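(* Let $(M^{n},\langle\cdot,\cdot\rangle)$ be a simply connected $n$-dimensional Riemannian manifold and let $f:(M^{n},\langle\cdot,\cdot\rangle)\rightarrow\mathbb{R}^{n+1}$ be an isometric immersion with shape operator $A$ associated with a unit normal vector field $N$. Let $Q$ be a non-singular Codazzi tensor on $(M^{n},\langle\cdot,\cdot\rangle)$, and let $\widetilde{\langle\cdot,\cdot\rangle}$ be the Riemannian metric on $M^{n}$ given by $\widetilde{\langle X,Y\rangle}=\langle Q^{2}X,Y\rangle$ for all tangent vector fields $X,Y$. Assume that $\operatorname{rank}A\geq 3$ (at every point of $M^n$). Then: (i) The Riemannian manifold $(M^{n},\widetilde{\langle\cdot,\cdot\rangle})$ admits an isometric immersion into $\mathbb{R}^{n+1}$ if and only if $Q$ commutes with $A$, i.e. $Q\circ A=A\circ Q$. Moreover, if $\widetilde{f}:(M^{n},\widetilde{\langle\cdot,\cdot\rangle})\rightarrow\mathbb{R}^{n+1}$ is such an isometric immersion, then $\widetilde{f}$ is rigid and its shape operator is $\widetilde{A}=\pm Q^{-1}\circ A$. (ii) If $Q$ commutes with $A$, then there exist smooth functions $g,h:M^{n}\rightarrow\mathbb{R}$ such that $A(\operatorname{grad}g)=-\operatorname{grad}h$ and $QX=\nabla_{X}\operatorname{grad}g-hAX$ for every tangent vector field $X$, and moreover such that, setting $F=df(\operatorname{grad}g)+hN:M^{n}\rightarrow\mathbb{R}^{n+1}$, every isometric immersion $\widetilde{f}:(M^{n},\widetilde{\langle\cdot,\cdot\rangle})\rightarrow\mathbb{R}^{n+1}$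 is of the form $\widetilde{f}=\tau\circ F$ for some isometry $\tau$ of $\mathbb{R}^{n+1}$.
   Context: All manifolds, metrics, tensor fields and immersions are smooth; simply connected manifolds are understood to be connected. $\nabla$ denotes the Levi-Civita connection of $\langle\cdot,\cdot\rangle$, and $\operatorname{grad}$ denotes the gradient with respect to $\langle\cdot,\cdot\rangle$. Shape operator: let $f:(M^n,\langle\cdot,\cdot\rangle)\to\mathbb{R}^{n+1}$ be an isometric immersion, $N$ a unit normal vector field along $f$, and $\overline{\nabla}$ the connection on the induced bundle $f^{*}(T\mathbb{R}^{n+1})$ arising from the usual flat connection of $\mathbb{R}^{n+1}$. The shape operator $A$ associated with $N$ is the $(1,1)$-tensor field, self-adjoint with respect to $\langle\cdot,\cdot\rangle$, determined by the Weingarten formula $\overline{\nabla}_{X}N=-df(AX)$; equivalently, by the Gauss formula $\overline{\nabla}_{X}df(Y)=df(\nabla_{X}Y)+\langle AX,Y\rangle N$. The shape operator $\widetilde{A}$ of an isometric immersion $\widetilde{f}$ of $(M^n,\widetilde{\langle\cdot,\cdot\rangle})$ is defined in the same way, using a unit normal vector field along $\widetilde{f}$; the sign in $\pm$ corresponds to the choice of this unit normal. Codazzi tensor: a $(1,1)$-tensor field $Q$ on $(M^{n},\langle\cdot,\cdot\rangle)$ that is self-adjoint with respect to $\langle\cdot,\cdot\rangle$ and satisfies $(\nabla_{X}Q)Y=(\nabla_{Y}Q)X$ for all tangent vector fields $X,Y$, where $(\nabla_XQ)Y=\nabla_X(QY)-Q(\nabla_XY)$. It is non-singular if it is invertible at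 every point (it is not required to be positive definite). Rigid: an isometric immersion $\widetilde{f}$ of $(M^n,\widetilde{\langle\cdot,\cdot\rangle})$ into $\mathbb{R}^{n+1}$ is rigid if every other isometric immersion of $(M^n,\widetilde{\langle\cdot,\cdot\rangle})$ into $\mathbb{R}^{n+1}$ coincides with $\widetilde{f}$ up to composition with an isometry of $\mathbb{R}^{n+1}$. In the formula $F=df(\operatorname{grad}g)+hN$, the right-hand side is a section of $f^{*}(T\mathbb{R}^{n+1})$, regarded as an $\mathbb{R}^{n+1}$-valued map on $M^n$ via the canonical identification of the tangent spaces of $\mathbb{R}^{n+1}$ with $\mathbb{R}^{n+1}$. *)

theory Defs
  imports "HOL-Analysis.Analysis"
begin

section \<open>Smooth maps between Euclidean spaces\<close>

(* Only meaningful for open S; an induction over iterated directional derivatives. *)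
primrec Ck_on :: "nat \<Rightarrow> 'a::real_normed_vector set \<Rightarrow> ('a \<Rightarrow> 'b::real_normed_vector) \<Rightarrow> bool" where
  "Ck_on 0 S f \<longleftrightarrow> continuous_on S f"
| "Ck_on (Suc k) S f \<longleftrightarrow>
     (\<forall>x\<in>S. f differentiable (at x)) \<and> (\<forall>v. Ck_on k S (\<lambda>x. frechet_derivative f (at x) v))"

definition smooth_on :: "'a::real_normed_vector set \<Rightarrow> ('a \<Rightarrow> 'b::real_normed_vector) \<Rightarrow> bool" where
  "smooth_on S f \<longleftrightarrow> (\<forall>k. Ck_on k S f)"


section \<open>Smooth manifolds\<close>

(* The manifold is a whole (Hausdorff, second countable) topological type 'm, of dimension CARD('n).
   A chart is a pair (U, \<phi>); the values of \<phi> outside U are irrelevant. *)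
type_synonym ('m, 'n) chart = "'m set \<times> ('m \<Rightarrow> (real, 'n) vec)"

definition chart_inv :: "('m, 'n::finite) chart \<Rightarrow> real ^ 'n \<Rightarrow> 'm" where
  "chart_inv c = inv_into (fst c) (snd c)"

definition smooth_atlas ::
  "('m::{t2_space, second_countable_topology}, 'n::finite) chart set \<Rightarrow> bool" where
  "smooth_atlas \<A> \<longleftrightarrow>
     (\<Union>c\<in>\<A>. fst c) = UNIV \<and>
     (\<forall>c\<in>\<A>. open (fst c) \<and> open (snd c ` fst c) \<and>
        homeomorphism (fst c) (snd c ` fst c) (snd c) (chart_inv c)) \<and>
     (\<forall>c\<in>\<A>. \<forall>d\<in>\<A>. smooth_on (snd c ` (fst c \<inter> fst d)) (snd d \<circ> chart_inv c))"

definition smooth_map ::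
  "('m, 'n::finite) chart set \<Rightarrow> ('m \<Rightarrow> 'b::real_normed_vector) \<Rightarrow> bool" where
  "smooth_map \<A> u \<longleftrightarrow> (\<forall>c\<in>\<A>. smooth_on (snd c ` fst c) (u \<circ> chart_inv c))"


section \<open>Tangent vectors and tensor fields\<close>

(* One preferred chart around each point p is chosen, and the tangent space at p is identified with
   real ^ 'n through that chart. Thus a vector field is a map 'm \<Rightarrow> real ^ 'n and a field
   of endomorphisms is a map 'm \<Rightarrow> real ^ 'n \<Rightarrow> real ^ 'n. As the preferred chart may jump
   from point to point, smoothness of such fields is never smoothness of these maps themselves. *)
definition chart_at :: "('m, 'n) chart set \<Rightarrow> 'm \<Rightarrow> ('m, 'n) chart" where
  "chart_at \<A> p = (SOME c. c \<in> \<A> \<and> p \<in> fst c)"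

definition dM ::
  "('m, 'n::finite) chart set \<Rightarrow> ('m \<Rightarrow> 'b::real_normed_vector) \<Rightarrow> 'm \<Rightarrow> real ^ 'n \<Rightarrow> 'b" where
  "dM \<A> u p v =
     frechet_derivative (u \<circ> chart_inv (chart_at \<A> p)) (at (snd (chart_at \<A> p) p)) v"

(* dM \<A> (snd c) p v is the coordinate vector, with respect to the chart c, of the
   tangent vector v at p. *)
definition smooth_vector_field ::
  "('m, 'n::finite) chart set \<Rightarrow> ('m \<Rightarrow> real ^ 'n) \<Rightarrow> bool" where
  "smooth_vector_field \<A> X \<longleftrightarrow>
     (\<forall>c\<in>\<A>. smooth_on (snd c ` fst c)
        (\<lambda>x. dM \<A> (snd c) (chart_inv c x) (X (chart_inv c x))))"

definition tensor_field_11 ::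
  "('m, 'n::finite) chart set \<Rightarrow> ('m \<Rightarrow> real ^ 'n \<Rightarrow> real ^ 'n) \<Rightarrow> bool" where
  "tensor_field_11 \<A> T \<longleftrightarrow>
     (\<forall>p. linear (T p)) \<and>
     (\<forall>X. smooth_vector_field \<A> X \<longrightarrow> smooth_vector_field \<A> (\<lambda>p. T p (X p)))"


section \<open>Riemannian geometry\<close>

definition riemannian_metric ::
  "('m, 'n::finite) chart set \<Rightarrow> ('m \<Rightarrow> real ^ 'n \<Rightarrow> real ^ 'n \<Rightarrow> real) \<Rightarrow> bool" where
  "riemannian_metric \<A> met \<longleftrightarrow>
     (\<forall>p. bilinear (met p) \<and> (\<forall>v w. met p v w = met p w v) \<and> (\<forall>v. v \<noteq> 0 \<longrightarrow> met p v v > 0)) \<and>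
     (\<forall>X Y. smooth_vector_field \<A> X \<and> smooth_vector_field \<A> Y \<longrightarrow>
        smooth_map \<A> (\<lambda>p. met p (X p) (Y p)))"

definition affine_connection ::
  "('m, 'n::finite) chart set \<Rightarrow>
   (('m \<Rightarrow> real ^ 'n) \<Rightarrow> ('m \<Rightarrow> real ^ 'n) \<Rightarrow> ('m \<Rightarrow> real ^ 'n)) \<Rightarrow> bool" where
  "affine_connection \<A> nabla \<longleftrightarrow>
     (\<forall>X Y. smooth_vector_field \<A> X \<and> smooth_vector_field \<A> Y \<longrightarrow>
        smooth_vector_field \<A> (nabla X Y)) \<and>
     (\<forall>X X' Y u. smooth_vector_field \<A> X \<and> smooth_vector_field \<A> X' \<and> smooth_vector_field \<A> Y \<and>
        smooth_map \<A> (u :: 'm \<Rightarrow> real) \<longrightarrow>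
        (\<forall>p. nabla (\<lambda>q. u q *\<^sub>R X q + X' q) Y p = u p *\<^sub>R nabla X Y p + nabla X' Y p)) \<and>
     (\<forall>X Y Y' u. smooth_vector_field \<A> X \<and> smooth_vector_field \<A> Y \<and> smooth_vector_field \<A> Y' \<and>
        smooth_map \<A> (u :: 'm \<Rightarrow> real) \<longrightarrow>
        (\<forall>p. nabla X (\<lambda>q. u q *\<^sub>R Y q + Y' q) p =
           dM \<A> u p (X p) *\<^sub>R Y p + u p *\<^sub>R nabla X Y p + nabla X Y' p))"

(* Torsion-freeness, nabla X Y - nabla Y X = [X, Y], is expressed through the action of both sides
   as derivations on smooth functions, where [X, Y] u = X (Y u) - Y (X u). *)
definition levi_civita_connection ::
  "('m, 'n::finite) chart set \<Rightarrow> ('m \<Rightarrow> real ^ 'n \<Rightarrow> real ^ 'n \<Rightarrow> real) \<Rightarrow>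
   (('m \<Rightarrow> real ^ 'n) \<Rightarrow> ('m \<Rightarrow> real ^ 'n) \<Rightarrow> ('m \<Rightarrow> real ^ 'n)) \<Rightarrow> bool" where
  "levi_civita_connection \<A> met nabla \<longleftrightarrow>
     affine_connection \<A> nabla \<and>
     (\<forall>X Y u. smooth_vector_field \<A> X \<and> smooth_vector_field \<A> Y \<and> smooth_map \<A> (u :: 'm \<Rightarrow> real) \<longrightarrow>
        (\<forall>p. dM \<A> u p (nabla X Y p - nabla Y X p) =
           dM \<A> (\<lambda>q. dM \<A> u q (Y q)) p (X p) - dM \<A> (\<lambda>q. dM \<A> u q (X q)) p (Y p))) \<and>
     (\<forall>X Y Z. smooth_vector_field \<A> X \<and> smooth_vector_field \<A> Y \<and> smooth_vector_field \<A> Z \<longrightarrow>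
        (\<forall>p. dM \<A> (\<lambda>q. met q (Y q) (Z q)) p (X p) =
           met p (nabla X Y p) (Z p) + met p (Y p) (nabla X Z p)))"

definition grad ::
  "('m, 'n::finite) chart set \<Rightarrow> ('m \<Rightarrow> real ^ 'n \<Rightarrow> real ^ 'n \<Rightarrow> real) \<Rightarrow>
   ('m \<Rightarrow> real) \<Rightarrow> 'm \<Rightarrow> real ^ 'n" where
  "grad \<A> met u p = (THE w. \<forall>v. met p w v = dM \<A> u p v)"

definition self_adjoint_field ::
  "('m \<Rightarrow> real ^ 'n::finite \<Rightarrow> real ^ 'n \<Rightarrow> real) \<Rightarrow> ('m \<Rightarrow> real ^ 'n \<Rightarrow> real ^ 'n) \<Rightarrow> bool" where
  "self_adjoint_field met T \<longleftrightarrow> (\<forall>p v w. met p (T p v) w = met p v (T p w))"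

definition codazzi_tensor ::
  "('m, 'n::finite) chart set \<Rightarrow> ('m \<Rightarrow> real ^ 'n \<Rightarrow> real ^ 'n \<Rightarrow> real) \<Rightarrow>
   (('m \<Rightarrow> real ^ 'n) \<Rightarrow> ('m \<Rightarrow> real ^ 'n) \<Rightarrow> ('m \<Rightarrow> real ^ 'n)) \<Rightarrow>
   ('m \<Rightarrow> real ^ 'n \<Rightarrow> real ^ 'n) \<Rightarrow> bool" where
  "codazzi_tensor \<A> met nabla Q \<longleftrightarrow>
     tensor_field_11 \<A> Q \<and> self_adjoint_field met Q \<and>
     (\<forall>X Y. smooth_vector_field \<A> X \<and> smooth_vector_field \<A> Y \<longrightarrow>
        (\<forall>p. nabla X (\<lambda>q. Q q (Y q)) p - Q p (nabla X Y p) =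
             nabla Y (\<lambda>q. Q q (X q)) p - Q p (nabla Y X p)))"


section \<open>Isometric immersions into Euclidean space\<close>

definition isometric_immersion ::
  "('m, 'n::finite) chart set \<Rightarrow> ('m \<Rightarrow> real ^ 'n \<Rightarrow> real ^ 'n \<Rightarrow> real) \<Rightarrow>
   ('m \<Rightarrow> real ^ 'k::finite) \<Rightarrow> bool" where
  "isometric_immersion \<A> met f \<longleftrightarrow>
     smooth_map \<A> f \<and> (\<forall>p. inj (dM \<A> f p)) \<and>
     (\<forall>p v w. inner (dM \<A> f p v) (dM \<A> f p w) = met p v w)"

definition unit_normal_field ::
  "('m, 'n::finite) chart set \<Rightarrow> ('m \<Rightarrow> real ^ 'k::finite) \<Rightarrow> ('m \<Rightarrow> real ^ 'k) \<Rightarrow> bool" where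
  "unit_normal_field \<A> f N \<longleftrightarrow>
     smooth_map \<A> N \<and> (\<forall>p. norm (N p) = 1) \<and> (\<forall>p v. inner (N p) (dM \<A> f p v) = 0)"

(* The flat connection on the induced bundle is componentwise differentiation, so the covariant
   derivative of N in the direction v is dM \<A> N p v (Weingarten formula). *)
definition shape_operator ::
  "('m, 'n::finite) chart set \<Rightarrow> ('m \<Rightarrow> real ^ 'n \<Rightarrow> real ^ 'n \<Rightarrow> real) \<Rightarrow>
   ('m \<Rightarrow> real ^ 'k::finite) \<Rightarrow> ('m \<Rightarrow> real ^ 'k) \<Rightarrow> ('m \<Rightarrow> real ^ 'n \<Rightarrow> real ^ 'n) \<Rightarrow> bool" where
  "shape_operator \<A> met f N A \<longleftrightarrow>
     tensor_field_11 \<A> A \<and> self_adjoint_field met A \<and>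
     (\<forall>p v. dM \<A> N p v = - dM \<A> f p (A p v))"

definition euclidean_isometry :: "(real ^ 'k::finite \<Rightarrow> real ^ 'k) \<Rightarrow> bool" where
  "euclidean_isometry \<tau> \<longleftrightarrow> surj \<tau> \<and> (\<forall>x y. dist (\<tau> x) (\<tau> y) = dist x y)"

definition rigid ::
  "('m, 'n::finite) chart set \<Rightarrow> ('m \<Rightarrow> real ^ 'n \<Rightarrow> real ^ 'n \<Rightarrow> real) \<Rightarrow>
   ('m \<Rightarrow> real ^ 'k::finite) \<Rightarrow> bool" where
  "rigid \<A> met f \<longleftrightarrow>
     (\<forall>f' :: 'm \<Rightarrow> real ^ 'k. isometric_immersion \<A> met f' \<longrightarrow>
        (\<exists>\<tau>. euclidean_isometry \<tau> \<and> f' = \<tau> \<circ> f))"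

end

theory Submission
  imports Defs
begin

text \<open>Tensors are extended from the tangent spaces to the ambient space through \<open>df\<close> and the unit
  normal, which turns the Codazzi equations of \<open>Q\<close> and \<open>A\<close> into statements about differentials of
  matrix-valued functions. If \<open>Q\<close> commutes with \<open>A\<close>, the \<open>\<real>\<^sup>n\<^sup>+\<^sup>1\<close>-valued one-form
  \<open>df \<circ> Q\<close> is closed; a primitive \<open>F\<close> of it is the required immersion, \<open>g\<close> is a primitive of the
  closed form \<open>\<langle>F, df\<rangle>\<close>, and \<open>h = \<langle>F, N\<rangle>\<close>.

  Conversely, let \<open>ft\<close> be an immersion with normal \<open>Nt\<close> inducing the new metric, and let \<open>R\<close> be the
  orthogonal-matrix-valued function with \<open>d(ft) = R \<circ> df \<circ> Q\<close> and \<open>R N = Nt\<close>. Closedness of \<open>d(ft)\<close> and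
  the Codazzi equation of \<open>Q\<close> force \<open>R\<^sup>-\<^sup>1 dR\<close> to interchange tangent and normal directions, and its
  flatness says that \<open>C = Q \<circ> At\<close>, with \<open>At\<close> the shape operator of \<open>ft\<close>, satisfies
  \<open>CX \<and> CY = AX \<and> AY\<close>. As \<open>A\<close> has rank at least three, \<open>C = \<plusminus>A\<close>. After choosing the sign of \<open>Nt\<close>
  this gives \<open>dR = 0\<close>, so \<open>ft\<close> and \<open>F\<close> are congruent.\<close>

section \<open>Closure properties of smooth maps\<close>

text \<open>A tangent vector is recorded in a preferred chart that may jump from point to point, so
  vector fields and tensors cannot be differentiated as functions on the manifold. Vectors
  \<open>df p (X p)\<close> and matrices \<open>ambient T p\<close> form smooth maps in the plain
  sense, to which \<open>dM\<close> applies; the Levi-Civita connection is reached from them through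
  the Gauss formula and \<open>bracket\<close>. Three passages from local to global shape the rest.
  The homotopies provided by simple connectedness are merely continuous, so a closed form cannot be
  integrated along them; instead its local primitives are continued along continuous maps of the
  unit square. The immersion \<open>ft\<close> comes without a normal, and a smooth one must be
  produced on the whole manifold: the given \<open>N\<close> fixes the orientation, and a
  determinant then selects one of the two unit normals at each point. Finally, linear algebra yields
  \<open>C = \<plusminus>A\<close> with a sign that might depend on the point; connectedness makes
  it constant, because \<open>A\<close> vanishes nowhere.\<close>

lemma Ck_on_cong:
  assumes "open S" "\<And>x. x \<in> S \<Longrightarrow> f x = g x" "Ck_on k S f"
  shows "Ck_on k S g"
  using assms(2,3)
proof (induction k arbitrary: f g)
  case 0
  then show ?case by (auto intro: continuous_on_eq)
next
  case (Suc k)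
  have eq: "frechet_derivative f (at x) = frechet_derivative g (at x)" if "x \<in> S" for x
    using Suc.prems that assms(1) frechet_derivative_transform_within_open[of f x S g] by simp
  have "g differentiable (at x)" if "x \<in> S" for x
    using Suc.prems that assms(1)
    by (metis Ck_on.simps(2) differentiable_def has_derivative_transform_within_open)
  moreover have "Ck_on k S (\<lambda>x. frechet_derivative g (at x) v)" for v
    using Suc.IH[of "\<lambda>x. frechet_derivative f (at x) v" "\<lambda>x. frechet_derivative g (at x) v"] Suc.prems eq
    by simp
  ultimately show ?case by simp
qed

lemma Ck_on_Suc_D: "Ck_on (Suc k) S f \<Longrightarrow> Ck_on k S f"
proof (induction k arbitrary: f)
  case 0
  then show ?case
    by (auto intro!: continuous_at_imp_continuous_on differentiable_imp_continuous_within)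
next
  case (Suc k)
  then show ?case by (metis Ck_on.simps(2))
qed

lemma Ck_on_subset: "Ck_on k S f \<Longrightarrow> T \<subseteq> S \<Longrightarrow> Ck_on k T f"
  by (induction k arbitrary: f) (auto intro: continuous_on_subset)

text \<open>Any explicit formula for the derivative may stand in for
  \<open>frechet_derivative\<close>, so closure properties become inductions on the order along the
  usual differentiation rules.\<close>

lemma Ck_on_SucI:
  assumes "open S" "\<And>x. x \<in> S \<Longrightarrow> (f has_derivative f' x) (at x)"
    and "\<And>v. Ck_on k S (\<lambda>x. f' x v)"
  shows "Ck_on (Suc k) S f"
  unfolding Ck_on.simps
proof (intro conjI ballI allI)
  fix x assume "x \<in> S" then show "f differentiable (at x)"
    using assms(2) differentiableI by blast
next
  fix v
  have "f' x v = frechet_derivative f (at x) v" if "x \<in> S" for x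
    using assms(2)[OF that] frechet_derivative_at by metis
  then show "Ck_on k S (\<lambda>x. frechet_derivative f (at x) v)"
    using Ck_on_cong[OF assms(1), of "\<lambda>x. f' x v" "\<lambda>x. frechet_derivative f (at x) v"] assms(3) by simp
qed

lemma Ck_on_has_derivative:
  assumes "Ck_on (Suc k) S f" "x \<in> S"
  shows "(f has_derivative frechet_derivative f (at x)) (at x)"
  using assms frechet_derivative_works by auto

lemma Ck_on_const: "Ck_on k S (\<lambda>x. c)"
  by (induction k arbitrary: c) auto

lemma Ck_on_add:
  assumes "open S" "Ck_on k S f" "Ck_on k S g"
  shows "Ck_on k S (\<lambda>x. f x + g x)"
  using assms(2,3)
proof (induction k arbitrary: f g)
  case 0
  then show ?case by (simp add: continuous_on_add)
next
  case (Suc k)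
  show ?case
    by (rule Ck_on_SucI[OF assms(1) has_derivative_add[OF Ck_on_has_derivative Ck_on_has_derivative]])
      (use Suc in auto)
qed

lemma (in bounded_linear) Ck_on_compose:
  assumes "open S" "Ck_on k S g"
  shows "Ck_on k S (\<lambda>x. f (g x))"
  using assms(2)
proof (induction k arbitrary: g)
  case 0
  then show ?case by (auto intro: continuous_on)
next
  case (Suc k)
  show ?case
    by (rule Ck_on_SucI[OF assms(1) has_derivative[OF Ck_on_has_derivative]])
      (use Suc in auto)
qed

lemma (in bounded_bilinear) Ck_on_prod:
  assumes "open S" "Ck_on k S f" "Ck_on k S g"
  shows "Ck_on k S (\<lambda>x. prod (f x) (g x))"
  using assms(2,3)
proof (induction k arbitrary: f g)
  case 0
  then show ?case by (auto intro: continuous_on)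
next
  case (Suc k)
  show ?case
  proof (rule Ck_on_SucI[OF assms(1) FDERIV[OF Ck_on_has_derivative Ck_on_has_derivative]])
    fix v
    have "Ck_on k S (\<lambda>x. prod (f x) (frechet_derivative g (at x) v))"
      "Ck_on k S (\<lambda>x. prod (frechet_derivative f (at x) v) (g x))"
      using Suc Ck_on_Suc_D[OF Suc.prems(1)] Ck_on_Suc_D[OF Suc.prems(2)] by auto
    then show "Ck_on k S (\<lambda>x. prod (f x) (frechet_derivative g (at x) v) + prod (frechet_derivative f (at x) v) (g x))"
      by (rule Ck_on_add[OF assms(1)])
  qed (use Suc in auto)
qed

text \<open>The derivative of \<open>1/f\<close> is a product of \<open>df\<close> with two copies
  of \<open>1/f\<close> itself, so the induction runs on the order alone with \<open>f\<close>
  fixed.\<close>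

lemma Ck_on_inverse:
  fixes f :: "'a::real_normed_vector \<Rightarrow> real"
  assumes "open S" "Ck_on k S f" "\<And>x. x \<in> S \<Longrightarrow> f x \<noteq> 0"
  shows "Ck_on k S (\<lambda>x. inverse (f x))"
  using assms(2)
proof (induction k)
  case 0
  then show ?case using assms(3) by (simp add: continuous_on_inverse)
next
  case (Suc k)
  have inv: "Ck_on k S (\<lambda>x. inverse (f x))"
    using Suc Ck_on_Suc_D by blast
  show ?case
  proof (rule Ck_on_SucI[OF assms(1) Deriv.has_derivative_inverse[OF _ Ck_on_has_derivative]])
    fix v
    have "Ck_on k S (\<lambda>x. frechet_derivative f (at x) v)" using Suc by simp
    then show "Ck_on k S (\<lambda>x. - (inverse (f x) * frechet_derivative f (at x) v * inverse (f x)))"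
      by (intro bounded_linear.Ck_on_compose[OF bounded_linear_minus[OF bounded_linear_ident] assms(1)]
          bounded_bilinear.Ck_on_prod[OF bounded_bilinear_mult assms(1)] inv)
  qed (use Suc assms in auto)
qed

section \<open>Smoothness of all orders, determinants and linear systems\<close>

lemma smooth_on_cong:
  "open S \<Longrightarrow> (\<And>x. x \<in> S \<Longrightarrow> f x = g x) \<Longrightarrow> smooth_on S f \<Longrightarrow> smooth_on S g"
  unfolding smooth_on_def by (metis Ck_on_cong)

lemma smooth_on_subset: "smooth_on S f \<Longrightarrow> T \<subseteq> S \<Longrightarrow> smooth_on T f"
  by (auto simp: smooth_on_def intro: Ck_on_subset)

lemma smooth_on_continuous_on: "smooth_on S f \<Longrightarrow> continuous_on S f"
  unfolding smooth_on_def by (metis Ck_on.simps(1))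

lemma smooth_on_has_derivative:
  "smooth_on S f \<Longrightarrow> x \<in> S \<Longrightarrow> (f has_derivative frechet_derivative f (at x)) (at x)"
  unfolding smooth_on_def by (rule Ck_on_has_derivative) auto

lemma smooth_on_frechet_derivative:
  "smooth_on S f \<Longrightarrow> smooth_on S (\<lambda>x. frechet_derivative f (at x) v)"
  unfolding smooth_on_def by (metis Ck_on.simps(2))

lemma smooth_onI_derivative:
  assumes "open S" "\<And>x. x \<in> S \<Longrightarrow> (f has_derivative f' x) (at x)"
    and "\<And>v. smooth_on S (\<lambda>x. f' x v)"
  shows "smooth_on S f"
  unfolding smooth_on_def
proof
  fix k
  have "Ck_on (Suc k) S f"
    by (rule Ck_on_SucI[OF assms(1,2)]) (use assms(3) in \<open>auto simp: smooth_on_def\<close>)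
  then show "Ck_on k S f" by (rule Ck_on_Suc_D)
qed

lemma smooth_on_const: "smooth_on S (\<lambda>x. c)"
  by (simp add: smooth_on_def Ck_on_const)

lemma smooth_on_add:
  "open S \<Longrightarrow> smooth_on S f \<Longrightarrow> smooth_on S g \<Longrightarrow> smooth_on S (\<lambda>x. f x + g x)"
  by (simp add: smooth_on_def Ck_on_add)

lemma (in bounded_linear) smooth_on_compose:
  "open S \<Longrightarrow> smooth_on S g \<Longrightarrow> smooth_on S (\<lambda>x. f (g x))"
  by (simp add: smooth_on_def Ck_on_compose)

lemma (in bounded_bilinear) smooth_on_prod:
  "open S \<Longrightarrow> smooth_on S f \<Longrightarrow> smooth_on S g \<Longrightarrow> smooth_on S (\<lambda>x. prod (f x) (g x))"
  by (simp add: smooth_on_def Ck_on_prod)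

lemma smooth_on_inverse:
  fixes f :: "'a::real_normed_vector \<Rightarrow> real"
  shows "open S \<Longrightarrow> smooth_on S f \<Longrightarrow> (\<And>x. x \<in> S \<Longrightarrow> f x \<noteq> 0) \<Longrightarrow> smooth_on S (\<lambda>x. inverse (f x))"
  by (simp add: smooth_on_def Ck_on_inverse)

lemma smooth_on_sum:
  assumes "open S" "\<And>i. i \<in> I \<Longrightarrow> smooth_on S (f i)"
  shows "smooth_on S (\<lambda>x. \<Sum>i\<in>I. f i x)"
  using assms by (induction I rule: infinite_finite_induct) (auto intro: smooth_on_const smooth_on_add)

lemma smooth_on_finite_prod:
  fixes f :: "'i \<Rightarrow> 'a::real_normed_vector \<Rightarrow> real"
  assumes "open S" "\<And>i. i \<in> I \<Longrightarrow> smooth_on S (f i)"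
  shows "smooth_on S (\<lambda>x. \<Prod>i\<in>I. f i x)"
  using assms by (induction I rule: infinite_finite_induct)
    (auto intro: smooth_on_const bounded_bilinear.smooth_on_prod[OF bounded_bilinear_mult])

lemma smooth_on_component:
  fixes f :: "'a::real_normed_vector \<Rightarrow> 'b::real_normed_vector ^ 'i::finite"
  assumes "open S" "smooth_on S f"
  shows "smooth_on S (\<lambda>x. f x $ i)"
  by (rule bounded_linear.smooth_on_compose[OF bounded_linear_vec_nth assms])

lemma bounded_linear_axis: "bounded_linear (axis i :: 'b::euclidean_space \<Rightarrow> 'b ^ 'i::finite)"
  by (rule linear_conv_bounded_linear[THEN iffD1], rule linearI) (auto simp: vec_eq_iff axis_def)

lemma vec_eq_sum_axis: "v = (\<Sum>i\<in>UNIV. axis i (v $ i))" for v :: "'b::euclidean_space ^ 'i::finite"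
  by (simp add: vec_eq_iff axis_def)

lemma smooth_on_vec:
  fixes f :: "'i::finite \<Rightarrow> 'a::real_normed_vector \<Rightarrow> 'b::euclidean_space"
  assumes "open S" "\<And>i. smooth_on S (f i)"
  shows "smooth_on S (\<lambda>x. \<chi> i. f i x)"
proof -
  have "smooth_on S (\<lambda>x. \<Sum>i\<in>UNIV. axis i (f i x))"
    by (rule smooth_on_sum[OF assms(1)])
      (rule bounded_linear.smooth_on_compose[OF bounded_linear_axis assms])
  moreover have "(\<Sum>i\<in>UNIV. axis i (f i x)) = (\<chi> i. f i x)" for x
    using vec_eq_sum_axis[of "\<chi> i. f i x"] by simp
  ultimately show ?thesis by simp
qed

lemma smooth_on_det:
  fixes f :: "'a::real_normed_vector \<Rightarrow> real ^ 'i ^ 'i::finite"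
  assumes "open S" "\<And>i j. smooth_on S (\<lambda>x. f x $ i $ j)"
  shows "smooth_on S (\<lambda>x. det (f x))"
  unfolding det_def
proof (rule smooth_on_sum[OF assms(1)])
  fix p :: "'i \<Rightarrow> 'i"
  have "smooth_on S (\<lambda>x. \<Prod>i\<in>UNIV. f x $ i $ p i)"
    by (rule smooth_on_finite_prod) (rule assms)+
  then show "smooth_on S (\<lambda>x. of_int (sign p) * (\<Prod>i\<in>UNIV. f x $ i $ p i))"
    by (rule bounded_linear.smooth_on_compose[OF bounded_linear_mult_right assms(1)])
qed

text \<open>By Cramer's rule the solution is a quotient of polynomials in the entries of
  \<open>G\<close> and \<open>b\<close>. Every later claim that something determined pointwise by an
  invertible system is smooth comes down to this.\<close>

lemma smooth_on_linear_system:
  fixes G :: "'a::real_normed_vector \<Rightarrow> real ^ 'i ^ 'i::finite"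
  assumes S: "open S" and G: "\<And>i j. smooth_on S (\<lambda>x. G x $ i $ j)" and b: "smooth_on S b"
    and det: "\<And>x. x \<in> S \<Longrightarrow> det (G x) \<noteq> 0" and eq: "\<And>x. x \<in> S \<Longrightarrow> G x *v y x = b x"
  shows "smooth_on S y"
proof -
  let ?y = "\<lambda>x. \<chi> k. det (\<chi> i j. if j = k then b x $ i else G x $ i $ j) * inverse (det (G x))"
  have "smooth_on S ?y"
  proof (rule smooth_on_vec[OF S], rule bounded_bilinear.smooth_on_prod[OF bounded_bilinear_mult S
        _ smooth_on_inverse[OF S smooth_on_det[OF S G] det]], rule smooth_on_det[OF S])
    fix k i j
    show "smooth_on S (\<lambda>x. (\<chi> i j. if j = k then b x $ i else G x $ i $ j) $ i $ j)"
      using G smooth_on_component[OF S b] by (cases "j = k") auto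
  qed
  moreover have "?y x = y x" if "x \<in> S" for x
    using cramer[OF det[OF that], of "y x" "b x"] eq[OF that] by (simp add: divide_inverse)
  ultimately show ?thesis using smooth_on_cong[OF S, of ?y y] by blast
qed

lemma smooth_on_frechet_derivative_field:
  fixes f :: "real ^ 'n::finite \<Rightarrow> 'b::real_normed_vector"
  assumes "open S" "smooth_on S f" "smooth_on S \<xi>"
  shows "smooth_on S (\<lambda>x. frechet_derivative f (at x) (\<xi> x))"
proof (rule smooth_on_cong[OF assms(1)])
  show "smooth_on S (\<lambda>x. \<Sum>i\<in>UNIV. \<xi> x $ i *\<^sub>R frechet_derivative f (at x) (axis i 1))"
    by (rule smooth_on_sum[OF assms(1)])
      (rule bounded_bilinear.smooth_on_prod[OF bounded_bilinear_scaleR assms(1)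
          smooth_on_component[OF assms(1,3)] smooth_on_frechet_derivative[OF assms(2)]])
next
  fix x assume "x \<in> S"
  then have lin: "linear (frechet_derivative f (at x))"
    using smooth_on_has_derivative[OF assms(2)] has_derivative_linear by blast
  have "\<xi> x = (\<Sum>i\<in>UNIV. \<xi> x $ i *\<^sub>R axis i 1)"
    using basis_expansion[of "\<xi> x"] by (simp add: scalar_mult_eq_scaleR)
  then have "frechet_derivative f (at x) (\<xi> x) = frechet_derivative f (at x) (\<Sum>i\<in>UNIV. \<xi> x $ i *\<^sub>R axis i 1)"
    by simp
  then show "(\<Sum>i\<in>UNIV. \<xi> x $ i *\<^sub>R frechet_derivative f (at x) (axis i 1)) = frechet_derivative f (at x) (\<xi> x)"
    by (simp add: linear_sum[OF lin] linear_scale[OF lin])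
qed

lemma bounded_bilinear_matrix_vector_mult:
  "bounded_bilinear ((*v) :: real ^ 'i::finite ^ 'j::finite \<Rightarrow> real ^ 'i \<Rightarrow> real ^ 'j)"
  unfolding bilinear_conv_bounded_bilinear[symmetric] bilinear_def
  by (auto intro!: linearI simp: vec_eq_iff matrix_vector_mult_def sum.distrib sum_distrib_left algebra_simps)

lemma bounded_bilinear_matrix_matrix_mult:
  "bounded_bilinear ((**) :: real ^ 'i::finite ^ 'j::finite \<Rightarrow> real ^ 'l::finite ^ 'i \<Rightarrow> real ^ 'l ^ 'j)"
  unfolding bilinear_conv_bounded_bilinear[symmetric] bilinear_def
  by (auto intro!: linearI simp: vec_eq_iff matrix_matrix_mult_def sum.distrib sum_distrib_left algebra_simps)

section \<open>The Poincare lemma\<close>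

lemma has_vector_derivative_along_line:
  assumes "(f has_derivative f') (at (a + t *\<^sub>R v))"
  shows "((\<lambda>t. f (a + t *\<^sub>R v)) has_vector_derivative f' v) (at t within U)"
proof -
  have "((\<lambda>t. a + t *\<^sub>R v) has_derivative (\<lambda>h. h *\<^sub>R v)) (at t within U)"
    by (auto intro!: derivative_eq_intros)
  from has_derivative_compose[OF this assms]
  have "((\<lambda>t. f (a + t *\<^sub>R v)) has_derivative (\<lambda>h. f' (h *\<^sub>R v))) (at t within U)" .
  then show ?thesis
    using has_derivative_linear[OF assms] by (simp add: has_vector_derivative_def linear_scale)
qed

text \<open>One-sided derivatives are used because the integrals over \<open>{0..t}\<close> below
  are studied only for nonnegative \<open>t\<close>.\<close>

lemma vector_derivative_unique_at_0:
  fixes f :: "real \<Rightarrow> 'b::real_normed_vector"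
  assumes "(f has_vector_derivative a) (at 0 within {0..d})" "(f has_vector_derivative b) (at 0 within {0..d})" "d > 0"
  shows "a = b"
  using vector_derivative_unique_within_closed_interval[of 0 d 0 f a b] assms by auto

text \<open>The increment \<open>f (x + s v + t w) - f (x + s v)\<close> is the integral of the
  \<open>w\<close>-derivative over \<open>{0..t}\<close>. Differentiating in \<open>s\<close> at 0,
  under the integral sign, and then in \<open>t\<close> at 0 gives the two mixed
  derivatives.\<close>

lemma symmetric_second_derivative:
  fixes f :: "'a::real_normed_vector \<Rightarrow> 'b::banach"
  assumes S: "open S" and x: "x \<in> S" and f: "smooth_on S f"
  shows "frechet_derivative (\<lambda>y. frechet_derivative f (at y) v) (at x) w =
         frechet_derivative (\<lambda>y. frechet_derivative f (at y) w) (at x) v"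
proof -
  let ?D = "\<lambda>u y. frechet_derivative f (at y) u"
  let ?DD = "\<lambda>u y w. frechet_derivative (?D u) (at y) w"
  obtain e where e: "e > 0" "ball x e \<subseteq> S" using S x open_contains_ball by blast
  \<comment> \<open>For parameters of size at most \<open>d\<close> the displacement has norm at
    most \<open>d (norm v + norm w)\<close>, which is less than \<open>e\<close>. The summand 1
    keeps the denominator positive when both vectors vanish.\<close>
  define d where "d = e / (2 * (norm v + norm w + 1))"
  have pos: "norm v + norm w + 1 > 0" by (simp add: add_nonneg_pos)
  then have d: "d > 0" using e by (simp add: d_def)
  have small: "x + s *\<^sub>R v + t *\<^sub>R w \<in> S" if "\<bar>s\<bar> \<le> d" "\<bar>t\<bar> \<le> d" for s t
  proof -
    have "norm (s *\<^sub>R v + t *\<^sub>R w) \<le> \<bar>s\<bar> * norm v + \<bar>t\<bar> * norm w"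
      by (metis norm_scaleR norm_triangle_ineq)
    also have "\<dots> \<le> d * norm v + d * norm w"
      using that by (intro add_mono mult_right_mono) auto
    also have "\<dots> < d * (2 * (norm v + norm w + 1))"
      using d by (simp add: algebra_simps add_nonneg_pos)
    also have "\<dots> = e" using pos by (simp add: d_def)
    finally show ?thesis using e by (auto simp: dist_norm norm_minus_commute subset_iff add.assoc)
  qed
  have Dsm: "smooth_on S (?D u)" for u by (rule smooth_on_frechet_derivative[OF f])
  have DDc: "continuous_on S (\<lambda>y. ?DD u y z)" for u z
    by (rule smooth_on_continuous_on[OF smooth_on_frechet_derivative[OF Dsm]])
  have step: "((\<lambda>t. f (x + s *\<^sub>R v + t *\<^sub>R w)) has_vector_derivative ?D w (x + s *\<^sub>R v + t *\<^sub>R w)) (at t within U)"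
    if "\<bar>s\<bar> \<le> d" "\<bar>t\<bar> \<le> d" for s t U
    by (rule has_vector_derivative_along_line[OF smooth_on_has_derivative[OF f small[OF that]]])
  have stepv: "((\<lambda>s. g (x + s *\<^sub>R v + t *\<^sub>R w)) has_vector_derivative frechet_derivative g (at (x + s *\<^sub>R v + t *\<^sub>R w)) v) (at s within U)"
    if "\<bar>s\<bar> \<le> d" "\<bar>t\<bar> \<le> d" "smooth_on S g" for s t U and g :: "'a \<Rightarrow> 'b"
  proof -
    have eq: "x + s *\<^sub>R v + t *\<^sub>R w = (x + t *\<^sub>R w) + s *\<^sub>R v" for s by simp
    show ?thesis
      unfolding eq using has_vector_derivative_along_line[of g _ "x + t *\<^sub>R w" s v]
        smooth_on_has_derivative[OF that(3) small[OF that(1,2)]] eq by metis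
  qed
  have integral_w: "integral {0..t} (\<lambda>\<tau>. ?D w (x + s *\<^sub>R v + \<tau> *\<^sub>R w)) = f (x + s *\<^sub>R v + t *\<^sub>R w) - f (x + s *\<^sub>R v)"
    if "s \<in> {-d..d}" "t \<in> {0..d}" for s t
  proof -
    have "((\<lambda>\<tau>. ?D w (x + s *\<^sub>R v + \<tau> *\<^sub>R w)) has_integral (f (x + s *\<^sub>R v + t *\<^sub>R w) - f (x + s *\<^sub>R v + 0 *\<^sub>R w))) {0..t}"
      by (rule fundamental_theorem_of_calculus) (use that step in \<open>auto simp: abs_le_iff\<close>)
    then show ?thesis by (simp add: integral_unique)
  qed
  have cont2: "continuous_on ({-d..d} \<times> {-d..d}) (\<lambda>(s, \<tau>). g (x + s *\<^sub>R v + \<tau> *\<^sub>R w))"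
    if "continuous_on S g" for g :: "'a \<Rightarrow> 'b"
    unfolding case_prod_beta
    by (rule continuous_on_compose2[OF that]) (auto intro!: continuous_intros small simp: abs_le_iff)
  have key: "?D v (x + t *\<^sub>R w) - ?D v x = integral {0..t} (\<lambda>\<tau>. ?DD w (x + \<tau> *\<^sub>R w) v)" if t: "t \<in> {0..d}" for t
  proof -
    have "((\<lambda>s. integral (cbox 0 t) (\<lambda>\<tau>. ?D w (x + s *\<^sub>R v + \<tau> *\<^sub>R w))) has_vector_derivative
        integral (cbox 0 t) (\<lambda>\<tau>. ?DD w (x + 0 *\<^sub>R v + \<tau> *\<^sub>R w) v)) (at 0 within {0..d})"
    proof (rule leibniz_rule_vector_derivative[where fx = "\<lambda>s \<tau>. ?DD w (x + s *\<^sub>R v + \<tau> *\<^sub>R w) v"])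
      show "((\<lambda>s. ?D w (x + s *\<^sub>R v + \<tau> *\<^sub>R w)) has_vector_derivative ?DD w (x + s *\<^sub>R v + \<tau> *\<^sub>R w) v) (at s within {0..d})"
        if "s \<in> {0..d}" "\<tau> \<in> cbox 0 t" for s \<tau>
        by (rule stepv) (use that t Dsm in auto)
      show "(\<lambda>\<tau>. ?D w (x + s *\<^sub>R v + \<tau> *\<^sub>R w)) integrable_on cbox 0 t" if "s \<in> {0..d}" for s
      proof (rule integrable_continuous)
        show "continuous_on (cbox 0 t) (\<lambda>\<tau>. ?D w (x + s *\<^sub>R v + \<tau> *\<^sub>R w))"
          by (rule continuous_on_compose2[OF smooth_on_continuous_on[OF Dsm]])
            (use that t in \<open>auto intro!: continuous_intros small\<close>)
      qed
      show "continuous_on ({0..d} \<times> cbox 0 t) (\<lambda>(s, \<tau>). ?DD w (x + s *\<^sub>R v + \<tau> *\<^sub>R w) v)"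
        by (rule continuous_on_subset[OF cont2[OF DDc]]) (use t in auto)
    qed (use d in auto)
    then have 1: "((\<lambda>s. integral {0..t} (\<lambda>\<tau>. ?D w (x + s *\<^sub>R v + \<tau> *\<^sub>R w))) has_vector_derivative
        integral {0..t} (\<lambda>\<tau>. ?DD w (x + \<tau> *\<^sub>R w) v)) (at 0 within {0..d})" by simp
    have "((\<lambda>s. f (x + s *\<^sub>R v + t *\<^sub>R w) - f (x + s *\<^sub>R v + 0 *\<^sub>R w)) has_vector_derivative
        (?D v (x + 0 *\<^sub>R v + t *\<^sub>R w) - ?D v (x + 0 *\<^sub>R v + 0 *\<^sub>R w))) (at 0 within {0..d})"
      by (intro has_vector_derivative_diff stepv) (use t d f in auto)
    then have 2: "((\<lambda>s. f (x + s *\<^sub>R v + t *\<^sub>R w) - f (x + s *\<^sub>R v)) has_vector_derivative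
        (?D v (x + t *\<^sub>R w) - ?D v x)) (at 0 within {0..d})" by simp
    have "((\<lambda>s. integral {0..t} (\<lambda>\<tau>. ?D w (x + s *\<^sub>R v + \<tau> *\<^sub>R w))) has_vector_derivative
        (?D v (x + t *\<^sub>R w) - ?D v x)) (at 0 within {0..d})"
      by (rule has_vector_derivative_transform[OF _ _ 2]) (use d t integral_w in auto)
    then show ?thesis using 1 vector_derivative_unique_at_0 d by blast
  qed
  have "((\<lambda>t. integral {0..t} (\<lambda>\<tau>. ?DD w (x + \<tau> *\<^sub>R w) v)) has_vector_derivative ?DD w (x + 0 *\<^sub>R w) v) (at 0 within {0..d})"
  proof (rule integral_has_vector_derivative)
    show "continuous_on {0..d} (\<lambda>\<tau>. ?DD w (x + \<tau> *\<^sub>R w) v)"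
      by (rule continuous_on_compose2[OF DDc]) (use small[of 0] d in \<open>auto intro!: continuous_intros\<close>)
  qed (use d in auto)
  then have "((\<lambda>t. ?D v (x + t *\<^sub>R w) - ?D v x) has_vector_derivative ?DD w (x + 0 *\<^sub>R w) v) (at 0 within {0..d})"
    by (rule has_vector_derivative_transform[rotated 2]) (use d key in auto)
  moreover have "((\<lambda>t. ?D v (x + t *\<^sub>R w) - ?D v x) has_vector_derivative ?DD v (x + 0 *\<^sub>R w) w - 0) (at 0 within {0..d})"
    by (intro has_vector_derivative_diff has_vector_derivative_const has_vector_derivative_along_line
        smooth_on_has_derivative[OF Dsm]) (use x in auto)
  ultimately show ?thesis using vector_derivative_unique_at_0 d by force
qed

lemma linear_eq_sum_Basis:
  fixes L :: "'a::euclidean_space \<Rightarrow> 'b::real_vector"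
  assumes "linear L"
  shows "L v = (\<Sum>b\<in>Basis. (v \<bullet> b) *\<^sub>R L b)"
proof -
  have "L v = L (\<Sum>b\<in>Basis. (v \<bullet> b) *\<^sub>R b)" by (simp add: euclidean_representation)
  then show ?thesis by (simp add: linear_sum[OF assms] linear_scale[OF assms])
qed

text \<open>The primitive is the integral of the form along the segment from a fixed point
  \<open>a\<close> to \<open>x\<close>. By the symmetry hypothesis, its derivative in direction
  \<open>h\<close> has the integrand \<open>\<omega> (ray x t) h + t D h (ray x t) (x - a)\<close>,
  which is the \<open>t\<close>-derivative of \<open>t \<omega> (ray x t) h\<close> and so
  integrates to \<open>\<omega> x h\<close>.\<close>

lemma poincare_lemma:
  fixes \<omega> :: "'a::euclidean_space \<Rightarrow> 'a \<Rightarrow> 'b::banach"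
  assumes S: "open S" "convex S"
    and lin: "\<And>x. x \<in> S \<Longrightarrow> linear (\<omega> x)"
    and sm: "\<And>v. smooth_on S (\<lambda>x. \<omega> x v)"
    and sym: "\<And>x v w. x \<in> S \<Longrightarrow> frechet_derivative (\<lambda>y. \<omega> y v) (at x) w = frechet_derivative (\<lambda>y. \<omega> y w) (at x) v"
  shows "\<exists>P. \<forall>x\<in>S. (P has_derivative \<omega> x) (at x)"
proof (cases "S = {}")
  case False
  then obtain a where a: "a \<in> S" by blast
  define D where "D h y z = frechet_derivative (\<lambda>y. \<omega> y h) (at y) z" for h y z
  define ray where "ray x t = a + t *\<^sub>R (x - a)" for x t
  have ray: "ray x t \<in> S" if "x \<in> S" "t \<in> {0..1}" for x t
  proof -
    have "ray x t = (1 - t) *\<^sub>R a + t *\<^sub>R x" by (simp add: ray_def algebra_simps)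
    then show ?thesis using convexD_alt[OF S(2) a that(1), of t] that by simp
  qed
  have der: "((\<lambda>y. \<omega> y h) has_derivative D h y) (at y)" if "y \<in> S" for h y
    unfolding D_def using smooth_on_has_derivative[OF sm that] .
  have Dsym: "D h y z = D z y h" if "y \<in> S" for h y z
    using sym[OF that] by (simp add: D_def)
  have Dlin: "linear (D h y)" if "y \<in> S" for h y
    using der[OF that] has_derivative_linear by blast
  have Dlin': "linear (\<lambda>h. D h y z)" if "y \<in> S" for y z
  proof -
    have "(\<lambda>h. D h y z) = D z y" by (rule ext) (rule Dsym[OF that])
    then show ?thesis using Dlin[OF that, of z] by simp
  qed
  have contD: "continuous_on S (\<lambda>y. D h y z)" for h z
    unfolding D_def by (rule smooth_on_continuous_on[OF smooth_on_frechet_derivative[OF sm]])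
  have cont\<omega>: "continuous_on S (\<lambda>y. \<omega> y h)" for h
    by (rule smooth_on_continuous_on[OF sm])
  \<comment> \<open>Differentiating the integrand directly gives
    \<open>t D (x - a) (ray x t) h\<close>; it is stored with the two directions exchanged, the form
    that is a total derivative in \<open>t\<close>. \<open>Blinfun\<close> makes it a bounded linear
    map, as differentiation under the integral sign requires.\<close>
  define fx where "fx x t = Blinfun (\<lambda>h. \<omega> (ray x t) h + t *\<^sub>R D h (ray x t) (x - a))" for x t
  have fx: "blinfun_apply (fx x t) h = \<omega> (ray x t) h + t *\<^sub>R D h (ray x t) (x - a)"
    if "x \<in> S" "t \<in> {0..1}" for x t h
  proof -
    have "linear (\<lambda>h. \<omega> (ray x t) h + t *\<^sub>R D h (ray x t) (x - a))"
      by (rule linear_compose_add[OF lin[OF ray[OF that]]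
            linear_compose_scale_right[OF Dlin'[OF ray[OF that]]]])
    then show ?thesis
      unfolding fx_def using bounded_linear_Blinfun_apply linear_conv_bounded_linear by metis
  qed
  have contray: "continuous_on (S \<times> cbox 0 1) (\<lambda>z. ray (fst z) (snd z))"
    unfolding ray_def by (auto intro!: continuous_intros)
  have contfx: "continuous_on (S \<times> cbox 0 1) (\<lambda>(x, t). fx x t)"
  proof (rule continuous_on_blinfun_componentwise)
    fix h :: 'a
    have "continuous_on (S \<times> cbox 0 1) (\<lambda>z. \<omega> (ray (fst z) (snd z)) h + snd z *\<^sub>R
        (\<Sum>b\<in>Basis. ((fst z - a) \<bullet> b) *\<^sub>R D h (ray (fst z) (snd z)) b))"
      by (intro continuous_intros continuous_on_compose2[OF cont\<omega> contray]
          continuous_on_compose2[OF contD contray]) (auto simp: ray)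
    then show "continuous_on (S \<times> cbox 0 1) (\<lambda>z. blinfun_apply (case z of (x, t) \<Rightarrow> fx x t) h)"
      by (rule continuous_on_eq) (auto simp: fx linear_eq_sum_Basis[OF Dlin[OF ray], symmetric])
  qed
  define P where "P x = integral (cbox 0 1) (\<lambda>t. \<omega> (ray x t) (x - a))" for x
  have "(P has_derivative \<omega> x) (at x)" if x: "x \<in> S" for x
  proof -
    have "((\<lambda>x. integral (cbox 0 1) (\<lambda>t. \<omega> (ray x t) (x - a))) has_derivative
        blinfun_apply (integral (cbox 0 1) (fx x))) (at x within S)"
    proof (rule leibniz_rule[OF _ _ contfx x S(2)])
      fix y and t :: real assume y: "y \<in> S" "t \<in> cbox 0 1"
      then have t: "t \<in> {0..1}" by simp
      note r = ray[OF y(1) t]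
      have "((\<lambda>x. \<omega> (ray x t) b) has_derivative (\<lambda>h. t *\<^sub>R D b (ray y t) h)) (at y within S)" for b
      proof -
        have "((\<lambda>x. ray x t) has_derivative (\<lambda>h. t *\<^sub>R h)) (at y within S)"
          unfolding ray_def by (auto intro!: derivative_eq_intros)
        from has_derivative_compose[OF this der[OF r]] show ?thesis
          using Dlin[OF r] by (simp add: linear_scale)
      qed
      then have "((\<lambda>x. \<Sum>b\<in>Basis. ((x - a) \<bullet> b) *\<^sub>R \<omega> (ray x t) b) has_derivative
        (\<lambda>h. \<Sum>b\<in>Basis. ((y - a) \<bullet> b) *\<^sub>R (t *\<^sub>R D b (ray y t) h) + (h \<bullet> b) *\<^sub>R \<omega> (ray y t) b)) (at y within S)"
        by (auto intro!: derivative_eq_intros)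
      moreover have "(\<Sum>b\<in>Basis. ((y - a) \<bullet> b) *\<^sub>R (t *\<^sub>R D b (ray y t) h) + (h \<bullet> b) *\<^sub>R \<omega> (ray y t) b)
          = blinfun_apply (fx y t) h" for h
      proof -
        have "D h (ray y t) (y - a) = (\<Sum>b\<in>Basis. ((y - a) \<bullet> b) *\<^sub>R D b (ray y t) h)"
          using linear_eq_sum_Basis[OF Dlin[OF r], of h "y - a"] Dsym[OF r, of h] by simp
        moreover have "\<omega> (ray y t) h = (\<Sum>b\<in>Basis. (h \<bullet> b) *\<^sub>R \<omega> (ray y t) b)"
          by (rule linear_eq_sum_Basis[OF lin[OF r]])
        ultimately show ?thesis
          by (simp add: fx[OF y(1) t] sum.distrib scaleR_sum_right mult.commute)
      qed
      ultimately have "((\<lambda>x. \<Sum>b\<in>Basis. ((x - a) \<bullet> b) *\<^sub>R \<omega> (ray x t) b) has_derivative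
          blinfun_apply (fx y t)) (at y within S)" by (simp only:)
      then show "((\<lambda>x. \<omega> (ray x t) (x - a)) has_derivative blinfun_apply (fx y t)) (at y within S)"
        by (rule has_derivative_transform[OF y(1) _, rotated])
          (use linear_eq_sum_Basis[OF lin[OF ray[OF _ t]]] in blast)
    next
      fix y assume y: "y \<in> S"
      have "continuous_on (cbox 0 1) (\<lambda>t. \<omega> (ray y t) (y - a))"
        by (rule continuous_on_compose2[OF cont\<omega>]) (use ray[OF y] in \<open>auto simp: ray_def intro!: continuous_intros\<close>)
      then show "(\<lambda>t. \<omega> (ray y t) (y - a)) integrable_on cbox 0 1" by (rule integrable_continuous)
    qed
    moreover have "blinfun_apply (integral (cbox 0 1) (fx x)) = \<omega> x"
    proof
      fix h
      have "continuous_on (cbox 0 1) (fx x)"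
        using continuous_on_compose2[OF contfx, of "cbox 0 1" "\<lambda>t. (x, t)"] x
        by (simp add: continuous_on_Pair image_subset_iff)
      then have int: "fx x integrable_on cbox 0 1" by (rule integrable_continuous)
      have "((\<lambda>t. \<omega> (ray x t) h + t *\<^sub>R D h (ray x t) (x - a)) has_integral
          (1 *\<^sub>R \<omega> (ray x 1) h - 0 *\<^sub>R \<omega> (ray x 0) h)) {0..1}"
      proof (rule fundamental_theorem_of_calculus)
        fix t :: real assume t: "t \<in> {0..1}"
        have "((\<lambda>t. \<omega> (ray x t) h) has_vector_derivative D h (ray x t) (x - a)) (at t within {0..1})"
          unfolding ray_def by (rule has_vector_derivative_along_line) (use der[OF ray[OF x t]] in \<open>simp add: ray_def\<close>)
        then show "((\<lambda>t. t *\<^sub>R \<omega> (ray x t) h) has_vector_derivative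
          \<omega> (ray x t) h + t *\<^sub>R D h (ray x t) (x - a)) (at t within {0..1})"
          by (auto intro!: derivative_eq_intros simp: add.commute)
      qed simp
      then have "((\<lambda>t. blinfun_apply (fx x t) h) has_integral \<omega> x h) {0..1}"
        by (rule has_integral_eq_rhs[OF has_integral_eq[rotated]]) (simp_all add: ray_def fx[OF x])
      then have "integral {0..1} (\<lambda>t. blinfun_apply (fx x t) h) = \<omega> x h"
        by (rule integral_unique)
      then show "blinfun_apply (integral (cbox 0 1) (fx x)) h = \<omega> x h"
        using blinfun_apply_integral[OF int] by simp
    qed
    ultimately have "(P has_derivative \<omega> x) (at x within S)"
      unfolding P_def by (simp only:)
    then show ?thesis using S(1) x at_within_open by metis
  qed
  then show ?thesis by blast
qed auto

section \<open>Primitives along maps into a space with local primitives\<close>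

text \<open>A pair \<^term>\<open>(U, P)\<close> in the family \<^term>\<open>\<P>\<close> is a primitive of a fixed closed form on the open
  set \<^term>\<open>U\<close>; all that matters here is that two of them differ by a locally constant function.\<close>

locale local_primitives =
  fixes \<P> :: "('m::topological_space set \<times> ('m \<Rightarrow> 'b::real_normed_vector)) set"
  assumes open_domain: "(U, P) \<in> \<P> \<Longrightarrow> open U"
    and compat: "(U, P) \<in> \<P> \<Longrightarrow> (U', P') \<in> \<P> \<Longrightarrow> x \<in> U \<Longrightarrow> x \<in> U' \<Longrightarrow>
      \<exists>V c. open V \<and> x \<in> V \<and> (\<forall>y\<in>V. P y = P' y + c)"
    and cover: "\<exists>U P. (U, P) \<in> \<P> \<and> x \<in> U"
begin

text \<open>This is a primitive of the form pulled back by \<open>H\<close>, expressed without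
  derivatives: locally \<open>u\<close> is a primitive upstairs composed with \<open>H\<close>, up
  to a constant. It makes sense for a map \<open>H\<close> that is only continuous.\<close>

definition primitive_along :: "'z::topological_space set \<Rightarrow> ('z \<Rightarrow> 'm) \<Rightarrow> ('z \<Rightarrow> 'b) \<Rightarrow> bool" where
  "primitive_along K H u \<longleftrightarrow> (\<forall>z\<in>K. \<exists>W U P c. open W \<and> z \<in> W \<and> (U, P) \<in> \<P> \<and>
     (\<forall>y\<in>K \<inter> W. H y \<in> U \<and> u y = P (H y) + c))"

lemma primitive_alongE:
  assumes "primitive_along K H u" "z \<in> K"
  obtains W U P c where "open W" "z \<in> W" "(U, P) \<in> \<P>" "\<forall>y\<in>K \<inter> W. H y \<in> U \<and> u y = P (H y) + c"
proof -
  have "\<exists>W U P c. open W \<and> z \<in> W \<and> (U, P) \<in> \<P> \<and> (\<forall>y\<in>K \<inter> W. H y \<in> U \<and> u y = P (H y) + c)"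
    using assms unfolding primitive_along_def by (rule bspec)
  then show thesis using that by (elim exE conjE)
qed

text \<open>Restriction to a subset, reparametrization of a path and passage to a side of a square
  are all instances.\<close>

lemma primitive_along_compose:
  assumes "primitive_along K H u" and \<sigma>: "continuous_on K' \<sigma>" "\<sigma> ` K' \<subseteq> K"
    and "\<And>z. z \<in> K' \<Longrightarrow> H' z = H (\<sigma> z)"
  shows "primitive_along K' H' (\<lambda>z. u (\<sigma> z))"
  unfolding primitive_along_def
proof
  fix z assume z: "z \<in> K'"
  then have "\<sigma> z \<in> K" using \<sigma> by blast
  then obtain W U P c where W0: "open W" "\<sigma> z \<in> W" "(U, P) \<in> \<P>"
    "\<forall>y\<in>K \<inter> W. H y \<in> U \<and> u y = P (H y) + c"
    by (rule primitive_alongE[OF assms(1)])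
  note W = W0(1-3) W0(4)[rule_format, OF IntI]
  obtain W' where W': "open W'" "W' \<inter> K' = \<sigma> -` W \<inter> K'"
    using continuous_on_open_invariant[THEN iffD1, OF \<sigma>(1)] W(1) by blast
  have "z \<in> W'" using W'(2) W(2) z by blast
  moreover have "H' y \<in> U \<and> u (\<sigma> y) = P (H' y) + c" if "y \<in> K' \<inter> W'" for y
  proof -
    have "\<sigma> y \<in> K" "\<sigma> y \<in> W" using that W'(2) \<sigma>(2) by blast+
    then show ?thesis using W(4)[of "\<sigma> y"] assms(4)[of y] that by simp
  qed
  ultimately show "\<exists>W U P c. open W \<and> z \<in> W \<and> (U, P) \<in> \<P> \<and>
     (\<forall>y\<in>K' \<inter> W. H' y \<in> U \<and> u (\<sigma> y) = P (H' y) + c)"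
    using W' W(3) by (intro exI[of _ W'] exI[of _ U] exI[of _ P] exI[of _ c]) simp
qed

text \<open>The difference of two primitives along \<open>H\<close> is locally constant by
  \<open>compat\<close>, hence constant on a connected set.\<close>

lemma primitive_along_unique:
  assumes "primitive_along K H u" "primitive_along K H v"
    and H: "continuous_on K H" and K: "connected K" "a \<in> K" "b \<in> K"
  shows "u b - u a = v b - v a"
proof -
  have "u a - v a = u b - v b"
  proof (rule connected_local_const[OF K, of "\<lambda>z. u z - v z"], rule ballI)
    fix z assume z: "z \<in> K"
    obtain W U P c where W0: "open W" "z \<in> W" "(U, P) \<in> \<P>"
      "\<forall>y\<in>K \<inter> W. H y \<in> U \<and> u y = P (H y) + c"
      by (rule primitive_alongE[OF assms(1) z])
    note W = W0(1-3) W0(4)[rule_format, OF IntI]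
    obtain W' U' P' c' where W'0: "open W'" "z \<in> W'" "(U', P') \<in> \<P>"
      "\<forall>y\<in>K \<inter> W'. H y \<in> U' \<and> v y = P' (H y) + c'"
      by (rule primitive_alongE[OF assms(2) z])
    note W' = W'0(1-3) W'0(4)[rule_format, OF IntI]
    obtain V d where V: "open V" "H z \<in> V" "\<forall>y\<in>V. P y = P' y + d"
      using compat[OF W(3) W'(3), of "H z"] W(4)[OF z W(2)] W'(4)[OF z W'(2)] by blast
    obtain T where T: "open T" "T \<inter> K = H -` V \<inter> K"
      using continuous_on_open_invariant[THEN iffD1, OF H] V(1) by blast
    have "\<forall>y\<in>K \<inter> (W \<inter> W' \<inter> T). u y - v y = d + c - c'"
    proof
      fix y assume y: "y \<in> K \<inter> (W \<inter> W' \<inter> T)"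
      then have "H y \<in> V" using T(2) by blast
      then show "u y - v y = d + c - c'" using y W(4)[of y] W'(4)[of y] V(3) by simp
    qed
    moreover have "z \<in> T" using z V(2) T(2) by blast
    then have "z \<in> W \<inter> W' \<inter> T" using W W' by simp
    moreover have "open (W \<inter> W' \<inter> T)" using W(1) W'(1) T(1) by (intro open_Int)
    ultimately show "\<forall>\<^sub>F y in at z within K. u z - v z = u y - v y"
      unfolding eventually_at_topological using z by (intro exI[of _ "W \<inter> W' \<inter> T"]) simp
  qed
  then show ?thesis by (simp add: algebra_simps)
qed

text \<open>On the connected overlap the two primitives differ by a constant, and shifting
  \<open>v\<close> by it makes them agree there. Away from the overlap, closedness of the other set
  lets a neighbourhood avoid it.\<close>

lemma primitive_along_glue:
  assumes u: "primitive_along K H u" "primitive_along L H v"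
    and H: "continuous_on (K \<union> L) H" and KL: "closed K" "closed L" "connected (K \<inter> L)"
  shows "\<exists>w. primitive_along (K \<union> L) H w"
proof -
  have "\<exists>c. \<forall>z\<in>K \<inter> L. u z = v z + c"
  proof (cases "K \<inter> L = {}")
    case False
    then obtain a where a: "a \<in> K \<inter> L" by blast
    have "primitive_along (K \<inter> L) H u" "primitive_along (K \<inter> L) H v"
      using primitive_along_compose[OF u(1), of "K \<inter> L" "\<lambda>z. z" H]
        primitive_along_compose[OF u(2), of "K \<inter> L" "\<lambda>z. z" H] by auto
    then have "u z - u a = v z - v a" if "z \<in> K \<inter> L" for z
      using primitive_along_unique[of "K \<inter> L" H u v a z] continuous_on_subset[OF H, of "K \<inter> L"] KL(3) a that by auto
    then show ?thesis by (intro exI[of _ "u a - v a"]) (simp add: algebra_simps)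
  qed auto
  then obtain c where c: "\<And>z. z \<in> K \<Longrightarrow> z \<in> L \<Longrightarrow> u z = v z + c" by blast
  define w where "w z = (if z \<in> K then u z else v z + c)" for z
  have wK: "w z = u z" if "z \<in> K" for z using that by (simp add: w_def)
  have wL: "w z = v z + c" if "z \<in> L" for z using that c by (auto simp: w_def)
  have "primitive_along (K \<union> L) H w"
    unfolding primitive_along_def
  proof
    fix z assume "z \<in> K \<union> L"
    then consider "z \<in> K" "z \<notin> L" | "z \<notin> K" "z \<in> L" | "z \<in> K" "z \<in> L" by blast
    then show "\<exists>W U P c. open W \<and> z \<in> W \<and> (U, P) \<in> \<P> \<and>
        (\<forall>y\<in>(K \<union> L) \<inter> W. H y \<in> U \<and> w y = P (H y) + c)"
    proof cases
      case 1
      obtain W U P c where W0: "open W" "z \<in> W" "(U, P) \<in> \<P>"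
        "\<forall>y\<in>K \<inter> W. H y \<in> U \<and> u y = P (H y) + c"
        by (rule primitive_alongE[OF u(1) 1(1)])
      note W = W0(1-3) W0(4)[rule_format, OF IntI]
      have "open (W - L)" using W(1) KL(2) by (rule open_Diff)
      moreover have "H y \<in> U \<and> w y = P (H y) + c" if "y \<in> (K \<union> L) \<inter> (W - L)" for y
      proof -
        have "y \<in> K" "y \<in> W" using that by auto
        then show ?thesis using W(4)[of y] wK[of y] by simp
      qed
      then have "\<forall>y\<in>(K \<union> L) \<inter> (W - L). H y \<in> U \<and> w y = P (H y) + (c)" by (rule ballI)
      moreover have "z \<in> W - L" using W(2) 1 by simp
      ultimately show ?thesis using W(3) by blast
    next
      case 2
      obtain W U P d where W0: "open W" "z \<in> W" "(U, P) \<in> \<P>"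
        "\<forall>y\<in>L \<inter> W. H y \<in> U \<and> v y = P (H y) + d"
        by (rule primitive_alongE[OF u(2) 2(2)])
      note W = W0(1-3) W0(4)[rule_format, OF IntI]
      have "open (W - K)" using W(1) KL(1) by (rule open_Diff)
      moreover have "H y \<in> U \<and> w y = P (H y) + (d + c)" if "y \<in> (K \<union> L) \<inter> (W - K)" for y
      proof -
        have "y \<in> L" "y \<in> W" using that by auto
        then show ?thesis using W(4)[of y] wL[of y] by simp
      qed
      then have "\<forall>y\<in>(K \<union> L) \<inter> (W - K). H y \<in> U \<and> w y = P (H y) + (d + c)" by (rule ballI)
      moreover have "z \<in> W - K" using W(2) 2 by simp
      ultimately show ?thesis using W(3) by blast
    next
      case 3
      obtain W U P e where W0: "open W" "z \<in> W" "(U, P) \<in> \<P>"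
        "\<forall>y\<in>K \<inter> W. H y \<in> U \<and> u y = P (H y) + e"
        by (rule primitive_alongE[OF u(1) 3(1)])
      note W = W0(1-3) W0(4)[rule_format, OF IntI]
      obtain W' U' P' e' where W'0: "open W'" "z \<in> W'" "(U', P') \<in> \<P>"
        "\<forall>y\<in>L \<inter> W'. H y \<in> U' \<and> v y = P' (H y) + e'"
        by (rule primitive_alongE[OF u(2) 3(2)])
      note W' = W'0(1-3) W'0(4)[rule_format, OF IntI]
      obtain V d where V: "open V" "H z \<in> V" "\<forall>y\<in>V. P y = P' y + d"
        using compat[OF W(3) W'(3), of "H z"] W(4)[OF 3(1) W(2)] W'(4)[OF 3(2) W'(2)] by blast
      \<comment> \<open>Near a common point the description of \<open>u\<close> on the side of
        \<open>K\<close> must serve \<open>L\<close> as well. The set \<open>T\<close> keeps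
        \<open>H y\<close> inside \<open>U\<close> for \<open>y\<close> in \<open>L\<close>, and
        comparing both descriptions at \<open>z\<close> fixes the constant \<open>d\<close>.\<close>
      have "open U" using open_domain W(3) by blast
      then obtain T where T: "open T" "T \<inter> (K \<union> L) = H -` (V \<inter> U) \<inter> (K \<union> L)"
        using continuous_on_open_invariant[THEN iffD1, OF H] V(1) by blast
      have d: "d = e' + c - e"
        using W(4)[OF 3(1) W(2)] W'(4)[OF 3(2) W'(2)] c[OF 3] V by auto
      have "H y \<in> U \<and> w y = P (H y) + e" if y: "y \<in> (K \<union> L) \<inter> (W \<inter> W' \<inter> T)" for y
      proof (cases "y \<in> K")
        case True
        then show ?thesis using W(4)[of y] wK y by auto
      next
        case False
        then have "H y \<in> V" "H y \<in> U" "v y = P' (H y) + e'" "w y = v y + c"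
          using y T(2) W'(4)[of y] wL by auto
        then show ?thesis using V(3) d by auto
      qed
      moreover have "z \<in> T" using 3 V(2) T(2) W(4)[OF 3(1) W(2)] by blast
      then have "z \<in> W \<inter> W' \<inter> T" using W W' by simp
      moreover have "open (W \<inter> W' \<inter> T)" using W(1) W'(1) T(1) by (intro open_Int)
      ultimately show ?thesis
        using W(3) by (intro exI[of _ "W \<inter> W' \<inter> T"] exI[of _ U] exI[of _ P] exI[of _ e]) simp
    qed
  qed
  then show ?thesis by blast
qed

text \<open>Rectangles below the Lebesgue number of the cover map into a single domain, where a
  primitive is at hand. Bisection in one coordinate glues them into thin strips, and bisection in
  the other glues strips into the square; each overlap is a segment, hence connected.\<close>

lemma primitive_along_square:
  fixes H :: "real \<times> real \<Rightarrow> 'm"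
  assumes H: "continuous_on ({0..1} \<times> {0..1}) H"
  shows "\<exists>u. primitive_along ({0..1} \<times> {0..1}) H u"
proof -
  let ?Q = "{0..1} \<times> {0..1} :: (real \<times> real) set"
  \<comment> \<open>The premise inside \<open>E\<close> makes it hold vacuously for rectangles that
    stick out of the square, since \<open>Bolzano\<close> also asks about intervals reaching beyond
    the unit interval.\<close>
  define E where "E s s' t t' \<longleftrightarrow> (0 \<le> s \<and> s' \<le> 1 \<and> 0 \<le> t \<and> t' \<le> 1 \<longrightarrow>
    (\<exists>u. primitive_along ({s..s'} \<times> {t..t'}) H u))" for s s' t t'
  have contH: "continuous_on ({s..s'} \<times> {t..t'}) H" if "0 \<le> s" "s' \<le> 1" "0 \<le> t" "t' \<le> 1" for s s' t t'
    by (rule continuous_on_subset[OF H]) (use that in auto)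
  define \<C> where "\<C> = {T. open T \<and> (\<exists>U P. (U, P) \<in> \<P> \<and> T \<inter> ?Q \<subseteq> H -` U)}"
  obtain \<delta> where \<delta>: "\<delta> > 0" "\<And>T. T \<subseteq> ?Q \<Longrightarrow> diameter T < \<delta> \<Longrightarrow> \<exists>B\<in>\<C>. T \<subseteq> B"
  proof (rule Lebesgue_number_lemma[of ?Q \<C>])
    show "compact ?Q" by (intro compact_Times compact_Icc)
    show "?Q \<subseteq> \<Union>\<C>"
    proof
      fix z assume z: "z \<in> ?Q"
      obtain U P where U: "(U, P) \<in> \<P>" "H z \<in> U" using cover by blast
      obtain T where "open T" "T \<inter> ?Q = H -` U \<inter> ?Q"
        using continuous_on_open_invariant[THEN iffD1, OF H] open_domain[OF U(1)] by blast
      then have "T \<in> \<C>" "z \<in> T" using U z by (auto simp: \<C>_def)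
      then show "z \<in> \<Union>\<C>" by blast
    qed
    then show "\<C> \<noteq> {}" by force
  qed (auto simp: \<C>_def)
  \<comment> \<open>Sides below \<open>\<delta> / 4\<close> keep the diameter at most
    \<open>\<delta> / 2\<close>, hence strictly below the Lebesgue number.\<close>
  have small: "E s s' t t'" if st: "s' - s < \<delta> / 4" "t' - t < \<delta> / 4" for s s' t t'
    unfolding E_def
  proof
    assume *: "0 \<le> s \<and> s' \<le> 1 \<and> 0 \<le> t \<and> t' \<le> 1"
    let ?R = "{s..s'} \<times> {t..t'}"
    have "diameter ?R \<le> \<delta> / 2"
    proof (rule diameter_le)
      show "norm (x - y) \<le> \<delta> / 2" if "x \<in> ?R" "y \<in> ?R" for x y
      proof -
        have "norm (x - y) \<le> \<bar>fst x - fst y\<bar> + \<bar>snd x - snd y\<bar>"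
          using norm_Pair_le[of "fst x - fst y" "snd x - snd y"] by (simp add: minus_prod_def)
        also have "\<dots> \<le> \<delta> / 4 + \<delta> / 4"
        proof (rule add_mono)
          have "s \<le> fst x" "fst x \<le> s'" "s \<le> fst y" "fst y \<le> s'" using that by auto
          then show "\<bar>fst x - fst y\<bar> \<le> \<delta> / 4" using st by linarith
          have "t \<le> snd x" "snd x \<le> t'" "t \<le> snd y" "snd y \<le> t'" using that by auto
          then show "\<bar>snd x - snd y\<bar> \<le> \<delta> / 4" using st by linarith
        qed
        finally show ?thesis by simp
      qed
    qed (use \<delta> in auto)
    then have "diameter ?R < \<delta>" using \<delta>(1) by linarith
    moreover have sub: "?R \<subseteq> ?Q" using * by auto
    ultimately obtain B where B: "B \<in> \<C>" "?R \<subseteq> B" using \<delta>(2) by blast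
    then obtain U P where U: "(U, P) \<in> \<P>" "B \<inter> ?Q \<subseteq> H -` U" by (auto simp: \<C>_def)
    have "\<forall>y\<in>?R. H y \<in> U" using U(2) B(2) sub by blast
    then have "primitive_along ?R H (\<lambda>z. P (H z))"
      unfolding primitive_along_def using U(1)
      by (intro ballI exI[of _ UNIV] exI[of _ U] exI[of _ P] exI[of _ 0]) auto
    then show "\<exists>u. primitive_along ?R H u" by blast
  qed
  have strip: "E 0 1 t t'" if t: "t' - t < \<delta> / 4" for t t'
  proof (rule Bolzano[of 0 1 "\<lambda>s s'. E s s' t t'"])
    fix a b c assume abc: "E a b t t'" "E b c t t'" "a \<le> b" "b \<le> (c::real)"
    show "E a c t t'"
      unfolding E_def
    proof
      assume *: "0 \<le> a \<and> c \<le> 1 \<and> 0 \<le> t \<and> t' \<le> 1"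
      then obtain u v where "primitive_along ({a..b} \<times> {t..t'}) H u" "primitive_along ({b..c} \<times> {t..t'}) H v"
        using abc unfolding E_def by fastforce
      moreover have eq: "{a..b} \<times> {t..t'} \<union> {b..c} \<times> {t..t'} = {a..c} \<times> {t..t'}"
        "{a..b} \<times> {t..t'} \<inter> {b..c} \<times> {t..t'} = {b} \<times> {t..t'}" using abc by auto
      moreover have "connected ({b} \<times> {t..t'})" by (intro connected_Times) auto
      ultimately show "\<exists>u. primitive_along ({a..c} \<times> {t..t'}) H u"
        using primitive_along_glue[of "{a..b} \<times> {t..t'}" H u "{b..c} \<times> {t..t'}" v] contH[of a c t t'] *
        by (auto intro: closed_Times)
    qed
  next
    fix s :: real
    show "\<exists>d>0. \<forall>a b. a \<le> s \<and> s \<le> b \<and> b - a < d \<longrightarrow> E a b t t'"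
      using small[OF _ t] \<delta>(1) by (intro exI[of _ "\<delta> / 4"]) auto
  qed simp
  have "E 0 1 0 1"
  proof (rule Bolzano[of 0 1 "\<lambda>t t'. E 0 1 t t'"])
    fix a b c assume abc: "E 0 1 a b" "E 0 1 b c" "a \<le> b" "b \<le> (c::real)"
    show "E 0 1 a c"
      unfolding E_def
    proof
      assume *: "0 \<le> (0::real) \<and> 1 \<le> (1::real) \<and> 0 \<le> a \<and> c \<le> 1"
      then obtain u v where "primitive_along ({0..1} \<times> {a..b}) H u" "primitive_along ({0..1} \<times> {b..c}) H v"
        using abc unfolding E_def by fastforce
      moreover have eq: "{0..1} \<times> {a..b} \<union> {0..1} \<times> {b..c} = {0..1::real} \<times> {a..c}"
        "{0..1} \<times> {a..b} \<inter> {0..1} \<times> {b..c} = {0..1::real} \<times> {b}" using abc by auto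
      moreover have "connected ({0..1::real} \<times> {b})" by (intro connected_Times) auto
      ultimately show "\<exists>u. primitive_along ({0..1} \<times> {a..c}) H u"
        using primitive_along_glue[of "{0..1} \<times> {a..b}" H u "{0..1} \<times> {b..c}" v] contH[of 0 1 a c] *
        by (auto intro: closed_Times)
    qed
  next
    fix s :: real
    show "\<exists>d>0. \<forall>a b. a \<le> s \<and> s \<le> b \<and> b - a < d \<longrightarrow> E 0 1 a b"
      using strip \<delta>(1) by (intro exI[of _ "\<delta> / 4"]) auto
  qed simp
  then show ?thesis by (auto simp: E_def)
qed

section \<open>Increments along paths and the global primitive\<close>

lemma primitive_along_path:
  assumes "path \<gamma>"
  shows "\<exists>u. primitive_along {0..1} \<gamma> u"
proof -
  have "continuous_on ({0..1} \<times> {0..1}) (\<lambda>z. \<gamma> (snd z))"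
    using assms unfolding path_def
    by (rule continuous_on_compose2) (auto intro!: continuous_intros)
  then obtain u where "primitive_along ({0..1::real} \<times> {0..1}) (\<lambda>z. \<gamma> (snd z)) u"
    using primitive_along_square by blast
  then have "primitive_along {0..1} \<gamma> (\<lambda>t. u (0, t))"
    by (rule primitive_along_compose) (auto intro!: continuous_intros)
  then show ?thesis by blast
qed

text \<open>This is the integral of the closed form along a merely continuous path. The choice is
  harmless, because all primitives along \<open>\<gamma>\<close> have the same increment.\<close>

definition increment :: "(real \<Rightarrow> 'm) \<Rightarrow> 'b" where
  "increment \<gamma> = (SOME d. \<exists>u. primitive_along {0..1} \<gamma> u \<and> d = u 1 - u 0)"

lemma increment_eq:
  assumes "path \<gamma>" "primitive_along {0..1} \<gamma> u"
  shows "increment \<gamma> = u 1 - u 0"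
proof -
  have "\<exists>v. primitive_along {0..1} \<gamma> v \<and> increment \<gamma> = v 1 - v 0"
    unfolding increment_def by (rule someI_ex) (use assms in blast)
  then obtain v where "primitive_along {0..1} \<gamma> v" "increment \<gamma> = v 1 - v 0" by blast
  then show ?thesis
    using primitive_along_unique[of "{0..1}" \<gamma> v u 0 1] assms by (auto simp: path_def)
qed

lemma increment_join:
  assumes "path \<gamma>" "path \<gamma>'" "pathfinish \<gamma> = pathstart \<gamma>'"
  shows "increment (\<gamma> +++ \<gamma>') = increment \<gamma> + increment \<gamma>'"
proof -
  have p: "path (\<gamma> +++ \<gamma>')" using assms by simp
  obtain u where u: "primitive_along {0..1} (\<gamma> +++ \<gamma>') u" using primitive_along_path[OF p] by blast
  have "primitive_along {0..1} \<gamma> (\<lambda>t. u (t / 2))"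
    by (rule primitive_along_compose[OF u]) (auto simp: joinpaths_def intro!: continuous_intros)
  moreover have "primitive_along {0..1} \<gamma>' (\<lambda>t. u ((t + 1) / 2))"
  proof (rule primitive_along_compose[OF u])
    fix t :: real assume "t \<in> {0..1}"
    then show "\<gamma>' t = (\<gamma> +++ \<gamma>') ((t + 1) / 2)"
      using assms(3) by (cases "t = 0") (simp_all add: joinpaths_def pathfinish_def pathstart_def add_divide_distrib)
  qed (auto intro!: continuous_intros)
  ultimately show ?thesis
    using increment_eq[OF assms(1)] increment_eq[OF assms(2)] increment_eq[OF p u] by simp
qed

lemma increment_reversepath:
  assumes "path \<gamma>"
  shows "increment (reversepath \<gamma>) = - increment \<gamma>"
proof -
  obtain u where u: "primitive_along {0..1} \<gamma> u" using primitive_along_path[OF assms] by blast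
  have r: "primitive_along {0..1} (reversepath \<gamma>) (\<lambda>t. u (1 - t))"
    by (rule primitive_along_compose[OF u]) (auto simp: reversepath_def intro!: continuous_intros)
  then show ?thesis using increment_eq[OF _ r] increment_eq[OF assms u] assms by simp
qed

lemma increment_in_domain:
  assumes "(U, P) \<in> \<P>" "path \<gamma>" "path_image \<gamma> \<subseteq> U"
  shows "increment \<gamma> = P (pathfinish \<gamma>) - P (pathstart \<gamma>)"
proof -
  have "primitive_along {0..1} \<gamma> (\<lambda>t. P (\<gamma> t))"
    unfolding primitive_along_def using assms
    by (intro ballI exI[of _ UNIV] exI[of _ U] exI[of _ P] exI[of _ 0]) (auto simp: path_image_def)
  then show ?thesis using increment_eq[OF assms(2)] by (simp add: pathstart_def pathfinish_def)
qed

text \<open>A null-homotopy is a map of the square with a primitive \<open>u\<close> along it. The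
  sides \<open>H (s, 0)\<close> and \<open>H (s, 1)\<close> are the same path and contribute equal
  increments, the side at \<open>s = 1\<close> is constant, and so the remaining side, the loop, has
  increment 0.\<close>

lemma increment_loop:
  assumes sc: "simply_connected (UNIV :: 'm set)" and \<gamma>: "path \<gamma>" "pathfinish \<gamma> = pathstart \<gamma>"
  shows "increment \<gamma> = 0"
proof -
  let ?p = "pathstart \<gamma>"
  have "homotopic_loops UNIV \<gamma> (\<lambda>_. ?p)"
    using sc \<gamma> unfolding simply_connected_def by (auto simp: path_def pathstart_def pathfinish_def)
  then obtain H where H: "continuous_on ({0..1::real} \<times> {0..1::real}) H"
    and H0: "\<And>t. t \<in> {0..1} \<Longrightarrow> H (0, t) = \<gamma> t" and H1: "\<And>t. t \<in> {0..1} \<Longrightarrow> H (1, t) = ?p"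
    and Hl: "\<And>s. s \<in> {0..1} \<Longrightarrow> H (s, 0) = H (s, 1)"
    unfolding homotopic_loops by (auto simp: pathstart_def pathfinish_def)
  obtain u where u: "primitive_along ({0..1} \<times> {0..1}) H u"
    using primitive_along_square[OF H] by blast
  have 0: "primitive_along {0..1} (\<lambda>s. H (s, 0)) (\<lambda>s. u (s, 0))"
    by (rule primitive_along_compose[OF u]) (auto intro!: continuous_intros)
  have 1: "primitive_along {0..1} (\<lambda>s. H (s, 0)) (\<lambda>s. u (s, 1))"
    by (rule primitive_along_compose[OF u]) (auto simp: Hl intro!: continuous_intros)
  have "continuous_on {0..1} (\<lambda>s. H (s, 0))"
    by (rule continuous_on_compose2[OF H]) (auto intro!: continuous_intros)
  then have sides: "u (1, 0) - u (0, 0) = u (1, 1) - u (0, 1)"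
    using primitive_along_unique[OF 0 1, of 0 1] by simp
  have "primitive_along {0..1} (\<lambda>_. ?p) (\<lambda>t. u (1, t))"
    by (rule primitive_along_compose[OF u]) (auto simp: H1 intro!: continuous_intros)
  moreover obtain U P where "(U, P) \<in> \<P>" "?p \<in> U" using cover by blast
  then have "primitive_along {0..1} (\<lambda>_::real. ?p) (\<lambda>_. 0)"
    unfolding primitive_along_def
    by (intro ballI exI[of _ UNIV] exI[of _ U] exI[of _ P] exI[of _ "- P ?p"]) auto
  ultimately have const: "u (1, 1) - u (1, 0) = 0"
    using primitive_along_unique[of "{0..1::real}" "\<lambda>_. ?p" "\<lambda>t. u (1, t)" "\<lambda>_. 0" 0 1] by simp
  have "primitive_along {0..1} \<gamma> (\<lambda>t. u (0, t))"
    by (rule primitive_along_compose[OF u]) (auto simp: H0 intro!: continuous_intros)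
  then have "increment \<gamma> = u (0, 1) - u (0, 0)" by (rule increment_eq[OF \<gamma>(1)])
  then show ?thesis using sides const by (simp add: algebra_simps)
qed

text \<open>The constant loops at \<open>p\<close> and \<open>q\<close> are homotopic as free loops;
  following the base point during the homotopy traces a path between them.\<close>

lemma path_exists:
  assumes "simply_connected (UNIV :: 'm set)"
  shows "\<exists>\<gamma>. path \<gamma> \<and> pathstart \<gamma> = p \<and> pathfinish \<gamma> = (q :: 'm)"
proof -
  have "homotopic_loops UNIV (\<lambda>_. p) (\<lambda>_. q)"
    using assms unfolding simply_connected_def by (auto simp: path_def pathstart_def pathfinish_def)
  then obtain H where "continuous_on ({0..1::real} \<times> {0..1::real}) H"
    "\<And>t. t \<in> {0..1} \<Longrightarrow> H (0, t) = p" "\<And>t. t \<in> {0..1} \<Longrightarrow> H (1, t) = q"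
    unfolding homotopic_loops by auto
  moreover from this(1) have "continuous_on {0..1} (\<lambda>s. H (s, 0))"
    by (rule continuous_on_compose2) (auto intro!: continuous_intros)
  ultimately show ?thesis
    by (intro exI[of _ "\<lambda>s. H (s, 0)"]) (auto simp: path_def pathstart_def pathfinish_def)
qed

text \<open>\<open>F q\<close> is the increment along some path from a fixed base point to
  \<open>q\<close>, independent of the path by \<open>increment_loop\<close>. Path-connectedness of
  \<open>U\<close> provides a path from \<open>p\<close> to \<open>q\<close> inside
  \<open>U\<close>, along which the increment is read off from \<open>P\<close>.\<close>

theorem global_primitive:
  assumes sc: "simply_connected (UNIV :: 'm set)"
  obtains F where "\<And>U P p q. (U, P) \<in> \<P> \<Longrightarrow> path_connected U \<Longrightarrow> p \<in> U \<Longrightarrow> q \<in> U \<Longrightarrow> F q - F p = P q - P p"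
proof
  fix p0 :: 'm
  define \<gamma> where "\<gamma> q = (SOME \<gamma>. path \<gamma> \<and> pathstart \<gamma> = p0 \<and> pathfinish \<gamma> = q)" for q
  have \<gamma>: "path (\<gamma> q)" "pathstart (\<gamma> q) = p0" "pathfinish (\<gamma> q) = q" for q
    using someI_ex[OF path_exists[OF sc, of p0 q]] by (auto simp: \<gamma>_def)
  fix U P p q assume U: "(U, P) \<in> \<P>" "path_connected U" "p \<in> U" "q \<in> U"
  then obtain \<sigma> where \<sigma>: "path \<sigma>" "path_image \<sigma> \<subseteq> U" "pathstart \<sigma> = p" "pathfinish \<sigma> = q"
    unfolding path_connected_def by blast
  let ?l = "(\<gamma> p +++ \<sigma>) +++ reversepath (\<gamma> q)"
  have "increment ?l = increment (\<gamma> p) + increment \<sigma> - increment (\<gamma> q)"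
    using \<gamma> \<sigma> by (simp add: increment_join increment_reversepath)
  moreover have "increment ?l = 0" by (rule increment_loop[OF sc]) (use \<gamma> \<sigma> in auto)
  moreover have "increment \<sigma> = P q - P p" using increment_in_domain[OF U(1) \<sigma>(1,2)] \<sigma> by simp
  ultimately show "increment (\<gamma> q) - increment (\<gamma> p) = P q - P p" by (simp add: algebra_simps)
qed

end

section \<open>Calculus on a manifold\<close>

locale smooth_manifold =
  fixes \<A> :: "('m::{t2_space, second_countable_topology}, 'n::finite) chart set"
  assumes atlas: "smooth_atlas \<A>"
begin

lemma open_chart: "c \<in> \<A> \<Longrightarrow> open (fst c)"
  and open_chart_range: "c \<in> \<A> \<Longrightarrow> open (snd c ` fst c)"
  and homeomorphism_chart: "c \<in> \<A> \<Longrightarrow> homeomorphism (fst c) (snd c ` fst c) (snd c) (chart_inv c)"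
  and smooth_on_transition: "c \<in> \<A> \<Longrightarrow> d \<in> \<A> \<Longrightarrow> smooth_on (snd c ` (fst c \<inter> fst d)) (snd d \<circ> chart_inv c)"
  using atlas unfolding smooth_atlas_def by blast+

lemma chart_inv_chart [simp]: "c \<in> \<A> \<Longrightarrow> p \<in> fst c \<Longrightarrow> chart_inv c (snd c p) = p"
  and chart_chart_inv: "c \<in> \<A> \<Longrightarrow> x \<in> snd c ` fst c \<Longrightarrow> snd c (chart_inv c x) = x"
  and chart_inv_in: "c \<in> \<A> \<Longrightarrow> x \<in> snd c ` fst c \<Longrightarrow> chart_inv c x \<in> fst c"
  using homeomorphism_chart[of c] unfolding homeomorphism_def by blast+

lemma continuous_on_chart: "c \<in> \<A> \<Longrightarrow> continuous_on (fst c) (snd c)"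
  and continuous_on_chart_inv: "c \<in> \<A> \<Longrightarrow> continuous_on (snd c ` fst c) (chart_inv c)"
  using homeomorphism_chart[of c] unfolding homeomorphism_def by blast+

lemma chart_at_in: "chart_at \<A> p \<in> \<A>" and in_chart_at: "p \<in> fst (chart_at \<A> p)"
proof -
  have "p \<in> (\<Union>c\<in>\<A>. fst c)" using atlas unfolding smooth_atlas_def by simp
  then have "\<exists>c. c \<in> \<A> \<and> p \<in> fst c" by blast
  then show "chart_at \<A> p \<in> \<A>" "p \<in> fst (chart_at \<A> p)"
    unfolding chart_at_def by (metis (mono_tags, lifting) someI_ex)+
qed

lemma open_chart_image:
  assumes "c \<in> \<A>" "open V"
  shows "open (snd c ` (fst c \<inter> V))"
proof -
  have "snd c ` (fst c \<inter> V) = snd c ` fst c \<inter> chart_inv c -` V"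
    using assms(1) by (force simp: chart_chart_inv chart_inv_in)
  then show ?thesis
    using continuous_open_preimage[OF continuous_on_chart_inv open_chart_range] assms by simp
qed

lemma open_chart_preimage:
  assumes "c \<in> \<A>" "open B"
  shows "open (fst c \<inter> snd c -` B)"
  using continuous_open_preimage[OF continuous_on_chart open_chart] assms by blast

lemma transition_has_derivative:
  assumes "c \<in> \<A>" "d \<in> \<A>" "p \<in> fst c" "p \<in> fst d"
  shows "(snd d \<circ> chart_inv c has_derivative frechet_derivative (snd d \<circ> chart_inv c) (at (snd c p))) (at (snd c p))"
  by (rule smooth_on_has_derivative[OF smooth_on_transition]) (use assms in auto)

lemma change_of_chart:
  assumes c: "c \<in> \<A>" "p \<in> fst c" and d: "d \<in> \<A>" "p \<in> fst d"
    and u: "(u \<circ> chart_inv c has_derivative u') (at (snd c p))"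
  shows "(u \<circ> chart_inv d has_derivative
    (\<lambda>v. u' (frechet_derivative (snd c \<circ> chart_inv d) (at (snd d p)) v))) (at (snd d p))"
proof (rule has_derivative_transform_within_open)
  have "(u \<circ> chart_inv c has_derivative u') (at ((snd c \<circ> chart_inv d) (snd d p)))"
    using u c d by simp
  then show "((\<lambda>x. (u \<circ> chart_inv c) ((snd c \<circ> chart_inv d) x)) has_derivative
      (\<lambda>v. u' (frechet_derivative (snd c \<circ> chart_inv d) (at (snd d p)) v))) (at (snd d p))"
    by (rule has_derivative_compose[OF transition_has_derivative[OF d(1) c(1) d(2) c(2)]])
  show "open (snd d ` (fst d \<inter> fst c))" by (rule open_chart_image[OF d(1) open_chart[OF c(1)]])
  show "snd d p \<in> snd d ` (fst d \<inter> fst c)" using c d by blast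
  show "(u \<circ> chart_inv c) ((snd c \<circ> chart_inv d) x) = (u \<circ> chart_inv d) x"
    if "x \<in> snd d ` (fst d \<inter> fst c)" for x
    using that c d by auto
qed

text \<open>The chain rule for the transition from the preferred chart: derivatives can be computed
  in any chart, once tangent vectors are converted to its coordinates.\<close>

lemma dM_chart:
  assumes c: "c \<in> \<A>" "p \<in> fst c" and u: "(u \<circ> chart_inv c has_derivative u') (at (snd c p))"
  shows "dM \<A> u p v = u' (dM \<A> (snd c) p v)"
  unfolding dM_def
  by (rule frechet_derivative_at[OF change_of_chart[OF c chart_at_in in_chart_at u], symmetric, THEN fun_cong])

lemma dM_chart_surj:
  assumes c: "c \<in> \<A>" "p \<in> fst c"
  obtains v where "dM \<A> (snd c) p v = w"
proof -
  let ?d = "chart_at \<A> p"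
  let ?T = "frechet_derivative (snd c \<circ> chart_inv ?d) (at (snd ?d p))"
  let ?T' = "frechet_derivative (snd ?d \<circ> chart_inv c) (at (snd c p))"
  have "(snd c \<circ> chart_inv c has_derivative (\<lambda>v. ?T (?T' v))) (at (snd c p))"
    by (rule change_of_chart[OF chart_at_in in_chart_at c
          transition_has_derivative[OF chart_at_in c(1) in_chart_at c(2)]])
  moreover have "(snd c \<circ> chart_inv c has_derivative (\<lambda>v. v)) (at (snd c p))"
    by (rule has_derivative_transform_within_open[OF has_derivative_ident open_chart_range[OF c(1)]])
      (use c in \<open>auto simp: chart_chart_inv\<close>)
  ultimately have "?T (?T' w) = w" using has_derivative_unique by metis
  then show thesis using that unfolding dM_def by blast
qed

section \<open>Rules for smooth maps and their differentials\<close>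

lemma smooth_map_has_derivative:
  assumes "smooth_map \<A> u" "c \<in> \<A>" "p \<in> fst c"
  shows "(u \<circ> chart_inv c has_derivative frechet_derivative (u \<circ> chart_inv c) (at (snd c p))) (at (snd c p))"
  using assms unfolding smooth_map_def by (intro smooth_on_has_derivative) auto

lemma smooth_map_has_dM:
  assumes "smooth_map \<A> u"
  shows "(u \<circ> chart_inv (chart_at \<A> p) has_derivative dM \<A> u p) (at (snd (chart_at \<A> p) p))"
  using smooth_map_has_derivative[OF assms chart_at_in in_chart_at] unfolding dM_def .

lemma dM_eqI:
  "(u \<circ> chart_inv (chart_at \<A> p) has_derivative u') (at (snd (chart_at \<A> p) p)) \<Longrightarrow> dM \<A> u p = u'"
  unfolding dM_def by (rule frechet_derivative_at[symmetric])

lemma linear_dM: "smooth_map \<A> u \<Longrightarrow> linear (dM \<A> u p)"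
  by (rule has_derivative_linear[OF smooth_map_has_dM])

lemma smooth_map_const: "smooth_map \<A> (\<lambda>p. c)"
  by (simp add: smooth_map_def o_def smooth_on_const)

lemma dM_const: "dM \<A> (\<lambda>p. c) p v = 0"
  using dM_eqI[of "\<lambda>p. c" p "\<lambda>v. 0"] by (simp add: o_def)

lemma smooth_map_add: "smooth_map \<A> u \<Longrightarrow> smooth_map \<A> w \<Longrightarrow> smooth_map \<A> (\<lambda>p. u p + w p)"
  by (simp add: smooth_map_def o_def smooth_on_add open_chart_range)

lemma dM_add:
  assumes "smooth_map \<A> u" "smooth_map \<A> w"
  shows "dM \<A> (\<lambda>p. u p + w p) p v = dM \<A> u p v + dM \<A> w p v"
  using dM_eqI[of "\<lambda>p. u p + w p" p, unfolded o_def,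
      OF has_derivative_add[OF assms[THEN smooth_map_has_dM], unfolded o_def]] by simp

lemma smooth_map_linear:
  assumes "bounded_linear L" "smooth_map \<A> u"
  shows "smooth_map \<A> (\<lambda>p. L (u p))"
  unfolding smooth_map_def o_def
proof
  fix c assume c: "c \<in> \<A>"
  have "smooth_on (snd c ` fst c) (\<lambda>x. u (chart_inv c x))"
    using assms(2) c unfolding smooth_map_def o_def by (rule bspec)
  then show "smooth_on (snd c ` fst c) (\<lambda>x. L (u (chart_inv c x)))"
    by (rule bounded_linear.smooth_on_compose[OF assms(1) open_chart_range[OF c]])
qed

lemma dM_linear:
  assumes "bounded_linear L" "smooth_map \<A> u"
  shows "dM \<A> (\<lambda>p. L (u p)) p v = L (dM \<A> u p v)"
  using dM_eqI[of "\<lambda>p. L (u p)" p, unfolded o_def,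
      OF bounded_linear.has_derivative[OF assms(1) smooth_map_has_dM[OF assms(2)], unfolded o_def]] by simp

lemma smooth_map_bilinear:
  assumes "bounded_bilinear b" "smooth_map \<A> u" "smooth_map \<A> w"
  shows "smooth_map \<A> (\<lambda>p. b (u p) (w p))"
  unfolding smooth_map_def o_def
proof
  fix c assume c: "c \<in> \<A>"
  have "smooth_on (snd c ` fst c) (\<lambda>x. u (chart_inv c x))" "smooth_on (snd c ` fst c) (\<lambda>x. w (chart_inv c x))"
    using assms(2,3) c unfolding smooth_map_def o_def by (auto dest: bspec)
  then show "smooth_on (snd c ` fst c) (\<lambda>x. b (u (chart_inv c x)) (w (chart_inv c x)))"
    by (rule bounded_bilinear.smooth_on_prod[OF assms(1) open_chart_range[OF c]])
qed

lemma dM_bilinear: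
  assumes "bounded_bilinear b" "smooth_map \<A> u" "smooth_map \<A> w"
  shows "dM \<A> (\<lambda>p. b (u p) (w p)) p v = b (u p) (dM \<A> w p v) + b (dM \<A> u p v) (w p)"
proof -
  have "((\<lambda>x. b ((u \<circ> chart_inv (chart_at \<A> p)) x) ((w \<circ> chart_inv (chart_at \<A> p)) x)) has_derivative
    (\<lambda>v. b (u p) (dM \<A> w p v) + b (dM \<A> u p v) (w p))) (at (snd (chart_at \<A> p) p))"
    using bounded_bilinear.FDERIV[OF assms(1) assms(2,3)[THEN smooth_map_has_dM[where p = p]]]
      chart_inv_chart[OF chart_at_in in_chart_at, of p] by (simp add: o_def)
  then show ?thesis
    using dM_eqI[of "\<lambda>p. b (u p) (w p)" p, unfolded o_def] unfolding o_def by simp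
qed

lemmas smooth_map_scaleR = smooth_map_bilinear[OF bounded_bilinear_scaleR]
  and dM_scaleR = dM_bilinear[OF bounded_bilinear_scaleR]
  and smooth_map_inner = smooth_map_bilinear[OF bounded_bilinear_inner]
  and dM_inner = dM_bilinear[OF bounded_bilinear_inner]
  and smooth_map_matrix_vector = smooth_map_bilinear[OF bounded_bilinear_matrix_vector_mult]
  and dM_matrix_vector = dM_bilinear[OF bounded_bilinear_matrix_vector_mult]
  and smooth_map_matrix_matrix = smooth_map_bilinear[OF bounded_bilinear_matrix_matrix_mult]
  and dM_matrix_matrix = dM_bilinear[OF bounded_bilinear_matrix_matrix_mult]
  and smooth_map_minus = smooth_map_linear[OF bounded_linear_minus[OF bounded_linear_ident]]
  and dM_minus = dM_linear[OF bounded_linear_minus[OF bounded_linear_ident]]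
  and smooth_map_nth = smooth_map_linear[OF bounded_linear_vec_nth]
  and dM_nth = dM_linear[OF bounded_linear_vec_nth]

lemma smooth_map_diff:
  assumes "smooth_map \<A> u" "smooth_map \<A> w"
  shows "smooth_map \<A> (\<lambda>p. u p - w p)"
  using smooth_map_add[OF assms(1) smooth_map_minus[OF assms(2)]] by simp

lemma dM_diff:
  assumes "smooth_map \<A> u" "smooth_map \<A> w"
  shows "dM \<A> (\<lambda>p. u p - w p) p v = dM \<A> u p v - dM \<A> w p v"
  using dM_add[OF assms(1) smooth_map_minus[OF assms(2)]] dM_minus[OF assms(2)] by simp

lemma smooth_map_sum: "(\<And>i. i \<in> I \<Longrightarrow> smooth_map \<A> (u i)) \<Longrightarrow> smooth_map \<A> (\<lambda>p. \<Sum>i\<in>I. u i p)"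
  by (induction I rule: infinite_finite_induct) (auto intro: smooth_map_const smooth_map_add)

lemma smooth_map_vec:
  fixes u :: "'i::finite \<Rightarrow> 'm \<Rightarrow> 'b::euclidean_space"
  assumes "\<And>i. smooth_map \<A> (u i)"
  shows "smooth_map \<A> (\<lambda>p. \<chi> i. u i p)"
  unfolding smooth_map_def o_def
proof
  fix c assume c: "c \<in> \<A>"
  have "smooth_on (snd c ` fst c) (\<lambda>x. u i (chart_inv c x))" for i
    using assms[of i] c unfolding smooth_map_def o_def by (rule bspec)
  then show "smooth_on (snd c ` fst c) (\<lambda>x. \<chi> i. u i (chart_inv c x))"
    by (rule smooth_on_vec[OF open_chart_range[OF c]])
qed

lemma smooth_map_det:
  fixes G :: "'m \<Rightarrow> real ^ 'i ^ 'i::finite"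
  assumes "\<And>i j. smooth_map \<A> (\<lambda>p. G p $ i $ j)"
  shows "smooth_map \<A> (\<lambda>p. det (G p))"
  unfolding smooth_map_def o_def
proof
  fix c assume c: "c \<in> \<A>"
  have "smooth_on (snd c ` fst c) (\<lambda>x. G (chart_inv c x) $ i $ j)" for i j
    using assms[of i j] c unfolding smooth_map_def o_def by (rule bspec)
  then show "smooth_on (snd c ` fst c) (\<lambda>x. det (G (chart_inv c x)))"
    by (rule smooth_on_det[OF open_chart_range[OF c]])
qed

lemma smooth_map_linear_system:
  fixes G :: "'m \<Rightarrow> real ^ 'i ^ 'i::finite"
  assumes "\<And>i j. smooth_map \<A> (\<lambda>p. G p $ i $ j)" "smooth_map \<A> b"
    and "\<And>p. det (G p) \<noteq> 0" "\<And>p. G p *v y p = b p"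
  shows "smooth_map \<A> y"
  unfolding smooth_map_def o_def
proof
  fix c assume c: "c \<in> \<A>"
  have "smooth_on (snd c ` fst c) (\<lambda>x. G (chart_inv c x) $ i $ j)" for i j
    using assms(1)[of i j] c unfolding smooth_map_def o_def by (rule bspec)
  moreover have "smooth_on (snd c ` fst c) (\<lambda>x. b (chart_inv c x))"
    using assms(2) c unfolding smooth_map_def o_def by (rule bspec)
  ultimately show "smooth_on (snd c ` fst c) (\<lambda>x. y (chart_inv c x))"
    by (rule smooth_on_linear_system[OF open_chart_range[OF c]]) (rule assms(3,4))+
qed

lemma smooth_map_dM_field:
  assumes u: "smooth_map \<A> u" and X: "smooth_vector_field \<A> X"
  shows "smooth_map \<A> (\<lambda>p. dM \<A> u p (X p))"
  unfolding smooth_map_def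
proof
  fix c assume c: "c \<in> \<A>"
  let ?\<xi> = "\<lambda>x. dM \<A> (snd c) (chart_inv c x) (X (chart_inv c x))"
  have "smooth_on (snd c ` fst c) (\<lambda>x. frechet_derivative (u \<circ> chart_inv c) (at x) (?\<xi> x))"
    using u X c unfolding smooth_map_def smooth_vector_field_def
    by (intro smooth_on_frechet_derivative_field open_chart_range) auto
  then show "smooth_on (snd c ` fst c) ((\<lambda>p. dM \<A> u p (X p)) \<circ> chart_inv c)"
  proof (rule smooth_on_cong[OF open_chart_range[OF c], rotated])
    fix x assume x: "x \<in> snd c ` fst c"
    show "frechet_derivative (u \<circ> chart_inv c) (at x) (?\<xi> x) = ((\<lambda>p. dM \<A> u p (X p)) \<circ> chart_inv c) x"
      using dM_chart[OF c chart_inv_in[OF c x] smooth_map_has_derivative[OF u c chart_inv_in[OF c x]]]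
        chart_chart_inv[OF c x] by simp
  qed
qed

lemma smooth_map_continuous:
  assumes "smooth_map \<A> u"
  shows "continuous_on UNIV u"
proof -
  have "continuous_on (\<Union>c\<in>\<A>. fst c) u"
  proof (rule continuous_on_open_UN)
    fix c assume c: "c \<in> \<A>"
    show "open (fst c)" by (rule open_chart[OF c])
    have "continuous_on (snd c ` fst c) (u \<circ> chart_inv c)"
      using assms c unfolding smooth_map_def by (intro smooth_on_continuous_on) (rule bspec)
    then have "continuous_on (fst c) (\<lambda>p. (u \<circ> chart_inv c) (snd c p))"
      by (rule continuous_on_compose2[OF _ continuous_on_chart[OF c]]) simp
    then show "continuous_on (fst c) u"
      by (rule continuous_on_eq) (use c in simp)
  qed
  then show ?thesis using atlas unfolding smooth_atlas_def by simp
qed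

lemma chart_ball:
  assumes c: "c \<in> \<A>" "p \<in> fst c" and V: "open V" "p \<in> V"
  obtains e where "e > 0" "ball (snd c p) e \<subseteq> snd c ` (fst c \<inter> V)"
    "open (fst c \<inter> snd c -` ball (snd c p) e)" "p \<in> fst c \<inter> snd c -` ball (snd c p) e"
    "path_connected (fst c \<inter> snd c -` ball (snd c p) e)"
proof -
  have "open (snd c ` (fst c \<inter> V))" "snd c p \<in> snd c ` (fst c \<inter> V)"
    using open_chart_image[OF c(1) V(1)] c V by auto
  then obtain e where e: "e > 0" "ball (snd c p) e \<subseteq> snd c ` (fst c \<inter> V)"
    using open_contains_ball by blast
  have sub: "ball (snd c p) e \<subseteq> snd c ` fst c" using e(2) by blast
  have "fst c \<inter> snd c -` ball (snd c p) e = chart_inv c ` ball (snd c p) e"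
  proof (intro equalityI subsetI)
    fix q assume "q \<in> fst c \<inter> snd c -` ball (snd c p) e"
    then have "q = chart_inv c (snd c q)" "snd c q \<in> ball (snd c p) e" using c(1) by auto
    then show "q \<in> chart_inv c ` ball (snd c p) e" by (rule image_eqI)
  next
    fix q assume "q \<in> chart_inv c ` ball (snd c p) e"
    then obtain x where x: "x \<in> ball (snd c p) e" "q = chart_inv c x" by blast
    then have "x \<in> snd c ` fst c" using sub by blast
    then show "q \<in> fst c \<inter> snd c -` ball (snd c p) e"
      using x chart_chart_inv[OF c(1)] chart_inv_in[OF c(1)] by simp
  qed
  moreover have "path_connected (chart_inv c ` ball (snd c p) e)"
    by (rule path_connected_continuous_image[OF continuous_on_subset[OF continuous_on_chart_inv[OF c(1)] sub]])
      (simp add: convex_imp_path_connected)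
  ultimately have "path_connected (fst c \<inter> snd c -` ball (snd c p) e)" by simp
  then show thesis
    by (rule that[OF e open_chart_preimage[OF c(1) open_ball], rotated]) (use e(1) c(2) in auto)
qed

lemma dM_zero_imp_const:
  assumes conn: "connected (UNIV :: 'm set)" and u: "smooth_map \<A> u" and 0: "\<And>p v. dM \<A> u p v = 0"
  shows "u p = u q"
proof (rule connected_local_const[OF conn UNIV_I UNIV_I, of u], rule ballI)
  fix p
  let ?c = "chart_at \<A> p"
  note c = chart_at_in[of p] in_chart_at[of p]
  obtain e where e: "e > 0" "ball (snd ?c p) e \<subseteq> snd ?c ` (fst ?c \<inter> UNIV)"
    "open (fst ?c \<inter> snd ?c -` ball (snd ?c p) e)" "p \<in> fst ?c \<inter> snd ?c -` ball (snd ?c p) e"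
    by (rule chart_ball[OF c open_UNIV UNIV_I])
  have const: "u p = u q" if q: "q \<in> fst ?c \<inter> snd ?c -` ball (snd ?c p) e" for q
  proof -
    have "(u \<circ> chart_inv ?c) (snd ?c q) = (u \<circ> chart_inv ?c) (snd ?c p)"
    proof (rule has_derivative_zero_unique_connected[of "ball (snd ?c p) e"])
      fix x assume "x \<in> ball (snd ?c p) e"
      then obtain r where r: "r \<in> fst ?c" "x = snd ?c r" using e(2) by blast
      note du = smooth_map_has_derivative[OF u c(1) r(1)]
      have "frechet_derivative (u \<circ> chart_inv ?c) (at (snd ?c r)) = (\<lambda>w. 0)"
      proof
        fix w
        obtain v where "dM \<A> (snd ?c) r v = w" by (rule dM_chart_surj[OF c(1) r(1)])
        then show "frechet_derivative (u \<circ> chart_inv ?c) (at (snd ?c r)) w = 0"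
          using dM_chart[OF c(1) r(1) du, of v] 0 by simp
      qed
      then show "(u \<circ> chart_inv ?c has_derivative (\<lambda>w. 0)) (at x)" using du r by simp
    qed (use q e in auto)
    then show ?thesis using q c by simp
  qed
  show "\<forall>\<^sub>F q in at p within UNIV. u p = u q"
    unfolding eventually_at_topological
    by (intro exI[of _ "fst ?c \<inter> snd ?c -` ball (snd ?c p) e"] conjI ballI impI e(3,4)) (rule const)
qed

end

section \<open>Closed one-forms on a simply connected manifold\<close>

context smooth_manifold
begin

text \<open>One-forms are written as combinations \<^term>\<open>\<Sum>j\<in>UNIV. w j p *\<^sub>R dM \<A> f p v $ j\<close> of the differentials
  of the components of a globally defined map; on an immersed manifold every one-form is of this kind.\<close>

theorem closed_form_exact:
  fixes f :: "'m \<Rightarrow> real ^ 'k::finite" and w :: "'k \<Rightarrow> 'm \<Rightarrow> 'b::banach"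
  assumes sc: "simply_connected (UNIV :: 'm set)" and f: "smooth_map \<A> f" and w: "\<And>j. smooth_map \<A> (w j)"
    and closed: "\<And>p u v. (\<Sum>j\<in>UNIV. dM \<A> f p u $ j *\<^sub>R dM \<A> (w j) p v) =
      (\<Sum>j\<in>UNIV. dM \<A> f p v $ j *\<^sub>R dM \<A> (w j) p u)"
  shows "\<exists>F. smooth_map \<A> F \<and> (\<forall>p v. dM \<A> F p v = (\<Sum>j\<in>UNIV. dM \<A> f p v $ j *\<^sub>R w j p))"
proof -
  define \<omega> where "\<omega> c p v = (\<Sum>j\<in>UNIV. frechet_derivative (f \<circ> chart_inv c) (at (snd c p)) v $ j *\<^sub>R w j p)" for c :: "('m, 'n) chart" and p v
  \<comment> \<open>Prescribing the derivative in every chart allows two primitives to be compared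
    in a common chart, whichever charts produced them; \<open>change\<close> reduces the requirement
    to a single chart.\<close>
  define prim where "prim U P \<longleftrightarrow> open U \<and>
    (\<forall>c\<in>\<A>. \<forall>p\<in>U \<inter> fst c. (P \<circ> chart_inv c has_derivative \<omega> c p) (at (snd c p)))" for U P
  have change: "(P \<circ> chart_inv d has_derivative \<omega> d p) (at (snd d p))"
    if c: "c \<in> \<A>" "p \<in> fst c" and d: "d \<in> \<A>" "p \<in> fst d" and P: "(P \<circ> chart_inv c has_derivative \<omega> c p) (at (snd c p))"
    for c d p P
  proof -
    have "frechet_derivative (f \<circ> chart_inv d) (at (snd d p)) v =
      frechet_derivative (f \<circ> chart_inv c) (at (snd c p)) (frechet_derivative (snd c \<circ> chart_inv d) (at (snd d p)) v)" for v
      using frechet_derivative_at[OF change_of_chart[OF c d smooth_map_has_derivative[OF f c]], THEN fun_cong, symmetric] .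
    then have "\<omega> d p = (\<lambda>v. \<omega> c p (frechet_derivative (snd c \<circ> chart_inv d) (at (snd d p)) v))"
      by (intro ext) (simp add: \<omega>_def)
    then show ?thesis using change_of_chart[OF c d P] by simp
  qed
  have smooth_\<omega>: "smooth_on S (\<lambda>x. \<Sum>j\<in>UNIV. frechet_derivative (f \<circ> chart_inv c) (at x) v $ j *\<^sub>R (w j \<circ> chart_inv c) x)"
    if c: "c \<in> \<A>" and S: "open S" "S \<subseteq> snd c ` fst c" for c v S
  proof (rule smooth_on_sum[OF S(1)])
    fix j
    have "smooth_on S (f \<circ> chart_inv c)" "smooth_on S (w j \<circ> chart_inv c)"
      using f w c smooth_on_subset[OF _ S(2)] unfolding smooth_map_def by blast+
    then show "smooth_on S (\<lambda>x. frechet_derivative (f \<circ> chart_inv c) (at x) v $ j *\<^sub>R (w j \<circ> chart_inv c) x)"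
      by (intro bounded_bilinear.smooth_on_prod[OF bounded_bilinear_scaleR S(1)] smooth_on_component[OF S(1)]
          smooth_on_frechet_derivative)
  qed
  have local: "\<exists>U P. prim U P \<and> path_connected U \<and> p \<in> U" for p
  proof -
    define c where "c = chart_at \<A> p"
    have c: "c \<in> \<A>" "p \<in> fst c" by (auto simp: c_def chart_at_in in_chart_at)
    obtain e where e: "e > 0" "ball (snd c p) e \<subseteq> snd c ` (fst c \<inter> UNIV)"
      "open (fst c \<inter> snd c -` ball (snd c p) e)" "p \<in> fst c \<inter> snd c -` ball (snd c p) e"
      "path_connected (fst c \<inter> snd c -` ball (snd c p) e)"
      by (rule chart_ball[OF c open_UNIV UNIV_I])
    let ?B = "ball (snd c p) e" and ?f = "f \<circ> chart_inv c" and ?w = "\<lambda>j. w j \<circ> chart_inv c"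
    let ?\<omega> = "\<lambda>x v. \<Sum>j\<in>UNIV. frechet_derivative ?f (at x) v $ j *\<^sub>R ?w j x"
    have B: "?B \<subseteq> snd c ` fst c" using e(2) by simp
    have fB: "smooth_on ?B ?f" and wB: "smooth_on ?B (?w j)" for j
      using f w c(1) smooth_on_subset[OF _ B] unfolding smooth_map_def by blast+
    have "\<exists>P. \<forall>x\<in>?B. (P has_derivative ?\<omega> x) (at x)"
    proof (rule poincare_lemma)
      fix x assume x: "x \<in> ?B"
      then obtain q where q: "q \<in> fst c" "x = snd c q" using B by blast
      have lin: "linear (frechet_derivative ?f (at x))"
        by (rule has_derivative_linear[OF smooth_on_has_derivative[OF fB x]])
      show "linear (?\<omega> x)"
        by (rule linearI) (simp_all add: linear_add[OF lin] linear_scale[OF lin] scaleR_add_left sum.distrib scaleR_sum_right)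
      have D: "frechet_derivative (\<lambda>y. ?\<omega> y v) (at x) h = (\<Sum>j\<in>UNIV. frechet_derivative ?f (at x) v $ j *\<^sub>R
          frechet_derivative (?w j) (at x) h + frechet_derivative (\<lambda>y. frechet_derivative ?f (at y) v) (at x) h $ j *\<^sub>R ?w j x)" for v h
      proof -
        have "((\<lambda>y. frechet_derivative ?f (at y) v $ j) has_derivative
            (\<lambda>h. frechet_derivative (\<lambda>y. frechet_derivative ?f (at y) v) (at x) h $ j)) (at x)" for j
          by (rule bounded_linear.has_derivative[OF bounded_linear_vec_nth
                smooth_on_has_derivative[OF smooth_on_frechet_derivative[OF fB] x]])
        then have "((\<lambda>y. ?\<omega> y v) has_derivative (\<lambda>h. \<Sum>j\<in>UNIV. frechet_derivative ?f (at x) v $ j *\<^sub>R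
          frechet_derivative (?w j) (at x) h + frechet_derivative (\<lambda>y. frechet_derivative ?f (at y) v) (at x) h $ j *\<^sub>R ?w j x)) (at x)"
          by (intro has_derivative_sum has_derivative_scaleR smooth_on_has_derivative[OF wB x])
        from frechet_derivative_at[OF this, THEN fun_cong, of h] show ?thesis by simp
      qed
      fix v v'
      obtain a where a: "dM \<A> (snd c) q a = v" by (rule dM_chart_surj[OF c(1) q(1)])
      obtain a' where a': "dM \<A> (snd c) q a' = v'" by (rule dM_chart_surj[OF c(1) q(1)])
      have f_eq: "frechet_derivative ?f (at x) v = dM \<A> f q a" "frechet_derivative ?f (at x) v' = dM \<A> f q a'"
        and w_eq: "frechet_derivative (?w j) (at x) v = dM \<A> (w j) q a" "frechet_derivative (?w j) (at x) v' = dM \<A> (w j) q a'" for j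
        using dM_chart[OF c(1) q(1) smooth_map_has_derivative[OF f c(1) q(1)]]
          dM_chart[OF c(1) q(1) smooth_map_has_derivative[OF w c(1) q(1)]] a a' q(2) by simp_all
      \<comment> \<open>In the product rule \<open>D\<close> the part with second derivatives of
        \<open>f\<close> is symmetric by itself; symmetry of what remains is the hypothesis
        \<open>closed\<close>.\<close>
      have "frechet_derivative (\<lambda>y. frechet_derivative ?f (at y) v) (at x) v' =
          frechet_derivative (\<lambda>y. frechet_derivative ?f (at y) v') (at x) v"
        by (rule symmetric_second_derivative[OF open_ball x fB])
      then show "frechet_derivative (\<lambda>y. ?\<omega> y v) (at x) v' = frechet_derivative (\<lambda>y. ?\<omega> y v') (at x) v"
        unfolding D sum.distrib f_eq w_eq using closed[of q a a'] by simp
    qed (use smooth_\<omega>[OF c(1) open_ball B] in auto)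
    then obtain P where P: "\<And>x. x \<in> ?B \<Longrightarrow> (P has_derivative ?\<omega> x) (at x)" by blast
    have "prim (fst c \<inter> snd c -` ?B) (\<lambda>q. P (snd c q))"
      unfolding prim_def
    proof (intro conjI ballI e(3))
      fix d q assume d: "d \<in> \<A>" and q: "q \<in> (fst c \<inter> snd c -` ?B) \<inter> fst d"
      show "((\<lambda>q. P (snd c q)) \<circ> chart_inv d has_derivative \<omega> d q) (at (snd d q))"
      proof (rule change[OF c(1) _ d])
        have "(P has_derivative \<omega> c q) (at (snd c q))"
          using P[of "snd c q"] q c(1) by (simp add: \<omega>_def[abs_def])
        then show "((\<lambda>q. P (snd c q)) \<circ> chart_inv c has_derivative \<omega> c q) (at (snd c q))"
          by (rule has_derivative_transform_within_open[OF _ open_chart_range[OF c(1)]])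
            (use q in \<open>auto simp: chart_chart_inv[OF c(1)]\<close>)
      qed (use q in auto)
    qed
    then show ?thesis using e(4,5) by blast
  qed
  interpret local_primitives "{(U, P). prim U P}"
  proof
    show "open U" if "(U, P) \<in> {(U, P). prim U P}" for U P using that by (simp add: prim_def)
    show "\<exists>U P. (U, P) \<in> {(U, P). prim U P} \<and> p \<in> U" for p using local[of p] by auto
    fix U P U' P' p
    assume "(U, P) \<in> {(U, P). prim U P}" "(U', P') \<in> {(U, P). prim U P}" and p: "p \<in> U" "p \<in> U'"
    then have prim: "prim U P" "prim U' P'" by auto
    define c where "c = chart_at \<A> p"
    have c: "c \<in> \<A>" "p \<in> fst c" by (auto simp: c_def chart_at_in in_chart_at)
    have "open (U \<inter> U')" "p \<in> U \<inter> U'" using prim p by (auto simp: prim_def)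
    then obtain e where e: "e > 0" "ball (snd c p) e \<subseteq> snd c ` (fst c \<inter> (U \<inter> U'))"
      "open (fst c \<inter> snd c -` ball (snd c p) e)" "p \<in> fst c \<inter> snd c -` ball (snd c p) e"
      by (rule chart_ball[OF c])
    have "P q = P' q + (P p - P' p)" if q: "q \<in> fst c \<inter> snd c -` ball (snd c p) e" for q
    proof -
      let ?g = "\<lambda>x. (P \<circ> chart_inv c) x - (P' \<circ> chart_inv c) x"
      have "?g (snd c q) = ?g (snd c p)"
      proof (rule has_derivative_zero_unique_connected[of "ball (snd c p) e"])
        fix x assume "x \<in> ball (snd c p) e"
        then obtain r where r: "r \<in> fst c" "r \<in> U" "r \<in> U'" "x = snd c r" using e(2) by blast
        have "(P \<circ> chart_inv c has_derivative \<omega> c r) (at (snd c r))" "(P' \<circ> chart_inv c has_derivative \<omega> c r) (at (snd c r))"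
          using prim r c unfolding prim_def by blast+
        then have "(?g has_derivative (\<lambda>v. \<omega> c r v - \<omega> c r v)) (at (snd c r))"
          by (rule has_derivative_diff)
        then show "(?g has_derivative (\<lambda>v. 0)) (at x)" using r by simp
      qed (use q e in auto)
      then show ?thesis using q c by (simp add: algebra_simps)
    qed
    then show "\<exists>V d. open V \<and> p \<in> V \<and> (\<forall>y\<in>V. P y = P' y + d)" using e(3,4) by blast
  qed
  obtain F where F: "\<And>U P p q. (U, P) \<in> {(U, P). prim U P} \<Longrightarrow> path_connected U \<Longrightarrow> p \<in> U \<Longrightarrow> q \<in> U \<Longrightarrow> F q - F p = P q - P p"
    using global_primitive[OF sc] by blast
  have dF: "(F \<circ> chart_inv c has_derivative \<omega> c p) (at (snd c p))" if c: "c \<in> \<A>" "p \<in> fst c" for c p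
  proof -
    obtain U P where U: "prim U P" "path_connected U" "p \<in> U" using local by blast
    have "(P \<circ> chart_inv c has_derivative \<omega> c p) (at (snd c p))"
      using U c unfolding prim_def by blast
    then have "((\<lambda>x. (P \<circ> chart_inv c) x + (F p - P p)) has_derivative (\<lambda>v. \<omega> c p v + 0)) (at (snd c p))"
      by (rule has_derivative_add[OF _ has_derivative_const])
    then have "((\<lambda>x. (P \<circ> chart_inv c) x + (F p - P p)) has_derivative \<omega> c p) (at (snd c p))" by simp
    then show ?thesis
    proof (rule has_derivative_transform_within_open)
      show "open (snd c ` (fst c \<inter> U))" using open_chart_image[OF c(1)] U(1) by (simp add: prim_def)
      show "(P \<circ> chart_inv c) x + (F p - P p) = (F \<circ> chart_inv c) x" if "x \<in> snd c ` (fst c \<inter> U)" for x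
      proof -
        obtain q where "q \<in> fst c" "q \<in> U" "x = snd c q" using \<open>x \<in> snd c ` (fst c \<inter> U)\<close> by blast
        then show ?thesis using F[of U P p q] U c(1) by (simp add: algebra_simps)
      qed
    qed (use c U in blast)
  qed
  have "smooth_map \<A> F"
    unfolding smooth_map_def
  proof
    fix c assume c: "c \<in> \<A>"
    show "smooth_on (snd c ` fst c) (F \<circ> chart_inv c)"
    proof (rule smooth_onI_derivative[OF open_chart_range[OF c] _ smooth_\<omega>[OF c open_chart_range[OF c] subset_refl]])
      fix x assume "x \<in> snd c ` fst c"
      then obtain q where q: "q \<in> fst c" "x = snd c q" by blast
      then show "(F \<circ> chart_inv c has_derivative
          (\<lambda>v. \<Sum>j\<in>UNIV. frechet_derivative (f \<circ> chart_inv c) (at x) v $ j *\<^sub>R (w j \<circ> chart_inv c) x)) (at x)"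
        using dF[OF c q(1)] c by (simp add: \<omega>_def[abs_def])
    qed
  qed
  moreover have "dM \<A> F p v = (\<Sum>j\<in>UNIV. dM \<A> f p v $ j *\<^sub>R w j p)" for p v
    using dM_eqI[OF dF[OF chart_at_in in_chart_at], of p] by (simp add: \<omega>_def dM_def)
  ultimately show ?thesis by blast
qed

end

section \<open>Extrinsic calculus on a hypersurface\<close>

locale hypersurface = smooth_manifold \<A>
  for \<A> :: "('m::{t2_space, second_countable_topology}, 'n::finite) chart set" +
  fixes met :: "'m \<Rightarrow> real ^ 'n \<Rightarrow> real ^ 'n \<Rightarrow> real"
    and nabla :: "('m \<Rightarrow> real ^ 'n) \<Rightarrow> ('m \<Rightarrow> real ^ 'n) \<Rightarrow> ('m \<Rightarrow> real ^ 'n)"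
    and f N :: "'m \<Rightarrow> real ^ 'k::finite" and A :: "'m \<Rightarrow> real ^ 'n \<Rightarrow> real ^ 'n"
  assumes codim: "CARD('k) = CARD('n) + 1"
    and levi_civita: "levi_civita_connection \<A> met nabla"
    and immersion: "isometric_immersion \<A> met f"
    and normal: "unit_normal_field \<A> f N"
    and shape: "shape_operator \<A> met f N A"
begin

abbreviation df :: "'m \<Rightarrow> real ^ 'n \<Rightarrow> real ^ 'k" where "df p v \<equiv> dM \<A> f p v"

lemma smooth_f: "smooth_map \<A> f" and inj_df: "inj (df p)" and met_eq: "met p v w = df p v \<bullet> df p w"
  using immersion by (simp_all add: isometric_immersion_def)

lemma smooth_N: "smooth_map \<A> N" and norm_N: "norm (N p) = 1" and N_df [simp]: "N p \<bullet> df p v = 0"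
  using normal by (simp_all add: unit_normal_field_def)

lemma df_N [simp]: "df p v \<bullet> N p = 0" and N_N [simp]: "N p \<bullet> N p = 1"
  using norm_N[of p] by (simp_all add: inner_commute dot_square_norm)

lemma linear_df: "linear (df p)" by (rule linear_dM[OF smooth_f])

lemma df_eq_iff [simp]: "df p v = df p w \<longleftrightarrow> v = w"
  using inj_df by (auto dest: injD)

lemma dM_N: "dM \<A> N p v = - df p (A p v)"
  and tensor_A: "tensor_field_11 \<A> A" and met_A: "met p (A p v) w = met p v (A p w)"
  using shape by (simp_all add: shape_operator_def self_adjoint_field_def)

lemma df_A: "df p (A p v) \<bullet> df p w = df p v \<bullet> df p (A p w)"
  using met_A by (simp add: met_eq)

section \<open>Tangential projection and the vector fields it provides\<close>

lemma range_df: "range (df p) = {x. N p \<bullet> x = 0}"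
proof (rule subspace_dim_equal)
  have "N p \<noteq> 0" using norm_N[of p] by auto
  then have "dim {x. N p \<bullet> x = 0} = CARD('k) - 1" by (simp add: dim_hyperplane)
  moreover have "dim (range (df p)) = CARD('n)"
    using dim_image_eq[OF linear_df, of p UNIV] inj_df by (simp add: inj_on_subset)
  ultimately show "dim {x. N p \<bullet> x = 0} \<le> dim (range (df p))" using codim by simp
  show "subspace (range (df p))" by (rule linear_subspace_image[OF linear_df subspace_UNIV])
  show "subspace {x. N p \<bullet> x = 0}" by (rule subspace_hyperplane)
qed auto

text \<open>The orthogonal projection of an ambient vector to the tangent space, read back through
  \<open>df\<close>. It turns a constant ambient vector into a smooth vector field on the whole
  manifold.\<close>

definition tang :: "'m \<Rightarrow> real ^ 'k \<Rightarrow> real ^ 'n" where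
  "tang p e = inv (df p) (e - (e \<bullet> N p) *\<^sub>R N p)"

lemma df_tang: "df p (tang p e) = e - (e \<bullet> N p) *\<^sub>R N p"
proof -
  have "N p \<bullet> (e - (e \<bullet> N p) *\<^sub>R N p) = 0" by (simp add: inner_diff_right inner_commute)
  then have "e - (e \<bullet> N p) *\<^sub>R N p \<in> range (df p)" using range_df by blast
  then show ?thesis unfolding tang_def by (rule f_inv_into_f)
qed

lemma tang_df [simp]: "tang p (df p v) = v"
  unfolding tang_def using inj_df by (simp add: inv_f_f)

lemma tang_N [simp]: "tang p (N p) = 0"
proof -
  have "df p (tang p (N p)) = df p 0" by (simp add: df_tang linear_0[OF linear_df])
  then show ?thesis by simp
qed

lemma linear_tang: "linear (tang p)"
proof (rule linearI)
  fix x y :: "real ^ 'k" and r :: real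
  have "df p (tang p (x + y)) = df p (tang p x + tang p y)" "df p (tang p (r *\<^sub>R x)) = df p (r *\<^sub>R tang p x)"
    by (simp_all add: df_tang linear_add[OF linear_df] linear_scale[OF linear_df] inner_add_left algebra_simps)
  then show "tang p (x + y) = tang p x + tang p y" "tang p (r *\<^sub>R x) = r *\<^sub>R tang p x" by simp_all
qed

lemma decompose: "e = df p (tang p e) + (e \<bullet> N p) *\<^sub>R N p"
  by (simp add: df_tang)

text \<open>In a chart the coordinates of \<open>X\<close> solve a linear system whose matrix is the
  Gram matrix of the coordinate vectors of \<open>f\<close>, invertible because \<open>f\<close> is
  an immersion. Smoothness of fields can therefore be tested in the ambient space.\<close>

lemma smooth_vector_fieldI:
  assumes "smooth_map \<A> (\<lambda>p. df p (X p))"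
  shows "smooth_vector_field \<A> X"
  unfolding smooth_vector_field_def
proof
  fix c assume c: "c \<in> \<A>"
  let ?S = "snd c ` fst c" and ?y = "\<lambda>x. df (chart_inv c x) (X (chart_inv c x))"
  let ?\<xi> = "\<lambda>x. dM \<A> (snd c) (chart_inv c x) (X (chart_inv c x))"
  let ?J = "\<lambda>x. frechet_derivative (f \<circ> chart_inv c) (at x)"
  let ?G = "\<lambda>x. \<chi> i j. ?J x (axis i 1) \<bullet> ?J x (axis j 1)" and ?b = "\<lambda>x. \<chi> i. ?J x (axis i 1) \<bullet> ?y x"
  note S = open_chart_range[OF c]
  have fS: "smooth_on ?S (f \<circ> chart_inv c)" using smooth_f c unfolding smooth_map_def by (rule bspec)
  have yS: "smooth_on ?S ?y" using assms c unfolding smooth_map_def o_def by (rule bspec)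
  note JS = smooth_on_frechet_derivative[OF fS]
  note inner_smooth = bounded_bilinear.smooth_on_prod[OF bounded_bilinear_inner S]
  have lin: "linear (?J x)" if "x \<in> ?S" for x
    using has_derivative_linear[OF smooth_on_has_derivative[OF fS that]] .
  have sumJ: "(\<Sum>j\<in>UNIV. z $ j *\<^sub>R ?J x (axis j 1)) = ?J x z" if "x \<in> ?S" for x z
  proof -
    have "?J x z = ?J x (\<Sum>j\<in>UNIV. z $ j *\<^sub>R axis j 1)"
      using basis_expansion[of z] by (simp add: scalar_mult_eq_scaleR)
    then show ?thesis by (simp add: linear_sum[OF lin[OF that]] linear_scale[OF lin[OF that]])
  qed
  have Gz: "(?G x *v z) $ i = ?J x (axis i 1) \<bullet> ?J x z" if "x \<in> ?S" for x z i
    unfolding sumJ[OF that, of z, symmetric] by (simp add: matrix_vector_mult_def inner_sum_right mult.commute)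
  have injJ: "z = 0" if x: "x \<in> ?S" and z: "?J x z = 0" for x z
  proof -
    let ?p = "chart_inv c x"
    note p = chart_inv_in[OF c x]
    obtain v where v: "dM \<A> (snd c) ?p v = z" by (rule dM_chart_surj[OF c p])
    have "dM \<A> (snd c) ?p 0 = 0"
      using linear_0[OF has_derivative_linear[OF transition_has_derivative[OF chart_at_in c in_chart_at p]]]
      by (simp add: dM_def)
    moreover have "df ?p v = df ?p 0"
      using dM_chart[OF c p smooth_map_has_derivative[OF smooth_f c p]] v z chart_chart_inv[OF c x]
      by (simp add: linear_0[OF linear_df])
    ultimately show ?thesis using v by simp
  qed
  show "smooth_on ?S ?\<xi>"
  proof (rule smooth_on_linear_system[OF S, of ?G ?b])
    show "smooth_on ?S (\<lambda>x. ?G x $ i $ j)" for i j using inner_smooth[OF JS JS] by simp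
    show "smooth_on ?S ?b" by (rule smooth_on_vec[OF S inner_smooth[OF JS yS]])
    fix x assume x: "x \<in> ?S"
    have "z = 0" if "?G x *v z = 0" for z
    proof -
      have "?J x z \<bullet> ?J x z = (\<Sum>i\<in>UNIV. z $ i * (?G x *v z) $ i)"
        unfolding Gz[OF x] by (subst (1) sumJ[OF x, of z, symmetric]) (simp add: inner_sum_left)
      then show ?thesis using injJ[OF x, of z] that by simp
    qed
    then show "det (?G x) \<noteq> 0"
      by (metis invertible_det_nz invertible_left_inverse matrix_left_invertible_ker)
    have eq: "?J x (?\<xi> x) = ?y x"
      using dM_chart[OF c chart_inv_in[OF c x] smooth_map_has_derivative[OF smooth_f c chart_inv_in[OF c x]]]
        chart_chart_inv[OF c x] by simp
    show "?G x *v ?\<xi> x = ?b x"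
    proof (rule vec_eq_iff[THEN iffD2, rule_format])
      show "(?G x *v ?\<xi> x) $ i = ?b x $ i" for i unfolding Gz[OF x] eq by simp
    qed
  qed
qed

lemma smooth_df: "smooth_vector_field \<A> X \<Longrightarrow> smooth_map \<A> (\<lambda>p. df p (X p))"
  by (rule smooth_map_dM_field[OF smooth_f])

lemma smooth_tang:
  assumes "smooth_map \<A> u"
  shows "smooth_vector_field \<A> (\<lambda>p. tang p (u p))"
  by (rule smooth_vector_fieldI, unfold df_tang)
    (intro smooth_map_diff smooth_map_scaleR smooth_map_inner assms smooth_N)

text \<open>Projecting the constant vector \<open>df p v\<close> at every point extends
  \<open>v\<close> to a global smooth field, so pointwise identities may be proved through
  fields.\<close>

lemma vector_field_through:
  obtains X where "smooth_vector_field \<A> X" "X p = v"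
  using that[of "\<lambda>q. tang q (df p v)"] smooth_tang[OF smooth_map_const] by simp

lemma bracket:
  fixes u :: "'m \<Rightarrow> 'b::euclidean_space"
  assumes X: "smooth_vector_field \<A> X" and Y: "smooth_vector_field \<A> Y" and u: "smooth_map \<A> u"
  shows "dM \<A> u p (nabla X Y p) - dM \<A> u p (nabla Y X p) =
    dM \<A> (\<lambda>q. dM \<A> u q (Y q)) p (X p) - dM \<A> (\<lambda>q. dM \<A> u q (X q)) p (Y p)"
proof (rule euclidean_eqI)
  fix b :: 'b
  note L = bounded_linear_inner_left[of b]
  have ub: "smooth_map \<A> (\<lambda>q. u q \<bullet> b)" by (rule smooth_map_linear[OF L u])
  have "dM \<A> (\<lambda>q. u q \<bullet> b) p (nabla X Y p - nabla Y X p) =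
    dM \<A> (\<lambda>q. dM \<A> (\<lambda>q. u q \<bullet> b) q (Y q)) p (X p) - dM \<A> (\<lambda>q. dM \<A> (\<lambda>q. u q \<bullet> b) q (X q)) p (Y p)"
    by (rule levi_civita[unfolded levi_civita_connection_def, THEN conjunct2, THEN conjunct1, rule_format])
      (use X Y ub in blast)
  then show "(dM \<A> u p (nabla X Y p) - dM \<A> u p (nabla Y X p)) \<bullet> b =
    (dM \<A> (\<lambda>q. dM \<A> u q (Y q)) p (X p) - dM \<A> (\<lambda>q. dM \<A> u q (X q)) p (Y p)) \<bullet> b"
    using dM_linear[OF L u] dM_linear[OF L smooth_map_dM_field[OF u X]] dM_linear[OF L smooth_map_dM_field[OF u Y]]
    by (simp add: linear_diff[OF linear_dM[OF u]] inner_diff_left)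
qed

text \<open>The difference between the two sides, paired with \<^term>\<open>df p (Z p)\<close>, is symmetric in the first two
  and skew in the last two of the fields \<^term>\<open>X\<close>, \<^term>\<open>Y\<close>, \<^term>\<open>Z\<close>, so its tangential part vanishes.\<close>

lemma gauss_formula:
  assumes X: "smooth_vector_field \<A> X" and Y: "smooth_vector_field \<A> Y"
  shows "dM \<A> (\<lambda>q. df q (Y q)) p (X p) = df p (nabla X Y p) + met p (A p (X p)) (Y p) *\<^sub>R N p"
proof -
  define E where "E X Y = dM \<A> (\<lambda>q. df q (Y q)) p (X p) - df p (nabla X Y p)" for X Y
  define B where "B X Y Z = E X Y \<bullet> df p (Z p)" for X Y Z
  note sv = smooth_df
  have sym: "B X Y Z = B Y X Z" if "smooth_vector_field \<A> X" "smooth_vector_field \<A> Y" for X Y Z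
  proof -
    have "E X Y = E Y X" using bracket[OF that smooth_f, of p] by (simp add: E_def algebra_simps)
    then show ?thesis by (simp add: B_def)
  qed
  have skew: "B X Y Z = - B X Z Y"
    if X: "smooth_vector_field \<A> X" and Y: "smooth_vector_field \<A> Y" and Z: "smooth_vector_field \<A> Z" for X Y Z
  proof -
    have "dM \<A> (\<lambda>q. met q (Y q) (Z q)) p (X p) = met p (nabla X Y p) (Z p) + met p (Y p) (nabla X Z p)"
      by (rule levi_civita[unfolded levi_civita_connection_def, THEN conjunct2, THEN conjunct2, rule_format])
        (use X Y Z in blast)
    then show ?thesis
      unfolding met_eq dM_inner[OF sv[OF Y] sv[OF Z]] B_def E_def
      by (simp add: inner_diff_left inner_diff_right inner_commute)
  qed
  have B0: "B X Y Z = 0" if Z: "smooth_vector_field \<A> Z" for Z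
  proof -
    have "B X Y Z = - B X Z Y" by (rule skew[OF X Y Z])
    also have "\<dots> = - B Z X Y" using sym[OF X Z] by simp
    also have "\<dots> = B Z Y X" using skew[OF Z X Y] by simp
    also have "\<dots> = B Y Z X" by (rule sym[OF Z Y])
    also have "\<dots> = - B Y X Z" by (rule skew[OF Y Z X])
    also have "\<dots> = - B X Y Z" using sym[OF X Y] by simp
    finally show ?thesis by simp
  qed
  have "E X Y \<bullet> df p v = 0" for v
  proof -
    obtain Z where "smooth_vector_field \<A> Z" "Z p = v" by (rule vector_field_through)
    then show ?thesis using B0[of Z] by (simp add: B_def)
  qed
  then have "df p (tang p (E X Y)) \<bullet> df p (tang p (E X Y)) = 0"
    using decompose[of "E X Y" p] by (metis (no_types, lifting) N_df add.right_neutral inner_add_left inner_scaleR_left mult_zero_right)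
  then have "E X Y = (E X Y \<bullet> N p) *\<^sub>R N p"
    using decompose[of "E X Y" p] by simp
  moreover have "E X Y \<bullet> N p = met p (A p (X p)) (Y p)"
  proof -
    \<comment> \<open>The inner product vanishes identically; differentiating it trades the normal
      part of the second derivative of \<open>f\<close> for the derivative of \<open>N\<close>, that
      is, for \<open>A\<close>.\<close>
    have "dM \<A> (\<lambda>q. df q (Y q) \<bullet> N q) p (X p) = 0" by (simp add: dM_const)
    then show ?thesis
      unfolding dM_inner[OF sv[OF Y] smooth_N] E_def
      by (simp add: dM_N met_eq inner_diff_left inner_diff_right inner_commute)
  qed
  ultimately show ?thesis unfolding E_def by (simp add: algebra_simps)
qed

text \<open>Antisymmetrized second derivatives of \<open>u\<close> and of \<open>f\<close> both
  reduce to the bracket of two fields. Expanding the former by the product rule and cancelling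
  \<open>W\<close> applied to the latter leaves only the terms with the derivative of
  \<open>W\<close>.\<close>

lemma exact_form_closed:
  fixes W :: "'m \<Rightarrow> real ^ 'k ^ 'l::finite"
  assumes u: "smooth_map \<A> u" and W: "smooth_map \<A> W" and du: "\<And>p v. dM \<A> u p v = W p *v df p v"
  shows "dM \<A> W p a *v df p b = dM \<A> W p b *v df p a"
proof -
  obtain X where X: "smooth_vector_field \<A> X" "X p = a" by (rule vector_field_through)
  obtain Y where Y: "smooth_vector_field \<A> Y" "Y p = b" by (rule vector_field_through)
  note DX = smooth_df[OF X(1)] and DY = smooth_df[OF Y(1)]
  have "W p *v (df p (nabla X Y p) - df p (nabla Y X p)) =
      W p *v (dM \<A> (\<lambda>q. df q (Y q)) p a) + dM \<A> W p a *v df p b -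
      (W p *v (dM \<A> (\<lambda>q. df q (X q)) p b) + dM \<A> W p b *v df p a)"
    using bracket[OF X(1) Y(1) u, of p] unfolding du dM_matrix_vector[OF W DY] dM_matrix_vector[OF W DX]
    by (simp add: X Y matrix_vector_mult_diff_distrib)
  moreover have "df p (nabla X Y p) - df p (nabla Y X p) =
      dM \<A> (\<lambda>q. df q (Y q)) p a - dM \<A> (\<lambda>q. df q (X q)) p b"
    using bracket[OF X(1) Y(1) smooth_f, of p] by (simp add: X Y)
  ultimately show ?thesis by (simp add: matrix_vector_mult_diff_distrib)
qed

text \<open>\<open>T\<close> is extended by 0 on the normal line, the normal part of a vector being
  discarded by \<open>tang\<close>.\<close>

definition ambient :: "('m \<Rightarrow> real ^ 'n \<Rightarrow> real ^ 'n) \<Rightarrow> 'm \<Rightarrow> real ^ 'k ^ 'k" where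
  "ambient T p = matrix (\<lambda>e. df p (T p (tang p e)))"

lemma ambient_mult:
  assumes "tensor_field_11 \<A> T"
  shows "ambient T p *v e = df p (T p (tang p e))"
proof -
  have "linear (T p)" using assms by (simp add: tensor_field_11_def)
  then have "linear (\<lambda>e. df p (T p (tang p e)))"
    using linear_compose[OF linear_compose[OF linear_tang, of "T p" p] linear_df, of p] by (simp add: o_def)
  then show ?thesis unfolding ambient_def by (rule matrix_vector_mul(2)[THEN fun_cong])
qed

lemma smooth_matrixI:
  fixes M :: "'m \<Rightarrow> real ^ 'i::finite ^ 'j::finite"
  assumes "\<And>e. smooth_map \<A> (\<lambda>p. M p *v e)"
  shows "smooth_map \<A> M"
proof -
  have "smooth_map \<A> (\<lambda>p. \<chi> i j. (M p *v axis j 1) $ i)"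
    by (intro smooth_map_vec smooth_map_nth assms)
  moreover have "(\<chi> i j. (M p *v axis j 1) $ i) = M p" for p
    by (simp add: vec_eq_iff matrix_vector_mul_component inner_axis)
  ultimately show ?thesis by simp
qed

lemma smooth_ambient:
  assumes "tensor_field_11 \<A> T"
  shows "smooth_map \<A> (ambient T)"
proof (rule smooth_matrixI)
  fix e
  have "smooth_vector_field \<A> (\<lambda>p. T p (tang p e))"
    using assms smooth_tang[OF smooth_map_const, of e] by (simp add: tensor_field_11_def)
  then show "smooth_map \<A> (\<lambda>p. ambient T p *v e)"
    unfolding ambient_mult[OF assms] by (rule smooth_df)
qed

text \<open>The tangential part is the Codazzi equation and vanishes. The normal term is what the
  Gauss formula contributes for the fields \<open>T Y\<close> and \<open>T X\<close>.\<close>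

lemma codazzi_ambient:
  assumes "codazzi_tensor \<A> met nabla T"
  shows "dM \<A> (ambient T) p a *v df p b - dM \<A> (ambient T) p b *v df p a =
    (met p (A p a) (T p b) - met p (A p b) (T p a)) *\<^sub>R N p"
proof -
  have T: "tensor_field_11 \<A> T"
    and cod: "\<And>X Y. smooth_vector_field \<A> X \<Longrightarrow> smooth_vector_field \<A> Y \<Longrightarrow>
      nabla X (\<lambda>q. T q (Y q)) p - T p (nabla X Y p) = nabla Y (\<lambda>q. T q (X q)) p - T p (nabla Y X p)"
    using assms by (auto simp: codazzi_tensor_def)
  have key: "dM \<A> (ambient T) p (X p) *v df p (Y p) =
      df p (nabla X (\<lambda>q. T q (Y q)) p - T p (nabla X Y p)) + met p (A p (X p)) (T p (Y p)) *\<^sub>R N p"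
    if X: "smooth_vector_field \<A> X" and Y: "smooth_vector_field \<A> Y" for X Y
  proof -
    have TY: "smooth_vector_field \<A> (\<lambda>q. T q (Y q))" using T Y by (simp add: tensor_field_11_def)
    have "dM \<A> (\<lambda>q. ambient T q *v df q (Y q)) p (X p) =
        ambient T p *v (df p (nabla X Y p) + met p (A p (X p)) (Y p) *\<^sub>R N p) + dM \<A> (ambient T) p (X p) *v df p (Y p)"
      unfolding dM_matrix_vector[OF smooth_ambient[OF T] smooth_df[OF Y]] gauss_formula[OF X Y] ..
    \<comment> \<open>\<open>ambient T\<close> annihilates \<open>N\<close>, so the normal term of
      the Gauss formula for \<open>Y\<close> drops out; the one for \<open>T Y\<close>
      survives.\<close>
    also have "ambient T p *v (df p (nabla X Y p) + met p (A p (X p)) (Y p) *\<^sub>R N p) = df p (T p (nabla X Y p))"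
      using T linear_0[of "T p"] linear_0[OF linear_df, of p]
      by (simp add: ambient_mult[OF T] linear_add[OF linear_tang] linear_scale[OF linear_tang] tensor_field_11_def)
    finally show ?thesis
      using gauss_formula[OF X TY, of p] by (simp add: ambient_mult[OF T] linear_diff[OF linear_df] algebra_simps)
  qed
  obtain X where X: "smooth_vector_field \<A> X" "X p = a" by (rule vector_field_through)
  obtain Y where Y: "smooth_vector_field \<A> Y" "Y p = b" by (rule vector_field_through)
  show ?thesis
    using key[OF X(1) Y(1)] key[OF Y(1) X(1)] cod[OF X(1) Y(1)] by (simp add: X Y algebra_simps)
qed

end

section \<open>Linear maps with equal second exterior powers\<close>

text \<open>The hypothesis of the second lemma says \<open>c x \<and> c y = a x \<and> a y\<close> as bivectors. If \<open>a x\<close> and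
  \<open>a y\<close> are independent, then whatever is orthogonal to both is orthogonal to \<open>c x\<close>; letting
  \<open>y\<close> vary, which takes rank three, leaves \<open>c x\<close> parallel to \<open>a x\<close>.\<close>

lemma exists_image_not_in_span:
  fixes a :: "'v::euclidean_space \<Rightarrow> 'w::euclidean_space"
  assumes rank: "dim (range a) \<ge> 3"
  shows "\<exists>z. a z \<notin> span {u, v}"
proof (rule ccontr)
  assume "\<not> (\<exists>z. a z \<notin> span {u, v})"
  then have "range a \<subseteq> span {u, v}" by blast
  then have "dim (range a) \<le> dim {u, v}" by (metis dim_span dim_subset)
  also have "\<dots> \<le> card {u, v}" by (rule dim_le_card') simp
  also have "\<dots> \<le> 2" by (simp add: card_insert_if)
  finally show False using rank by simp
qed

lemma exterior_square_eq_imp_eq_or_uminus: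
  fixes a c :: "'v::euclidean_space \<Rightarrow> 'w::euclidean_space"
  assumes rank: "dim (range a) \<ge> 3"
    and wedge: "\<And>x y e. (c y \<bullet> e) *\<^sub>R c x - (c x \<bullet> e) *\<^sub>R c y = (a y \<bullet> e) *\<^sub>R a x - (a x \<bullet> e) *\<^sub>R a y"
  shows "(\<forall>x. c x = a x) \<or> (\<forall>x. c x = - a x)"
proof -
  define indep where "indep x y \<longleftrightarrow> a x \<noteq> 0 \<and> a y \<notin> span {a x}" for x y
  have mono: "u \<notin> span {v}" if "u \<notin> span {v, w}" for u v w :: 'w
    using that span_mono[of "{v}" "{v, w}"] by blast
  \<comment> \<open>This is the bivector \<open>a x \<and> a y\<close> contracted with
    \<open>a x\<close>: up to a nonzero factor, the component of \<open>a y\<close> orthogonal to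
    \<open>a x\<close>.\<close>
  have nonzero: "(a y \<bullet> a x) *\<^sub>R a x - (a x \<bullet> a x) *\<^sub>R a y \<noteq> 0" if "indep x y" for x y
  proof
    assume "(a y \<bullet> a x) *\<^sub>R a x - (a x \<bullet> a x) *\<^sub>R a y = 0"
    moreover have "a x \<bullet> a x \<noteq> 0" using that by (simp add: indep_def)
    ultimately have "a y = ((a y \<bullet> a x) / (a x \<bullet> a x)) *\<^sub>R a x"
      by (simp add: eq_vector_fraction_iff)
    then have "a y \<in> span {a x}" by (metis span_base span_mul insertI1)
    then show False using that by (simp add: indep_def)
  qed
  \<comment> \<open>If \<open>c x\<close> had a component along \<open>e\<close>, the contraction
    with \<open>e\<close> would make \<open>c y\<close> parallel to \<open>c x\<close>. Then
    \<open>c x \<and> c y = 0\<close>, contradicting independence of \<open>a x\<close> and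
    \<open>a y\<close>.\<close>
  have orth: "c x \<bullet> e = 0" if xy: "indep x y" and e: "a x \<bullet> e = 0" "a y \<bullet> e = 0" for x y e
  proof (rule ccontr)
    assume ne: "c x \<bullet> e \<noteq> 0"
    have "(c y \<bullet> e) *\<^sub>R c x = (c x \<bullet> e) *\<^sub>R c y" using wedge[of y e x] e by simp
    then have cy: "c y = ((c y \<bullet> e) / (c x \<bullet> e)) *\<^sub>R c x" using ne by (simp add: eq_vector_fraction_iff)
    define t where "t = (c y \<bullet> e) / (c x \<bullet> e)"
    have "c y = t *\<^sub>R c x" using cy by (simp add: t_def)
    then have "(c y \<bullet> a x) *\<^sub>R c x - (c x \<bullet> a x) *\<^sub>R c y = 0" by simp
    then show False using wedge[of y "a x" x] nonzero[OF xy] by simp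
  qed
  have orth1: "c x \<bullet> e = 0" if x: "a x \<noteq> 0" and e: "a x \<bullet> e = 0" for x e
  proof -
    obtain y where "a y \<notin> span {a x, a x}" using exists_image_not_in_span[OF rank] by blast
    then have y: "indep x y" using x by (simp add: indep_def)
    obtain z where z: "a z \<notin> span {a x, a y}" using exists_image_not_in_span[OF rank] by blast
    then have xz: "indep x z" using mono x unfolding indep_def by blast
    obtain u d where u: "u \<in> span {a x, a y}" and d: "\<And>w. w \<in> span {a x, a y} \<Longrightarrow> orthogonal d w" and dec: "a z = u + d"
      using orthogonal_subspace_decomp_exists[of "{a x, a y}" "a z"] by metis
    have dx: "a x \<bullet> d = 0" and dy: "a y \<bullet> d = 0" and du: "u \<bullet> d = 0"
      using d[of "a x"] d[of "a y"] d[OF u] by (simp_all add: orthogonal_def inner_commute span_base)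
    have "d \<noteq> 0" using z u dec by auto
    then have dz: "a z \<bullet> d \<noteq> 0" using dec du by (simp add: inner_add_left)
    \<comment> \<open>With this \<open>s\<close> the vector \<open>e - s d\<close> is orthogonal to
      \<open>a x\<close> and \<open>a z\<close>, while \<open>d\<close> is orthogonal to
      \<open>a x\<close> and \<open>a y\<close>. Two applications of \<open>orth\<close>, with
      different partners of \<open>x\<close>, then cover \<open>e\<close>.\<close>
    define s where "s = (a z \<bullet> e) / (a z \<bullet> d)"
    have "c x \<bullet> (e - s *\<^sub>R d) = 0"
      by (rule orth[OF xz]) (use e dx dz in \<open>simp_all add: s_def inner_diff_right\<close>)
    moreover have "c x \<bullet> d = 0" by (rule orth[OF y dx dy])
    ultimately show ?thesis by (simp add: inner_diff_right)
  qed
  define l where "l x = (c x \<bullet> a x) / (a x \<bullet> a x)" for x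
  have cl: "c x = l x *\<^sub>R a x" if x: "a x \<noteq> 0" for x
  proof -
    let ?e = "c x - l x *\<^sub>R a x"
    have ae: "a x \<bullet> ?e = 0" using x by (simp add: l_def inner_diff_right inner_commute)
    moreover have "c x \<bullet> ?e = 0" by (rule orth1[OF x ae])
    ultimately have "?e \<bullet> ?e = 0" by (simp add: inner_diff_left[of "c x" "l x *\<^sub>R a x" "c x - l x *\<^sub>R a x"])
    then show ?thesis by simp
  qed
  \<comment> \<open>The bivector \<open>c x \<and> c y\<close> is \<open>l x * l y\<close> times
    \<open>a x \<and> a y\<close>, and the two bivectors are equal.\<close>
  have ll: "l x * l y = 1" if xy: "indep x y" for x y
  proof -
    let ?w = "(a y \<bullet> a x) *\<^sub>R a x - (a x \<bullet> a x) *\<^sub>R a y"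
    have "a y \<noteq> 0" using xy span_zero[of "{a x}"] by (auto simp: indep_def)
    then have "(l x * l y) *\<^sub>R ?w = ?w"
      using wedge[of y "a x" x] cl[of x] cl[of y] xy by (simp add: indep_def algebra_simps)
    then show ?thesis using nonzero[OF xy] by (metis scaleR_cancel_right scaleR_one)
  qed
  have l1: "l x = l y" if x: "a x \<noteq> 0" and y: "a y \<noteq> 0" for x y
  proof -
    obtain z where z: "a z \<notin> span {a x, a y}" using exists_image_not_in_span[OF rank] by blast
    then have "indep x z" "indep y z" using mono x y insert_commute unfolding indep_def by metis+
    then have "l x * l z = l y * l z" "l z \<noteq> 0" using ll by fastforce+
    then show ?thesis by simp
  qed
  obtain x where "a x \<notin> span {0, 0}" using exists_image_not_in_span[OF rank] by blast
  then have x: "a x \<noteq> 0" by (auto simp: span_zero)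
  obtain y where "a y \<notin> span {a x, a x}" using exists_image_not_in_span[OF rank] by blast
  then have xy: "indep x y" using x by (simp add: indep_def)
  have y: "a y \<noteq> 0" using span_zero[of "{a x}"] xy by (auto simp: indep_def)
  have "l x * l x = 1" using ll[OF xy] l1[OF x y] by simp
  then have lx: "l x = 1 \<or> l x = -1" by (simp add: square_eq_1_iff)
  \<comment> \<open>If \<open>a v = 0\<close>, the hypothesis contracted with \<open>c v\<close>
    gives \<open>c v \<and> c w = 0\<close>. A nonzero \<open>c v\<close> would put every
    \<open>a w\<close> on one line.\<close>
  have ker: "c v = 0" if v: "a v = 0" for v
  proof (rule ccontr)
    assume ne: "c v \<noteq> 0"
    have "a w = ((a w \<bullet> c v) / (c v \<bullet> c v)) *\<^sub>R c v" if w: "a w \<noteq> 0" for w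
    proof -
      have "l w \<noteq> 0" using l1[OF w x] lx by auto
      moreover have "(l w * (a w \<bullet> c v)) *\<^sub>R c v = (l w * (c v \<bullet> c v)) *\<^sub>R a w"
        using wedge[of w "c v" v] v cl[OF w] by (simp add: mult.commute)
      ultimately have "(a w \<bullet> c v) *\<^sub>R c v = (c v \<bullet> c v) *\<^sub>R a w"
        by (metis scaleR_scaleR scaleR_cancel_left)
      then show ?thesis using ne by (simp add: eq_vector_fraction_iff)
    qed
    then obtain s t where s: "a x = s *\<^sub>R c v" and t: "a y = t *\<^sub>R c v" using x y by metis
    then have "a y = (t / s) *\<^sub>R a x" using x by auto
    then have "a y \<in> span {a x}" by (metis span_base span_mul insertI1)
    then show False using xy by (simp add: indep_def)
  qed
  have "c v = l x *\<^sub>R a v" for v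
    using ker[of v] cl[of v] l1[of v x] x by (cases "a v = 0") auto
  then show ?thesis using lx by auto
qed

section \<open>The immersion determined by a commuting Codazzi tensor\<close>

lemma matrix_vector_mult_axis_sum:
  fixes M :: "real ^ 'i::finite ^ 'j::finite"
  shows "(\<Sum>j\<in>UNIV. e $ j *\<^sub>R (M *v axis j 1)) = M *v e"
proof -
  have "M *v e = M *v (\<Sum>j\<in>UNIV. e $ j *\<^sub>R axis j 1)"
    using basis_expansion[of e] by (simp add: scalar_mult_eq_scaleR)
  then show ?thesis
    by (simp add: linear_sum[OF matrix_vector_mul_linear] linear_scale[OF matrix_vector_mul_linear])
qed

locale codazzi_hypersurface = hypersurface \<A> met nabla f N A
  for \<A> :: "('m::{t2_space, second_countable_topology}, 'n::finite) chart set"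
    and met nabla and f N :: "'m \<Rightarrow> real ^ 'k::finite" and A +
  fixes met' :: "'m \<Rightarrow> real ^ 'n \<Rightarrow> real ^ 'n \<Rightarrow> real" and Q :: "'m \<Rightarrow> real ^ 'n \<Rightarrow> real ^ 'n"
  assumes connected_M: "connected (UNIV :: 'm set)" and simply_connected_M: "simply_connected (UNIV :: 'm set)"
    and codazzi: "codazzi_tensor \<A> met nabla Q"
    and bij_Q: "bij (Q p)"
    and met': "met' p v w = met p (Q p (Q p v)) w"
    and rank: "dim (range (A p)) \<ge> 3"
begin

lemma tensor_Q: "tensor_field_11 \<A> Q" and met_Q: "met p (Q p v) w = met p v (Q p w)"
  using codazzi by (simp_all add: codazzi_tensor_def self_adjoint_field_def)

lemma linear_Q: "linear (Q p)" and linear_A: "linear (A p)"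
  using tensor_Q tensor_A by (simp_all add: tensor_field_11_def)

lemma met'_eq: "met' p v w = df p (Q p v) \<bullet> df p (Q p w)"
  using met_Q[of p "Q p v" w] by (simp add: met' met_eq)

lemma df_cong: "(\<And>w. df p v \<bullet> df p w = df p v' \<bullet> df p w) \<Longrightarrow> v = v'"
proof -
  assume *: "\<And>w. df p v \<bullet> df p w = df p v' \<bullet> df p w"
  have "(df p v - df p v') \<bullet> (df p v - df p v') = 0"
    using *[of v] *[of v'] by (simp add: inner_diff_left inner_diff_right)
  then show "v = v'" by simp
qed

lemma grad_eqI:
  assumes "\<And>v. df p w \<bullet> df p v = dM \<A> u p v"
  shows "grad \<A> met u p = w"
  unfolding grad_def
proof (rule the_equality)
  fix w' assume "\<forall>v. met p w' v = dM \<A> u p v"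
  then show "w' = w" by (intro df_cong[of p]) (simp add: assms met_eq)
qed (simp add: assms met_eq)

text \<open>Commutation makes \<open>met p (A p a) (Q p b)\<close> symmetric in \<open>a\<close> and
  \<open>b\<close>, so the normal term of \<open>codazzi_ambient\<close> vanishes and the form is
  closed.\<close>

lemma commuting_imp_immersion:
  assumes comm: "\<And>p v. Q p (A p v) = A p (Q p v)"
  shows "\<exists>F. smooth_map \<A> F \<and> (\<forall>p v. dM \<A> F p v = df p (Q p v))"
proof -
  \<comment> \<open>The columns of \<open>ambient Q\<close>: the form assembled from them is
    \<open>ambient Q\<close> applied to \<open>df\<close>, which is \<open>df\<close> composed with
    \<open>Q\<close>.\<close>
  let ?w = "\<lambda>j p. ambient Q p *v axis j 1"
  have sm: "smooth_map \<A> (?w j)" for j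
    by (rule smooth_map_matrix_vector[OF smooth_ambient[OF tensor_Q] smooth_map_const])
  have dw: "dM \<A> (?w j) p v = dM \<A> (ambient Q) p v *v axis j 1" for j p v
    using dM_matrix_vector[OF smooth_ambient[OF tensor_Q] smooth_map_const] by (simp add: dM_const)
  have "met p (A p a) (Q p b) = met p (A p b) (Q p a)" for p a b
    using met_Q[of p "A p a" b] met_A[of p "Q p a" b] comm by (simp add: met_eq inner_commute)
  then have "dM \<A> (ambient Q) p a *v df p b = dM \<A> (ambient Q) p b *v df p a" for p a b
    using codazzi_ambient[OF codazzi, of p a b] by simp
  then have closed: "(\<Sum>j\<in>UNIV. df p u $ j *\<^sub>R dM \<A> (?w j) p v) = (\<Sum>j\<in>UNIV. df p v $ j *\<^sub>R dM \<A> (?w j) p u)" for p u v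
    unfolding dw matrix_vector_mult_axis_sum .
  obtain F where F: "smooth_map \<A> F" "\<And>p v. dM \<A> F p v = (\<Sum>j\<in>UNIV. df p v $ j *\<^sub>R ?w j p)"
    using closed_form_exact[OF simply_connected_M smooth_f sm closed] by blast
  have "dM \<A> F p v = df p (Q p v)" for p v
    unfolding F(2) matrix_vector_mult_axis_sum by (simp add: ambient_mult[OF tensor_Q])
  then show ?thesis using F(1) by blast
qed

lemma isometric_immersionI:
  assumes "smooth_map \<A> F" "\<And>p v. dM \<A> F p v = df p (Q p v)"
  shows "isometric_immersion \<A> met' F"
  unfolding isometric_immersion_def
proof (intro conjI allI)
  show "inj (dM \<A> F p)" for p
    using bij_Q[of p] by (auto simp: inj_def assms(2) bij_def)
qed (simp_all add: assms met'_eq)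

text \<open>The form pairing \<open>F\<close> with \<open>df\<close> is closed because
  \<open>Q\<close> is self-adjoint. Its primitive \<open>g\<close> has the tangential part of
  \<open>F\<close> as gradient, and the Hessian formula is the tangential part of the derivative of
  \<open>F = df (grad g) + h N\<close>.\<close>

lemma support_functions:
  assumes F: "smooth_map \<A> F" and dF: "\<And>p v. dM \<A> F p v = df p (Q p v)"
  shows "\<exists>g h :: 'm \<Rightarrow> real. smooth_map \<A> g \<and> smooth_map \<A> h \<and>
    (\<forall>p. A p (grad \<A> met g p) = - grad \<A> met h p) \<and>
    (\<forall>X. smooth_vector_field \<A> X \<longrightarrow> (\<forall>p. Q p (X p) = nabla X (grad \<A> met g) p - h p *\<^sub>R A p (X p))) \<and>
    (\<forall>p. df p (grad \<A> met g p) + h p *\<^sub>R N p = F p)"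
proof -
  have closed: "(\<Sum>j\<in>UNIV. df p u $ j *\<^sub>R dM \<A> (\<lambda>p. F p $ j) p v) =
      (\<Sum>j\<in>UNIV. df p v $ j *\<^sub>R dM \<A> (\<lambda>p. F p $ j) p u)" for p u v
  proof -
    have "(\<Sum>j\<in>UNIV. df p u $ j *\<^sub>R dM \<A> (\<lambda>p. F p $ j) p v) = df p u \<bullet> df p (Q p v)" for u v
      by (simp add: dM_nth[OF F] dF inner_vec_def)
    then show ?thesis using met_Q[of p u v] by (simp add: met_eq inner_commute)
  qed
  obtain g :: "'m \<Rightarrow> real" where g: "smooth_map \<A> g" "\<And>p v. dM \<A> g p v = (\<Sum>j\<in>UNIV. df p v $ j *\<^sub>R F p $ j)"
    using closed_form_exact[OF simply_connected_M smooth_f smooth_map_nth[OF F] closed] by blast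
  have dg: "dM \<A> g p v = F p \<bullet> df p v" for p v
    unfolding g(2) by (simp add: inner_vec_def mult.commute)
  define h where "h p = F p \<bullet> N p" for p
  have h: "smooth_map \<A> h" unfolding h_def by (rule smooth_map_inner[OF F smooth_N])
  have dh: "dM \<A> h p v = - (F p \<bullet> df p (A p v))" for p v
    unfolding h_def dM_inner[OF F smooth_N] by (simp add: dF dM_N)
  have grad_g: "grad \<A> met g p = tang p (F p)" for p
    by (rule grad_eqI) (simp add: dg df_tang inner_diff_left)
  have split: "df p (tang p (F p)) + h p *\<^sub>R N p = F p" for p
    by (simp add: df_tang h_def)
  have F_df: "F p \<bullet> df p v = df p (tang p (F p)) \<bullet> df p v" for p v
    by (simp add: df_tang inner_diff_left)
  have grad_h: "grad \<A> met h p = - A p (tang p (F p))" for p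
    by (rule grad_eqI) (simp add: dh F_df linear_neg[OF linear_df] df_A)
  have hess: "Q p (X p) = nabla X (\<lambda>p. tang p (F p)) p - h p *\<^sub>R A p (X p)" if X: "smooth_vector_field \<A> X" for X p
  proof -
    let ?G = "\<lambda>p. tang p (F p)"
    have G: "smooth_vector_field \<A> ?G" by (rule smooth_tang[OF F])
    have "df p (Q p (X p)) = dM \<A> (\<lambda>p. df p (?G p) + h p *\<^sub>R N p) p (X p)"
      by (simp add: split dF)
    also have "\<dots> = df p (nabla X ?G p) + met p (A p (X p)) (?G p) *\<^sub>R N p
        + (h p *\<^sub>R dM \<A> N p (X p) + dM \<A> h p (X p) *\<^sub>R N p)"
      unfolding dM_add[OF smooth_df[OF G] smooth_map_scaleR[OF h smooth_N]] dM_scaleR[OF h smooth_N]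
        gauss_formula[OF X G] ..
    \<comment> \<open>The normal terms cancel: the derivative of \<open>h\<close> is minus the
      pairing of \<open>F\<close> with \<open>df (A X)\<close>.\<close>
    also have "\<dots> = df p (nabla X ?G p - h p *\<^sub>R A p (X p))"
      by (simp add: dh F_df met_eq dM_N inner_commute linear_diff[OF linear_df] linear_scale[OF linear_df])
    finally show ?thesis by simp
  qed
  have "A p (grad \<A> met g p) = - grad \<A> met h p" for p by (simp add: grad_g grad_h)
  moreover have "grad \<A> met g = (\<lambda>p. tang p (F p))" using grad_g by (rule ext)
  ultimately show ?thesis using g(1) h hess split
    by (intro exI[of _ g] exI[of _ h] conjI) simp_all
qed

end

section \<open>Unit normals as determinants\<close>

definition outer :: "real ^ 'i \<Rightarrow> real ^ 'j \<Rightarrow> real ^ 'j ^ 'i" where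
  "outer a b = (\<chi> i j. a $ i * b $ j)"

lemma outer_mult: "outer a b *v x = (b \<bullet> x) *\<^sub>R a"
  by (simp add: vec_eq_iff outer_def matrix_vector_mult_def inner_vec_def sum_distrib_left mult.commute mult.left_commute)

lemma transpose_mult_inner: "(transpose M *v x) \<bullet> y = x \<bullet> (M *v y)" for M :: "real ^ 'i::finite ^ 'j::finite"
  by (metis dot_lmul_matrix transpose_matrix_vector)

lemma orthogonal_matrixI_inner:
  fixes R :: "real ^ 'i::finite ^ 'i"
  assumes "\<And>x y. (R *v x) \<bullet> (R *v y) = x \<bullet> y"
  shows "orthogonal_matrix R"
proof -
  have "orthogonal_transformation (\<lambda>x. R *v x)"
    by (simp add: orthogonal_transformation_def assms)
  then show ?thesis by (simp add: orthogonal_transformation_matrix)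
qed

lemma orthogonal_matrix_mult_transpose:
  assumes "orthogonal_matrix R"
  shows "R *v (transpose R *v x) = x"
  using assms by (simp add: orthogonal_matrix_def matrix_vector_mul_assoc)

text \<open>\<open>M\<close> agrees with \<open>R\<close> on the complement of \<open>n\<close> and
  sends \<open>n\<close> to \<open>a\<close>. After a rotation taking a basis vector to
  \<open>n\<close>, it is an orthogonal matrix with one column replaced by \<open>a\<close>, so its
  determinant is given by \<open>cramer_lemma\<close>.\<close>

lemma det_rotation_plus_outer:
  fixes R :: "real ^ 'i::finite ^ 'i"
  assumes R: "\<And>x y. (R *v x) \<bullet> (R *v y) = x \<bullet> y" and n: "norm n = 1"
    and M: "\<And>y. M *v y = R *v y + (n \<bullet> y) *\<^sub>R (a - R *v n)"
  shows "det M = ((R *v n) \<bullet> a) * det R"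
proof -
  fix k :: 'i
  obtain g :: "real ^ 'i \<Rightarrow> real ^ 'i" where g: "orthogonal_transformation g" "g (axis k 1) = n"
    using orthogonal_transformation_exists_1[OF norm_axis_1 n] by blast
  define T where "T = matrix g"
  have T: "T *v x = g x" for x
    unfolding T_def using g(1) by (metis matrix_vector_mul(2) orthogonal_transformation_linear)
  have oT: "orthogonal_matrix T" using g(1) by (simp add: orthogonal_transformation_matrix T_def)
  have oRT: "orthogonal_matrix (R ** T)" by (rule orthogonal_matrix_mul[OF orthogonal_matrixI_inner[OF R] oT])
  define x where "x = transpose (R ** T) *v a"
  have a: "(R ** T) *v x = a" unfolding x_def by (rule orthogonal_matrix_mult_transpose[OF oRT])
  have "M ** T = (\<chi> i j. if j = k then ((R ** T) *v x) $ i else (R ** T) $ i $ j)"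
  proof (simp only: vec_eq_iff vec_lambda_beta, intro allI)
    fix i j
    have "(M ** T) $ i $ j = (M *v g (axis j 1)) $ i" "(R ** T) $ i $ j = (R *v g (axis j 1)) $ i"
      using T[of "axis j 1"]
      by (simp_all add: matrix_matrix_mult_def matrix_vector_mult_def vec_eq_iff axis_def if_distrib cong: if_cong)
    moreover have "n \<bullet> g (axis j 1) = axis k 1 \<bullet> axis j (1::real)"
      using g unfolding orthogonal_transformation_def by metis
    ultimately show "(M ** T) $ i $ j = (if j = k then ((R ** T) *v x) $ i else (R ** T) $ i $ j)"
      unfolding a using g(2) by (auto simp: M inner_axis_axis)
  qed
  then have "det (M ** T) = x $ k * det (R ** T)" by (simp only: cramer_lemma)
  moreover have "x $ k = (R *v n) \<bullet> a"
  proof -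
    have "x $ k = x \<bullet> axis k 1" by (simp add: inner_axis)
    also have "\<dots> = a \<bullet> ((R ** T) *v axis k 1)" unfolding x_def by (rule transpose_mult_inner)
    finally show ?thesis by (simp add: matrix_vector_mul_assoc[symmetric] T g(2) inner_commute)
  qed
  moreover have "det T \<noteq> 0" using det_orthogonal_matrix[OF oT] by auto
  ultimately show ?thesis by (simp add: det_mul)
qed

section \<open>Rigidity\<close>

locale dual_immersion = codazzi_hypersurface \<A> met nabla f N A met' Q
  for \<A> :: "('m::{t2_space, second_countable_topology}, 'n::finite) chart set"
    and met nabla and f N :: "'m \<Rightarrow> real ^ 'k::finite" and A met' Q +
  fixes ft :: "'m \<Rightarrow> real ^ 'k"
  assumes immersion_ft: "isometric_immersion \<A> met' ft"
begin

lemma smooth_ft: "smooth_map \<A> ft" and inj_dft: "inj (dM \<A> ft p)"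
  and dft_inner: "dM \<A> ft p v \<bullet> dM \<A> ft p w = df p (Q p v) \<bullet> df p (Q p w)"
  using immersion_ft by (simp_all add: isometric_immersion_def met'_eq)

lemma linear_dft: "linear (dM \<A> ft p)" by (rule linear_dM[OF smooth_ft])

lemma Q_inv [simp]: "Q p (inv (Q p) v) = v" and inv_Q [simp]: "inv (Q p) (Q p v) = v"
  using bij_Q[of p] by (simp_all add: bij_def surj_f_inv_f inv_f_f)

lemma linear_inv_Q: "linear (inv (Q p))"
proof (rule linearI)
  have inj: "v = w" if "Q p v = Q p w" for v w using that by (metis inv_Q)
  show "inv (Q p) (x + y) = inv (Q p) x + inv (Q p) y" for x y
    by (rule inj) (simp add: linear_add[OF linear_Q])
  show "inv (Q p) (r *\<^sub>R x) = r *\<^sub>R inv (Q p) x" for r x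
    by (rule inj) (simp add: linear_scale[OF linear_Q])
qed

lemma tensor_inv_Q: "tensor_field_11 \<A> (\<lambda>p. inv (Q p))"
  unfolding tensor_field_11_def
proof (intro conjI allI impI linear_inv_Q)
  fix X assume X: "smooth_vector_field \<A> X"
  show "smooth_vector_field \<A> (\<lambda>p. inv (Q p) (X p))"
  proof (rule smooth_vector_fieldI)
    \<comment> \<open>\<open>ambient Q\<close> is singular along \<open>N\<close>; adding the
      projection to the normal line makes it invertible without changing it on tangent vectors. The
      field sought is then the solution of a smooth linear system.\<close>
    let ?G = "\<lambda>p. ambient Q p + outer (N p) (N p)"
    have G: "?G p *v e = df p (Q p (tang p e)) + (N p \<bullet> e) *\<^sub>R N p" for p e
      by (simp add: matrix_vector_mult_add_rdistrib ambient_mult[OF tensor_Q] outer_mult)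
    have "smooth_map \<A> ?G"
      by (rule smooth_matrixI, unfold matrix_vector_mult_add_rdistrib outer_mult)
        (intro smooth_map_add smooth_map_matrix_vector smooth_ambient tensor_Q smooth_map_const
          smooth_map_scaleR smooth_map_inner smooth_N)
    then have entries: "smooth_map \<A> (\<lambda>p. ?G p $ i $ j)" for i j
      by (intro smooth_map_nth)
    have "e = 0" if "?G p *v e = 0" for p e
    proof -
      have "N p \<bullet> (?G p *v e) = 0" using that by simp
      then have n: "N p \<bullet> e = 0" unfolding G by (simp add: inner_add_right)
      then have "df p (Q p (tang p e)) = df p (Q p 0)"
        using that unfolding G by (simp add: linear_0[OF linear_df] linear_0[OF linear_Q])
      then have "tang p e = 0" by (metis df_eq_iff inv_Q)
      then show ?thesis using decompose[of e p] n by (simp add: linear_0[OF linear_df] inner_commute)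
    qed
    then have "det (?G p) \<noteq> 0" for p
      by (metis invertible_det_nz invertible_left_inverse matrix_left_invertible_ker)
    then show "smooth_map \<A> (\<lambda>p. df p (inv (Q p) (X p)))"
      by (rule smooth_map_linear_system[OF entries smooth_df[OF X]]) (simp add: G)
  qed
qed

text \<open>The tangential part of the orthogonal matrix carrying the old frame to the new one. It
  is available before a normal of \<open>ft\<close> is known and has \<open>N\<close> in its
  kernel.\<close>

definition S :: "'m \<Rightarrow> real ^ 'k ^ 'k" where
  "S p = matrix (\<lambda>e. dM \<A> ft p (inv (Q p) (tang p e)))"

lemma S_mult: "S p *v e = dM \<A> ft p (inv (Q p) (tang p e))"
proof -
  have "linear (\<lambda>e. dM \<A> ft p (inv (Q p) (tang p e)))"
    using linear_compose[OF linear_compose[OF linear_tang linear_inv_Q] linear_dft, of p p p] by (simp add: o_def)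
  then show ?thesis unfolding S_def by (rule matrix_vector_mul(2)[THEN fun_cong])
qed

lemma smooth_S: "smooth_map \<A> S"
proof (rule smooth_matrixI)
  fix e
  have "smooth_vector_field \<A> (\<lambda>p. inv (Q p) (tang p e))"
    using tensor_inv_Q smooth_tang[OF smooth_map_const, of e] by (simp add: tensor_field_11_def)
  then show "smooth_map \<A> (\<lambda>p. S p *v e)"
    unfolding S_mult by (rule smooth_map_dM_field[OF smooth_ft])
qed

text \<open>Completes \<open>S\<close> by sending \<open>N\<close> to a candidate normal
  \<open>\<nu>\<close>; with a unit normal of \<open>ft\<close> in this place it is the matrix
  \<open>R\<close>.\<close>

definition frame :: "'m \<Rightarrow> real ^ 'k \<Rightarrow> real ^ 'k ^ 'k" where
  "frame p \<nu> = S p + outer \<nu> (N p)"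

lemma frame_mult: "frame p \<nu> *v e = dM \<A> ft p (inv (Q p) (tang p e)) + (N p \<bullet> e) *\<^sub>R \<nu>"
  by (simp add: frame_def matrix_vector_mult_add_rdistrib outer_mult S_mult)

lemma frame_inner:
  assumes "norm \<nu> = 1" "\<And>v. \<nu> \<bullet> dM \<A> ft p v = 0"
  shows "(frame p \<nu> *v x) \<bullet> (frame p \<nu> *v y) = x \<bullet> y"
proof -
  have "\<nu> \<bullet> \<nu> = 1" "\<And>v. dM \<A> ft p v \<bullet> \<nu> = 0"
    using assms by (simp_all add: dot_square_norm inner_commute)
  then have "(frame p \<nu> *v x) \<bullet> (frame p \<nu> *v y) = df p (tang p x) \<bullet> df p (tang p y) + (N p \<bullet> x) * (N p \<bullet> y)"
    by (simp add: frame_mult inner_add_left inner_add_right assms(2) dft_inner)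
  also have "\<dots> = x \<bullet> y"
    by (simp add: df_tang inner_diff_left inner_diff_right inner_commute)
  finally show ?thesis .
qed

lemma frame_N: "frame p \<nu> *v N p = \<nu>"
  by (simp add: frame_mult linear_0[OF linear_inv_Q] linear_0[OF linear_dft])

text \<open>The components of \<open>Nt\<close> are those of a generalized cross product: the basis
  vectors are put one after another in the normal slot of \<open>S\<close> and the determinant is
  taken, which is smooth. At each point this equals \<open>det (frame p \<nu>)\<close> times
  \<open>\<nu>\<close>, the same for both unit normals \<open>\<nu>\<close>, and the determinant has
  absolute value 1.\<close>

lemma unit_normal_exists: "\<exists>Nt. unit_normal_field \<A> ft Nt"
proof -
  define Nt where "Nt p = (\<chi> i. det (S p + outer (axis i 1) (N p)))" for p
  have "smooth_map \<A> Nt"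
    unfolding Nt_def
  proof (intro smooth_map_vec smooth_map_det smooth_map_nth)
    fix i
    show "smooth_map \<A> (\<lambda>p. S p + outer (axis i 1) (N p))"
      by (rule smooth_matrixI, unfold matrix_vector_mult_add_rdistrib outer_mult)
        (intro smooth_map_add smooth_map_matrix_vector smooth_S smooth_map_const
          smooth_map_scaleR smooth_map_inner smooth_N)
  qed
  moreover have "norm (Nt p) = 1 \<and> (\<forall>v. Nt p \<bullet> dM \<A> ft p v = 0)" for p
  proof -
    have "dim (range (dM \<A> ft p)) = CARD('n)"
      using dim_image_eq[OF linear_dft, of p UNIV] inj_dft[of p] by (simp add: inj_on_subset)
    then have "dim (range (dM \<A> ft p)) < DIM(real ^ 'k)" using codim by simp
    then obtain w where w: "w \<noteq> 0" "\<And>y. y \<in> span (range (dM \<A> ft p)) \<Longrightarrow> orthogonal w y"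
      using orthogonal_to_subspace_exists by blast
    define \<nu> where "\<nu> = w /\<^sub>R norm w"
    have \<nu>: "norm \<nu> = 1" "\<And>v. \<nu> \<bullet> dM \<A> ft p v = 0"
      using w by (simp_all add: \<nu>_def orthogonal_def span_base)
    note iso = frame_inner[OF \<nu>]
    have "Nt p $ i = det (frame p \<nu>) * \<nu> $ i" for i
    proof -
      have "det (S p + outer (axis i 1) (N p)) = ((frame p \<nu> *v N p) \<bullet> axis i 1) * det (frame p \<nu>)"
        by (rule det_rotation_plus_outer[OF iso norm_N])
          (simp add: frame_N, simp add: frame_def matrix_vector_mult_add_rdistrib outer_mult algebra_simps)
      then show ?thesis by (simp add: Nt_def frame_N inner_axis)
    qed
    then have "Nt p = det (frame p \<nu>) *\<^sub>R \<nu>" by (simp add: vec_eq_iff)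
    moreover have "\<bar>det (frame p \<nu>)\<bar> = 1"
      using det_orthogonal_matrix[OF orthogonal_matrixI_inner[OF iso]] by auto
    ultimately show ?thesis using \<nu> by simp
  qed
  ultimately show ?thesis unfolding unit_normal_field_def by blast
qed

end

text \<open>The orthogonal matrices \<^term>\<open>R p\<close> carry the frame of the given immersion to that of
  \<^term>\<open>ft\<close>. The connection form \<open>R\<^sup>-\<^sup>1 dR\<close> exchanges tangent and normal directions only, and
  \<open>\<kappa>\<close> is its mixed part.\<close>

locale framed_immersion = dual_immersion \<A> met nabla f N A met' Q ft
  for \<A> :: "('m::{t2_space, second_countable_topology}, 'n::finite) chart set"
    and met nabla and f N :: "'m \<Rightarrow> real ^ 'k::finite" and A met' Q and ft :: "'m \<Rightarrow> real ^ 'k" +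
  fixes Nt :: "'m \<Rightarrow> real ^ 'k"
  assumes normal_ft: "unit_normal_field \<A> ft Nt"
begin

abbreviation R :: "'m \<Rightarrow> real ^ 'k ^ 'k" where "R p \<equiv> frame p (Nt p)"
abbreviation dR :: "'m \<Rightarrow> real ^ 'n \<Rightarrow> real ^ 'k ^ 'k" where "dR p v \<equiv> dM \<A> (\<lambda>q. frame q (Nt q)) p v"

lemma smooth_Nt: "smooth_map \<A> Nt" and norm_Nt: "norm (Nt p) = 1" and Nt_dft: "Nt p \<bullet> dM \<A> ft p v = 0"
  using normal_ft by (simp_all add: unit_normal_field_def)

lemma R_inner: "(R p *v x) \<bullet> (R p *v y) = x \<bullet> y"
  by (rule frame_inner[OF norm_Nt Nt_dft])

lemma R_df: "R p *v df p v = dM \<A> ft p (inv (Q p) v)"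
  by (simp add: frame_mult)

lemma smooth_R: "smooth_map \<A> (\<lambda>q. frame q (Nt q))"
  by (rule smooth_matrixI, unfold frame_def matrix_vector_mult_add_rdistrib outer_mult)
    (intro smooth_map_add smooth_map_matrix_vector smooth_S smooth_map_const
      smooth_map_scaleR smooth_map_inner smooth_N smooth_Nt)

lemma smooth_R_mult: "smooth_map \<A> (\<lambda>q. R q *v e)"
  by (rule smooth_map_matrix_vector[OF smooth_R smooth_map_const])

lemma dM_R_mult: "dM \<A> (\<lambda>q. R q *v e) p v = dR p v *v e"
  using dM_matrix_vector[OF smooth_R smooth_map_const] by (simp add: dM_const)

lemma orthogonal_R: "orthogonal_matrix (R p)"
  by (rule orthogonal_matrixI_inner[OF R_inner])

lemma R_ext:
  assumes "\<And>e. (R p *v e) \<bullet> x = (R p *v e) \<bullet> y"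
  shows "x = y"
proof -
  have "(x - y) \<bullet> (x - y) = (R p *v (transpose (R p) *v (x - y))) \<bullet> (x - y)"
    by (simp only: orthogonal_matrix_mult_transpose[OF orthogonal_R])
  also have "\<dots> = 0" using assms by (simp add: inner_diff_right)
  finally show ?thesis by simp
qed

lemma dR_skew: "(R p *v e') \<bullet> (dR p v *v e) = - ((R p *v e) \<bullet> (dR p v *v e'))"
proof -
  have "dM \<A> (\<lambda>q. (R q *v e) \<bullet> (R q *v e')) p v = 0" unfolding R_inner by (rule dM_const)
  then show ?thesis
    unfolding dM_inner[OF smooth_R_mult smooth_R_mult] dM_R_mult by (simp add: inner_commute)
qed

text \<open>The differential of \<open>ft\<close> is \<open>R ** ambient Q\<close> applied to
  \<open>df\<close>. Closedness of this form gives two kinds of terms, and those with the derivative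
  of \<open>ambient Q\<close> are known from the Codazzi equation of \<open>Q\<close>.\<close>

lemma dR_codazzi:
  "dR p a *v df p (Q p b) - dR p b *v df p (Q p a) =
    (met p (A p b) (Q p a) - met p (A p a) (Q p b)) *\<^sub>R Nt p"
proof -
  let ?W = "\<lambda>p. R p ** ambient Q p" and ?dQ = "\<lambda>v. dM \<A> (ambient Q) p v"
  have W: "smooth_map \<A> ?W" by (rule smooth_map_matrix_matrix[OF smooth_R smooth_ambient[OF tensor_Q]])
  have "dM \<A> ft p v = ?W p *v df p v" for p v
    by (simp add: matrix_vector_mul_assoc[symmetric] ambient_mult[OF tensor_Q] R_df)
  from exact_form_closed[OF smooth_ft W this, of p a b]
  have "R p *v (?dQ a *v df p b) + dR p a *v df p (Q p b) = R p *v (?dQ b *v df p a) + dR p b *v df p (Q p a)"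
    unfolding dM_matrix_matrix[OF smooth_R smooth_ambient[OF tensor_Q]]
    by (simp add: matrix_vector_mult_add_rdistrib matrix_vector_mul_assoc[symmetric] ambient_mult[OF tensor_Q])
  then have "dR p a *v df p (Q p b) - dR p b *v df p (Q p a) = - (R p *v (?dQ a *v df p b - ?dQ b *v df p a))"
    by (simp add: matrix_vector_mult_diff_distrib algebra_simps)
  also have "\<dots> = (met p (A p b) (Q p a) - met p (A p a) (Q p b)) *\<^sub>R (R p *v N p)"
    unfolding codazzi_ambient[OF codazzi] linear_scale[OF matrix_vector_mul_linear]
    by (simp add: scaleR_left_diff_distrib)
  finally show ?thesis by (simp add: frame_N)
qed

text \<open>Again a trilinear form that is symmetric in two arguments and skew in two others.\<close>

lemma dR_tangential: "(R p *v df p z) \<bullet> (dR p a *v df p b) = 0"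
proof -
  \<comment> \<open>Inserting \<open>Q b\<close> rather than \<open>b\<close> is what makes
    \<open>dR_codazzi\<close> yield symmetry in \<open>a\<close> and \<open>b\<close>; invertibility
    of \<open>Q\<close> removes it at the end.\<close>
  define T where "T a b z = (R p *v df p (Q p z)) \<bullet> (dR p a *v df p (Q p b))" for a b z
  have Nt: "(R p *v df p v) \<bullet> Nt p = 0" for v
    using R_inner[of p "df p v" "N p"] by (simp add: frame_N)
  have sym: "T a b z = T b a z" for a b z
  proof -
    have "(R p *v df p (Q p z)) \<bullet> (dR p a *v df p (Q p b) - dR p b *v df p (Q p a)) = 0"
      unfolding dR_codazzi by (simp add: Nt)
    then show ?thesis by (simp add: T_def inner_diff_right)
  qed
  have skew: "T a b z = - T a z b" for a b z unfolding T_def by (rule dR_skew)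
  have T0: "T a b z = 0" for a b z
  proof -
    have "T a b z = - T a z b" by (rule skew)
    also have "\<dots> = - T z a b" using sym[of a z b] by simp
    also have "\<dots> = T z b a" using skew[of z a b] by simp
    also have "\<dots> = T b z a" by (rule sym)
    also have "\<dots> = - T b a z" by (rule skew)
    also have "\<dots> = - T a b z" using sym[of b a z] by simp
    finally show ?thesis by simp
  qed
  show ?thesis using T0[of a "inv (Q p) b" "inv (Q p) z"] by (simp add: T_def)
qed

definition \<kappa> :: "'m \<Rightarrow> real ^ 'n \<Rightarrow> real ^ 'k \<Rightarrow> real" where
  "\<kappa> p v e = Nt p \<bullet> (dR p v *v e)"

lemma kappa_N: "\<kappa> p v (N p) = 0"
  using dR_skew[of p "N p" v "N p"] by (simp add: \<kappa>_def frame_N)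

text \<open>The form \<open>R\<inverse> dR\<close> is skew and has no tangent-tangent block, hence
  is determined by \<open>\<kappa>\<close> as a wedge with the normal.\<close>

lemma dR_mixed: "(R p *v e') \<bullet> (dR p v *v e) = \<kappa> p v e * (N p \<bullet> e') - \<kappa> p v e' * (N p \<bullet> e)"
proof -
  have "R p *v e' = R p *v df p (tang p e') + (e' \<bullet> N p) *\<^sub>R Nt p"
    by (subst decompose[of e' p])
      (simp only: matrix_vector_right_distrib linear_scale[OF matrix_vector_mul_linear] frame_N)
  then have "(R p *v e') \<bullet> (dR p v *v df p t) = \<kappa> p v (df p t) * (N p \<bullet> e')" for t
    by (simp add: inner_add_left dR_tangential \<kappa>_def inner_commute[of e'])
  moreover have "(R p *v e') \<bullet> (dR p v *v N p) = - \<kappa> p v e'"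
    using dR_skew[of p e' v "N p"] by (simp add: \<kappa>_def frame_N)
  moreover have "\<kappa> p v e = \<kappa> p v (df p (tang p e))"
    using kappa_N[of p v] unfolding \<kappa>_def
    by (subst decompose[of e p])
      (simp add: matrix_vector_right_distrib linear_scale[OF matrix_vector_mul_linear] inner_add_right)
  moreover have "dR p v *v e = dR p v *v df p (tang p e) + (e \<bullet> N p) *\<^sub>R (dR p v *v N p)"
    by (subst decompose[of e p]) (simp add: matrix_vector_right_distrib linear_scale[OF matrix_vector_mul_linear])
  ultimately show ?thesis by (simp add: inner_add_right inner_commute)
qed

lemma dR_tangent_eq:
  assumes "N p \<bullet> e = 0"
  shows "dR p v *v e = \<kappa> p v e *\<^sub>R Nt p"
proof (rule R_ext[of p])
  fix e'
  have "(R p *v e') \<bullet> Nt p = N p \<bullet> e'" using R_inner[of p e' "N p"] by (simp add: frame_N inner_commute)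
  then show "(R p *v e') \<bullet> (dR p v *v e) = (R p *v e') \<bullet> (\<kappa> p v e *\<^sub>R Nt p)"
    by (simp add: dR_mixed assms)
qed

text \<open>Flatness of \<open>R\<^sup>-\<^sup>1 dR\<close>, evaluated on two tangent directions; with \<open>c = \<kappa> + df \<circ> A\<close> this is the
  Gauss equation \<open>c \<and> c = (df \<circ> A) \<and> (df \<circ> A)\<close>.\<close>

lemma kappa_flat:
  assumes e: "N p \<bullet> e = 0" and e': "N p \<bullet> e' = 0"
  shows "\<kappa> p a e' * \<kappa> p b e - \<kappa> p b e' * \<kappa> p a e =
    \<kappa> p b e' * (df p (A p a) \<bullet> e) - \<kappa> p b e * (df p (A p a) \<bullet> e')
    + \<kappa> p a e * (df p (A p b) \<bullet> e') - \<kappa> p a e' * (df p (A p b) \<bullet> e)"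
proof -
  obtain X where X: "smooth_vector_field \<A> X" "X p = a" by (rule vector_field_through)
  obtain Y where Y: "smooth_vector_field \<A> Y" "Y p = b" by (rule vector_field_through)
  let ?u = "\<lambda>q. R q *v e" and ?u' = "\<lambda>q. R q *v e'"
  \<comment> \<open>The ambient vectors \<open>e\<close> and \<open>e'\<close> are constant, hence
    tangent at \<open>p\<close> only. The functions \<open>N q \<bullet> e\<close> and
    \<open>N q \<bullet> e'\<close> vanish at \<open>p\<close>, but their derivatives do not in
    general, and these bring in \<open>A\<close>.\<close>
  have D: "dM \<A> (\<lambda>q. ?u' q \<bullet> dM \<A> ?u q (Z q)) p v =
      \<kappa> p (Z p) e' * (df p (A p v) \<bullet> e) - \<kappa> p (Z p) e * (df p (A p v) \<bullet> e')"
    if Z: "smooth_vector_field \<A> Z" for Z v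
  proof -
    have k: "smooth_map \<A> (\<lambda>q. \<kappa> q (Z q) e)" for e
      unfolding \<kappa>_def dM_R_mult[symmetric]
      by (rule smooth_map_inner[OF smooth_Nt smooth_map_dM_field[OF smooth_R_mult Z]])
    have n: "smooth_map \<A> (\<lambda>q. N q \<bullet> e)" for e by (rule smooth_map_inner[OF smooth_N smooth_map_const])
    have dn: "dM \<A> (\<lambda>q. N q \<bullet> e) p v = - (df p (A p v) \<bullet> e)" for e
      unfolding dM_inner[OF smooth_N smooth_map_const] by (simp add: dM_const dM_N)
    note M = bounded_bilinear_mult
    show ?thesis
      unfolding dM_R_mult dR_mixed dM_diff[OF smooth_map_bilinear[OF M k n] smooth_map_bilinear[OF M k n]]
        dM_bilinear[OF M k n] dn
      by (simp add: e e')
  qed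
  \<comment> \<open>The same antisymmetrized derivative is computed by the product rule: the bracket
    term dies because \<open>R\<inverse> dR\<close> has no tangent-tangent block, and the remaining
    products are the quadratic terms in \<open>\<kappa>\<close>.\<close>
  have leibniz: "(dM \<A> (\<lambda>q. ?u' q \<bullet> dM \<A> ?u q (Y q)) p a) - (dM \<A> (\<lambda>q. ?u' q \<bullet> dM \<A> ?u q (X q)) p b) =
      ?u' p \<bullet> (dM \<A> ?u p (nabla X Y p) - dM \<A> ?u p (nabla Y X p))
      + (dM \<A> ?u' p a \<bullet> dM \<A> ?u p b - dM \<A> ?u' p b \<bullet> dM \<A> ?u p a)"
    unfolding dM_inner[OF smooth_R_mult smooth_map_dM_field[OF smooth_R_mult X(1)]]
      dM_inner[OF smooth_R_mult smooth_map_dM_field[OF smooth_R_mult Y(1)]]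
      bracket[OF X(1) Y(1) smooth_R_mult]
    by (simp add: X Y inner_diff_right)
  have "?u' p \<bullet> (dM \<A> ?u p (nabla X Y p) - dM \<A> ?u p (nabla Y X p)) = 0"
    unfolding dM_R_mult inner_diff_right dR_mixed by (simp add: e e')
  moreover have "Nt p \<bullet> Nt p = 1" using norm_Nt[of p] by (simp add: dot_square_norm)
  moreover have "dM \<A> ?u p v = \<kappa> p v e *\<^sub>R Nt p" "dM \<A> ?u' p v = \<kappa> p v e' *\<^sub>R Nt p" for v
    by (simp_all add: dM_R_mult dR_tangent_eq e e')
  ultimately show ?thesis
    using leibniz[unfolded D[OF X(1)] D[OF Y(1)]] by (simp add: X Y) (simp add: algebra_simps)
qed

text \<open>If \<open>At\<close> is the shape operator of \<open>ft\<close>, this is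
  \<open>df p (Q p (At p v))\<close>: the map \<open>C\<close> transported to the ambient space,
  written without assuming that \<open>At\<close> exists.\<close>

definition shape_vector :: "'m \<Rightarrow> real ^ 'n \<Rightarrow> real ^ 'k" where
  "shape_vector p v = - (transpose (R p) *v dM \<A> Nt p v)"

lemma dM_Nt: "dM \<A> Nt p v = - (R p *v shape_vector p v)"
  using orthogonal_matrix_mult_transpose[OF orthogonal_R, of p "dM \<A> Nt p v"]
  by (simp add: shape_vector_def linear_neg[OF matrix_vector_mul_linear])

text \<open>Differentiating \<open>Nt = R N\<close> expresses the new second fundamental form by the
  old one and the mixed part of the connection form.\<close>

lemma shape_vector_inner: "shape_vector p v \<bullet> e = \<kappa> p v e + df p (A p v) \<bullet> e"
proof -
  have "Nt = (\<lambda>q. R q *v N q)" by (simp add: frame_N)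
  then have "dM \<A> Nt p v = R p *v dM \<A> N p v + dR p v *v N p"
    using dM_matrix_vector[OF smooth_R smooth_N, of p v] by simp
  moreover have "shape_vector p v \<bullet> e = - (dM \<A> Nt p v \<bullet> (R p *v e))"
    by (simp only: shape_vector_def inner_minus_left transpose_mult_inner)
  moreover have "(dR p v *v N p) \<bullet> (R p *v e) = - \<kappa> p v e"
    using dR_mixed[of p e v "N p"] by (simp add: kappa_N inner_commute)
  ultimately show ?thesis
    by (simp add: dM_N inner_diff_left linear_neg[OF matrix_vector_mul_linear] R_inner)
qed

text \<open>For tangent test vectors the hypothesis on bivectors is \<open>kappa_flat\<close>;
  general test vectors may be projected, since both maps have tangent values.\<close>

lemma shape_vector_eq_or_uminus:
  "(\<forall>v. shape_vector p v = df p (A p v)) \<or> (\<forall>v. shape_vector p v = - df p (A p v))"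
proof (rule exterior_square_eq_imp_eq_or_uminus)
  have "dim (range (\<lambda>v. df p (A p v))) = dim (range (A p))"
    using dim_image_eq[OF linear_df, of p "range (A p)"] inj_df[of p]
    by (simp add: image_image inj_on_subset)
  then show "dim (range (\<lambda>v. df p (A p v))) \<ge> 3" using rank by simp
next
  fix x y e
  let ?c = "shape_vector p" and ?a = "\<lambda>v. df p (A p v)"
  have tangent: "(?c y \<bullet> e) * (?c x \<bullet> e') - (?c x \<bullet> e) * (?c y \<bullet> e') = (?a y \<bullet> e) * (?a x \<bullet> e') - (?a x \<bullet> e) * (?a y \<bullet> e')"
    if "N p \<bullet> e = 0" "N p \<bullet> e' = 0" for e e'
    using kappa_flat[OF that, of x y] by (simp add: shape_vector_inner algebra_simps)
  have "?c v \<bullet> N p = 0" for v by (simp add: shape_vector_inner kappa_N)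
  then have proj: "?c v \<bullet> z = ?c v \<bullet> df p (tang p z)" "?a v \<bullet> z = ?a v \<bullet> df p (tang p z)" for v z
    by (simp_all add: df_tang inner_diff_right)
  show "(?c y \<bullet> e) *\<^sub>R ?c x - (?c x \<bullet> e) *\<^sub>R ?c y = (?a y \<bullet> e) *\<^sub>R ?a x - (?a x \<bullet> e) *\<^sub>R ?a y"
  proof (rule vector_eq_rdot[THEN iffD1], rule allI)
    fix z
    show "((?c y \<bullet> e) *\<^sub>R ?c x - (?c x \<bullet> e) *\<^sub>R ?c y) \<bullet> z = ((?a y \<bullet> e) *\<^sub>R ?a x - (?a x \<bullet> e) *\<^sub>R ?a y) \<bullet> z"
      using tangent[of "df p (tang p e)" "df p (tang p z)"]
      by (simp add: inner_diff_left proj[of _ e] proj[of _ z])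
  qed
qed

lemma dM_Nt_eq_or_uminus:
  "(\<forall>v. dM \<A> Nt p v = - dM \<A> ft p (inv (Q p) (A p v))) \<or> (\<forall>v. dM \<A> Nt p v = dM \<A> ft p (inv (Q p) (A p v)))"
  using shape_vector_eq_or_uminus[of p]
  by (auto simp: dM_Nt linear_neg[OF matrix_vector_mul_linear] R_df)

text \<open>The normal component of \<open>dR_codazzi\<close> says that
  \<open>shape_vector p v \<bullet> df p (Q p w)\<close> is symmetric in \<open>v\<close> and
  \<open>w\<close>. Replacing the shape vector by plus or minus \<open>df p (A p v)\<close> leaves
  the symmetry that is equivalent to commutation.\<close>

lemma commute: "Q p (A p v) = A p (Q p v)"
proof (rule df_cong)
  fix w
  have "Nt p \<bullet> (dR p v *v df p (Q p w) - dR p w *v df p (Q p v)) = met p (A p w) (Q p v) - met p (A p v) (Q p w)"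
    unfolding dR_codazzi using norm_Nt[of p] by (simp add: dot_square_norm)
  then have "shape_vector p v \<bullet> df p (Q p w) = shape_vector p w \<bullet> df p (Q p v)"
    by (simp add: shape_vector_inner \<kappa>_def inner_diff_right met_eq)
  then have "met p (A p v) (Q p w) = met p (A p w) (Q p v)"
    using shape_vector_eq_or_uminus[of p] by (auto simp: met_eq)
  then show "df p (Q p (A p v)) \<bullet> df p w = df p (A p (Q p v)) \<bullet> df p w"
    using met_Q[of p "A p v" w] met_A[of p w "Q p v"] by (simp add: met_eq inner_commute)
qed

lemma tensor_inv_Q_A: "tensor_field_11 \<A> (\<lambda>p v. inv (Q p) (A p v))"
  using tensor_inv_Q tensor_A linear_compose[OF linear_A linear_inv_Q]
  by (simp add: tensor_field_11_def o_def)

text \<open>The sets where either sign holds are closed and cover the connected manifold. They are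
  disjoint because a common point would force \<open>A p = 0\<close>, against the rank.\<close>

lemma dM_Nt_globally:
  "(\<forall>p v. dM \<A> Nt p v = - dM \<A> ft p (inv (Q p) (A p v))) \<or> (\<forall>p v. dM \<A> Nt p v = dM \<A> ft p (inv (Q p) (A p v)))"
proof -
  let ?B = "\<lambda>p v. dM \<A> ft p (inv (Q p) (A p v))"
  define P where "P s = {p. \<forall>v. dM \<A> Nt p v = s *\<^sub>R ?B p v}" for s :: real
  have "closed (P s)" for s
  proof -
    \<comment> \<open>Tangent vectors are parametrized by constant ambient vectors \<open>e\<close>:
      each \<open>tang p e\<close> is a smooth field, so each condition compares two continuous
      functions.\<close>
    have "P s = (\<Inter>e. {p. dM \<A> Nt p (tang p e) = s *\<^sub>R ?B p (tang p e)})"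
      unfolding P_def by (auto intro: tang_df[symmetric]) (metis tang_df)
    moreover have "closed {p. dM \<A> Nt p (tang p e) = s *\<^sub>R ?B p (tang p e)}" for e
    proof (rule closed_Collect_eq)
      note T = smooth_tang[OF smooth_map_const, of e]
      have T': "smooth_vector_field \<A> (\<lambda>p. inv (Q p) (A p (tang p e)))"
        using tensor_inv_Q_A T by (simp add: tensor_field_11_def)
      show "continuous_on UNIV (\<lambda>p. dM \<A> Nt p (tang p e))"
        by (rule smooth_map_continuous[OF smooth_map_dM_field[OF smooth_Nt T]])
      show "continuous_on UNIV (\<lambda>p. s *\<^sub>R ?B p (tang p e))"
        by (rule smooth_map_continuous[OF smooth_map_scaleR[OF smooth_map_const smooth_map_dM_field[OF smooth_ft T']]])
    qed
    ultimately show ?thesis by auto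
  qed
  moreover have "UNIV \<subseteq> P (-1) \<union> P 1" using dM_Nt_eq_or_uminus by (auto simp: P_def)
  moreover have "P (-1) \<inter> P 1 = {}"
  proof (rule ccontr)
    assume "P (-1) \<inter> P 1 \<noteq> {}"
    then obtain p where "p \<in> P (-1)" "p \<in> P 1" by blast
    then have *: "dM \<A> Nt p v = - ?B p v" "dM \<A> Nt p v = ?B p v" for v
      by (simp_all add: P_def)
    have "?B p v = 0" for v
    proof -
      have "2 *\<^sub>R ?B p v = ?B p v - - ?B p v" by (simp add: scaleR_2)
      also have "\<dots> = dM \<A> Nt p v - dM \<A> Nt p v"
        by (rule arg_cong2[where f = minus, OF *(2)[symmetric] *(1)[symmetric]])
      finally show ?thesis by simp
    qed
    then have "inv (Q p) (A p v) = 0" for v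
      using inj_dft[of p] linear_0[OF linear_dft, of p] by (metis injD)
    then have "A p v = 0" for v using Q_inv[of p "A p v"] linear_0[OF linear_Q, of p] by simp
    then have "range (A p) \<subseteq> {0}" by auto
    then have "dim (range (A p)) = 0" by (simp add: dim_eq_0)
    then show False using rank[of p] by linarith
  qed
  ultimately have "P (-1) = {} \<or> P 1 = {}"
    using connected_M unfolding connected_closed by blast
  then have "P 1 = UNIV \<or> P (-1) = UNIV" using \<open>UNIV \<subseteq> P (-1) \<union> P 1\<close> by blast
  then show ?thesis by (auto simp: P_def)
qed

text \<open>The factor \<open>s\<close> serves both signs at once. Self-adjointness for the new
  metric is where commutation of \<open>Q\<close> and \<open>A\<close> is used.\<close>

lemma shape_operatorI:
  assumes "\<And>p v. dM \<A> Nt p v = - (s *\<^sub>R dM \<A> ft p (inv (Q p) (A p v)))"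
  shows "shape_operator \<A> met' ft Nt (\<lambda>p v. s *\<^sub>R inv (Q p) (A p v))"
  unfolding shape_operator_def
proof (intro conjI allI)
  note T = tensor_inv_Q_A[unfolded tensor_field_11_def]
  show "tensor_field_11 \<A> (\<lambda>p v. s *\<^sub>R inv (Q p) (A p v))"
    unfolding tensor_field_11_def
  proof (intro conjI allI impI)
    show "linear (\<lambda>v. s *\<^sub>R inv (Q p) (A p v))" for p
      using linear_compose_scale_right[of "\<lambda>v. inv (Q p) (A p v)" s] T by blast
    fix X assume "smooth_vector_field \<A> X"
    then have "smooth_vector_field \<A> (\<lambda>p. inv (Q p) (A p (X p)))" using T by blast
    then have "smooth_map \<A> (\<lambda>p. s *\<^sub>R df p (inv (Q p) (A p (X p))))"
      by (intro smooth_map_scaleR smooth_map_const smooth_df)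
    then show "smooth_vector_field \<A> (\<lambda>p. s *\<^sub>R inv (Q p) (A p (X p)))"
      by (intro smooth_vector_fieldI) (simp add: linear_scale[OF linear_df])
  qed
  show "self_adjoint_field met' (\<lambda>p v. s *\<^sub>R inv (Q p) (A p v))"
    unfolding self_adjoint_field_def
  proof (intro allI)
    fix p v w
    have "df p (A p v) \<bullet> df p (Q p w) = df p (Q p v) \<bullet> df p (A p w)"
      using met_Q[of p "A p v" w] met_A[of p "Q p v" w] commute[of p v] by (simp add: met_eq)
    then show "met' p (s *\<^sub>R inv (Q p) (A p v)) w = met' p v (s *\<^sub>R inv (Q p) (A p w))"
      by (simp add: met'_eq linear_scale[OF linear_Q] linear_scale[OF linear_df])
  qed
  show "dM \<A> Nt p v = - dM \<A> ft p (s *\<^sub>R inv (Q p) (A p v))" for p v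
    by (simp add: assms linear_scale[OF linear_dft])
qed

text \<open>With this sign the shape vector is \<open>df p (A p v)\<close>, so
  \<open>\<kappa>\<close> vanishes by \<open>shape_vector_inner\<close>, and \<open>\<kappa>\<close>
  determines the derivative of \<open>R\<close>.\<close>

lemma frame_constant:
  assumes Nt: "\<And>p v. dM \<A> Nt p v = - dM \<A> ft p (inv (Q p) (A p v))"
  shows "R p = R q"
proof (rule dM_zero_imp_const[OF connected_M smooth_R])
  fix p v
  have "shape_vector p v \<bullet> e = df p (A p v) \<bullet> e" for e
  proof -
    have "R p *v shape_vector p v = R p *v df p (A p v)" using Nt[of p v] by (simp add: dM_Nt R_df)
    then show ?thesis using R_inner[of p "shape_vector p v" e] R_inner[of p "df p (A p v)" e] by simp
  qed
  then have "\<kappa> p v e = 0" for e using shape_vector_inner[of p v e] by simp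
  then have "dR p v *v e = 0" for e by (intro R_ext[of p]) (simp add: dR_mixed)
  then show "dR p v = 0" by (simp add: matrix_eq)
qed

text \<open>Once \<open>R\<close> is a constant matrix \<open>T\<close>, the differential of
  \<open>ft\<close> is \<open>T\<close> applied to that of \<open>F\<close>, so
  \<open>ft - T F\<close> is constant and supplies the translation.\<close>

lemma congruentI:
  assumes Nt: "\<And>p v. dM \<A> Nt p v = - dM \<A> ft p (inv (Q p) (A p v))"
    and F: "smooth_map \<A> F" and dF: "\<And>p v. dM \<A> F p v = df p (Q p v)"
  shows "\<exists>\<tau>. euclidean_isometry \<tau> \<and> ft = \<tau> \<circ> F"
proof -
  fix p0 :: 'm
  define T where "T = R p0"
  have T: "R p = T" for p unfolding T_def by (rule frame_constant[OF Nt])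
  let ?T = "\<lambda>x. T *v x"
  have "bounded_linear ?T" by simp
  note TF = smooth_map_linear[OF this F] and dTF = dM_linear[OF this F]
  have const: "ft p - T *v F p = ft p0 - T *v F p0" for p
  proof (rule dM_zero_imp_const[OF connected_M smooth_map_diff[OF smooth_ft TF]])
    show "dM \<A> (\<lambda>p. ft p - T *v F p) p v = 0" for p v
      unfolding dM_diff[OF smooth_ft TF] dTF dF using R_df[of p "Q p v"] by (simp add: T)
  qed
  define \<tau> where "\<tau> x = T *v x + (ft p0 - T *v F p0)" for x
  have inner: "?T x \<bullet> ?T y = x \<bullet> y" for x y using R_inner[of p0] by (simp add: T_def)
  have "surj \<tau>"
  proof (rule surjI)
    show "\<tau> (transpose T *v (y - (ft p0 - T *v F p0))) = y" for y
      using orthogonal_matrix_mult_transpose[OF orthogonal_R[of p0]] by (simp add: \<tau>_def T_def)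
  qed
  moreover have "dist (\<tau> x) (\<tau> y) = dist x y" for x y
  proof -
    have "\<tau> x - \<tau> y = T *v (x - y)" by (simp add: \<tau>_def matrix_vector_mult_diff_distrib)
    then show ?thesis using inner[of "x - y" "x - y"] by (simp add: dist_norm norm_eq)
  qed
  moreover have "ft = \<tau> \<circ> F" using const by (auto simp: \<tau>_def algebra_simps)
  ultimately show ?thesis unfolding euclidean_isometry_def by blast
qed

end

section \<open>Conclusions for an immersion without a chosen normal\<close>

context dual_immersion
begin

lemma commute: "Q p (A p v) = A p (Q p v)"
proof -
  obtain Nt where "unit_normal_field \<A> ft Nt" using unit_normal_exists by blast
  then interpret framed_immersion \<A> met nabla f N A met' Q ft Nt by unfold_locales
  show ?thesis by (rule commute)
qed

lemma shape_operators:
  assumes "unit_normal_field \<A> ft Nt"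
  shows "shape_operator \<A> met' ft Nt (\<lambda>p v. inv (Q p) (A p v)) \<or>
    shape_operator \<A> met' ft Nt (\<lambda>p v. - inv (Q p) (A p v))"
proof -
  interpret framed_immersion \<A> met nabla f N A met' Q ft Nt by unfold_locales (rule assms)
  show ?thesis using dM_Nt_globally shape_operatorI[of 1] shape_operatorI[of "-1"] by auto
qed

lemma congruent:
  assumes F: "smooth_map \<A> F" and dF: "\<And>p v. dM \<A> F p v = df p (Q p v)"
  shows "\<exists>\<tau>. euclidean_isometry \<tau> \<and> ft = \<tau> \<circ> F"
proof -
  obtain N1 where N1: "unit_normal_field \<A> ft N1" using unit_normal_exists by blast
  interpret N1: framed_immersion \<A> met nabla f N A met' Q ft N1 by unfold_locales (rule N1)
  show ?thesis using N1.dM_Nt_globally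
  proof
    assume "\<forall>p v. dM \<A> N1 p v = - dM \<A> ft p (inv (Q p) (A p v))"
    then show ?thesis by (intro N1.congruentI[OF _ F dF]) blast
  next
    assume plus: "\<forall>p v. dM \<A> N1 p v = dM \<A> ft p (inv (Q p) (A p v))"
    \<comment> \<open>Reversing the normal changes the sign, which brings the second case under
      \<open>congruentI\<close>.\<close>
    have "unit_normal_field \<A> ft (\<lambda>p. - N1 p)"
      using N1 smooth_map_minus[of N1] by (simp add: unit_normal_field_def)
    then interpret N2: framed_immersion \<A> met nabla f N A met' Q ft "\<lambda>p. - N1 p" by unfold_locales
    show ?thesis
      by (rule N2.congruentI[OF _ F dF]) (simp add: dM_minus[OF N1.smooth_Nt] plus)
  qed
qed

end

lemma euclidean_isometry_comp_inv:
  assumes "euclidean_isometry \<tau>" "euclidean_isometry \<sigma>"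
  shows "euclidean_isometry (\<tau> \<circ> inv \<sigma>)" "inv \<sigma> \<circ> \<sigma> = id"
proof -
  have \<sigma>: "surj \<sigma>" "\<And>x y. dist (\<sigma> x) (\<sigma> y) = dist x y" using assms(2) by (auto simp: euclidean_isometry_def)
  have inj: "inj \<sigma>" by (rule injI) (metis \<sigma>(2) dist_eq_0_iff)
  then show "inv \<sigma> \<circ> \<sigma> = id" by simp
  have "dist (inv \<sigma> x) (inv \<sigma> y) = dist x y" for x y
    using \<sigma>(2)[of "inv \<sigma> x" "inv \<sigma> y"] by (simp add: surj_f_inv_f[OF \<sigma>(1)])
  moreover have "surj (inv \<sigma>)" using inj by (rule inj_imp_surj_inv)
  ultimately show "euclidean_isometry (\<tau> \<circ> inv \<sigma>)"
    using assms(1) comp_surj[of "inv \<sigma>" \<tau>] by (simp add: euclidean_isometry_def)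
qed

theorem theorem1:
  fixes \<A> :: "('m::{t2_space, second_countable_topology}, 'n::finite) chart set"
    and met met' :: "'m \<Rightarrow> real ^ 'n \<Rightarrow> real ^ 'n \<Rightarrow> real"
    and nabla :: "('m \<Rightarrow> real ^ 'n) \<Rightarrow> ('m \<Rightarrow> real ^ 'n) \<Rightarrow> ('m \<Rightarrow> real ^ 'n)"
    and f N :: "'m \<Rightarrow> real ^ 'k::finite"
    and A Q :: "'m \<Rightarrow> real ^ 'n \<Rightarrow> real ^ 'n"
  assumes "CARD('k) = CARD('n) + 1"
    and "smooth_atlas \<A>"
    and "connected (UNIV :: 'm set)" and "simply_connected (UNIV :: 'm set)"
    and "riemannian_metric \<A> met"
    and "levi_civita_connection \<A> met nabla"
    and "isometric_immersion \<A> met f"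
    and "unit_normal_field \<A> f N"
    and "shape_operator \<A> met f N A"
    and "codazzi_tensor \<A> met nabla Q" and "\<And>p. bij (Q p)"
    and "\<And>p v w. met' p v w = met p (Q p (Q p v)) w"
    and "\<And>p. dim (range (A p)) \<ge> 3"
  shows
    "((\<exists>ft :: 'm \<Rightarrow> real ^ 'k. isometric_immersion \<A> met' ft) \<longleftrightarrow> (\<forall>p. Q p \<circ> A p = A p \<circ> Q p)) \<and>
     (\<forall>ft :: 'm \<Rightarrow> real ^ 'k. isometric_immersion \<A> met' ft \<longrightarrow>
        rigid \<A> met' ft \<and>
        (\<exists>Nt. unit_normal_field \<A> ft Nt) \<and>
        (\<forall>Nt. unit_normal_field \<A> ft Nt \<longrightarrow>
           shape_operator \<A> met' ft Nt (\<lambda>p v. inv (Q p) (A p v)) \<or>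
           shape_operator \<A> met' ft Nt (\<lambda>p v. - inv (Q p) (A p v)))) \<and>
     ((\<forall>p. Q p \<circ> A p = A p \<circ> Q p) \<longrightarrow>
        (\<exists>g h :: 'm \<Rightarrow> real. smooth_map \<A> g \<and> smooth_map \<A> h \<and>
           (\<forall>p. A p (grad \<A> met g p) = - grad \<A> met h p) \<and>
           (\<forall>X. smooth_vector_field \<A> X \<longrightarrow>
              (\<forall>p. Q p (X p) = nabla X (grad \<A> met g) p - h p *\<^sub>R A p (X p))) \<and>
           (let F = (\<lambda>p. dM \<A> f p (grad \<A> met g p) + h p *\<^sub>R N p) in
              \<forall>ft :: 'm \<Rightarrow> real ^ 'k. isometric_immersion \<A> met' ft \<longrightarrow>
                (\<exists>\<tau>. euclidean_isometry \<tau> \<and> ft = \<tau> \<circ> F))))"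
proof -
  interpret codazzi_hypersurface \<A> met nabla f N A met' Q
    using assms by unfold_locales
  have dual: "dual_immersion \<A> met nabla f N A met' Q ft" if "isometric_immersion \<A> met' ft" for ft :: "'m \<Rightarrow> real ^ 'k"
    using that by unfold_locales
  have comm_iff: "(\<forall>p. Q p \<circ> A p = A p \<circ> Q p) \<longleftrightarrow> (\<forall>p v. Q p (A p v) = A p (Q p v))"
    by (simp add: fun_eq_iff)
  have comm: "\<forall>p v. Q p (A p v) = A p (Q p v)" if "isometric_immersion \<A> met' ft" for ft :: "'m \<Rightarrow> real ^ 'k"
    using dual_immersion.commute[OF dual[OF that]] by blast
  \<comment> \<open>Existence of \<open>ft\<close> forces commutation, hence supplies
    \<open>F\<close>; both immersions are congruent to this \<open>F\<close>, and
    \<open>\<tau>\<close> after the inverse of \<open>\<sigma>\<close> carries one to the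
    other.\<close>
  have rigid: "rigid \<A> met' ft" if ft: "isometric_immersion \<A> met' ft" for ft :: "'m \<Rightarrow> real ^ 'k"
    unfolding rigid_def
  proof (intro allI impI)
    fix ft' :: "'m \<Rightarrow> real ^ 'k" assume ft': "isometric_immersion \<A> met' ft'"
    obtain F where F: "smooth_map \<A> F" "\<And>p v. dM \<A> F p v = df p (Q p v)"
      using commuting_imp_immersion comm[OF ft] by blast
    obtain \<sigma> where \<sigma>: "euclidean_isometry \<sigma>" "ft = \<sigma> \<circ> F"
      using dual_immersion.congruent[OF dual[OF ft] F] by blast
    obtain \<tau> where \<tau>: "euclidean_isometry \<tau>" "ft' = \<tau> \<circ> F"
      using dual_immersion.congruent[OF dual[OF ft'] F] by blast
    have "ft' = (\<tau> \<circ> inv \<sigma>) \<circ> ft"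
      using euclidean_isometry_comp_inv(2)[OF \<sigma>(1) \<sigma>(1)] by (simp add: \<sigma>(2) \<tau>(2) fun_eq_iff)
    then show "\<exists>\<tau>. euclidean_isometry \<tau> \<and> ft' = \<tau> \<circ> ft"
      using euclidean_isometry_comp_inv(1)[OF \<tau>(1) \<sigma>(1)] by blast
  qed
  have i: "(\<exists>ft :: 'm \<Rightarrow> real ^ 'k. isometric_immersion \<A> met' ft) \<longleftrightarrow> (\<forall>p. Q p \<circ> A p = A p \<circ> Q p)"
    unfolding comm_iff using comm commuting_imp_immersion isometric_immersionI by metis
  have ii: "\<exists>g h :: 'm \<Rightarrow> real. smooth_map \<A> g \<and> smooth_map \<A> h \<and>
           (\<forall>p. A p (grad \<A> met g p) = - grad \<A> met h p) \<and>
           (\<forall>X. smooth_vector_field \<A> X \<longrightarrow>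
              (\<forall>p. Q p (X p) = nabla X (grad \<A> met g) p - h p *\<^sub>R A p (X p))) \<and>
           (let F = (\<lambda>p. dM \<A> f p (grad \<A> met g p) + h p *\<^sub>R N p) in
              \<forall>ft :: 'm \<Rightarrow> real ^ 'k. isometric_immersion \<A> met' ft \<longrightarrow>
                (\<exists>\<tau>. euclidean_isometry \<tau> \<and> ft = \<tau> \<circ> F))"
    if c: "\<forall>p. Q p \<circ> A p = A p \<circ> Q p"
  proof -
    obtain F where F: "smooth_map \<A> F" "\<And>p v. dM \<A> F p v = df p (Q p v)"
      using commuting_imp_immersion c unfolding comm_iff by blast
    obtain g h :: "'m \<Rightarrow> real" where gh: "smooth_map \<A> g" "smooth_map \<A> h"
      "\<forall>p. A p (grad \<A> met g p) = - grad \<A> met h p"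
      "\<forall>X. smooth_vector_field \<A> X \<longrightarrow> (\<forall>p. Q p (X p) = nabla X (grad \<A> met g) p - h p *\<^sub>R A p (X p))"
      "\<forall>p. df p (grad \<A> met g p) + h p *\<^sub>R N p = F p"
      using support_functions[OF F] by blast
    have FE: "(\<lambda>p. dM \<A> f p (grad \<A> met g p) + h p *\<^sub>R N p) = F" using gh(5) by blast
    have "\<forall>ft :: 'm \<Rightarrow> real ^ 'k. isometric_immersion \<A> met' ft \<longrightarrow> (\<exists>\<tau>. euclidean_isometry \<tau> \<and> ft = \<tau> \<circ> F)"
      using dual_immersion.congruent[OF dual F] by blast
    then show ?thesis
      by (intro exI[of _ g] exI[of _ h] conjI gh(1-4)) (simp only: Let_def FE)
  qed
  show ?thesis
    using i rigid ii dual_immersion.unit_normal_exists[OF dual] dual_immersion.shape_operators[OF dual] by blast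
qed

end
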